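(* Let $\psi:\mathcal{U}\subset\mathcal{A}\to\mathcal{A}$ be a conformal map, and $\theta_1,\theta_2:\mathcal{U}\to\mathbb{R}$ be such that $\psi=\theta_1+\sigma\theta_2$; suppose that $\lambda,\mu:\mathcal{U}\to\mathbb{R}$ are solutions of $$\partial_u\mu=-\lambda\,\partial_u\theta_2,\qquad\partial_v\lambda=-\mu\,\partial_v\theta_2$$ such that $\lambda\mu\neq0$, and, for a sign $\epsilon\in\{+1,-1\}$, define $$\underline{N_1}=\epsilon\frac{e^{\theta_1}}{\sqrt2}\left(\frac1\lambda+\sigma\frac1\mu\right)\qquad\text{and}\qquad\underline{N_2}=\frac{e^{-\theta_1}}{\sqrt2}\left(\frac1\lambda-\sigma\frac1\mu\right).$$ Then, if $g:\mathcal{U}\to Spin(2,2)\subset\mathbb{H}_0$ is a conformal map solving $$g'g^{-1}=\cosh\psi\,J+i\sinh\psi\,K\ \ (\text{if }\epsilon=+1)\qquad\text{or}\qquad g'g^{-1}=\sinh\psi\,J+i\cosh\psi\,K\ \ (\text{if }\epsilon=-1),$$ and if we set $$\xi:=ig^{-1}\left[\frac{w_2-w_1}{\sqrt2}J+\frac{w_2+w_1}{\sqrt2}iK\right]\widehat g,$$ where $w_1,w_2:T\mathcal{U}\to\mathbb{R}$ are the dual forms of $\underline{N_1},\underline{N_2}\in\Gamma(T\mathcal{U})$, the function $F=\int\xi$ defines a Lorentzian immersion $\mathcal{U}\to\mathbb{R}^{2,2}$ with $K=K_N=0$ and $\Delta>0$. Reciprocally, the Lorentzian immersions of a surface $M$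 into $\mathbb{R}^{2,2}$ such that $K=K_N=0$, $\Delta>0$ and with regular Gauss map are locally of this form.
   Context: Algebra. $\mathbb{R}^{2,2}$ is $\mathbb{R}^4$ with metric $-dx_0^2+dx_1^2-dx_2^2+dx_3^2$. $\mathcal{A}=\{u+\sigma v:u,v\in\mathbb{R}\}$, $\sigma^2=1$, $\mathcal{A}_{\mathbb{C}}=\mathcal{A}\otimes\mathbb{C}$ ($i$ is the imaginary unit of $\mathbb{C}$). $\mathbb{H}^{\mathcal{A}_{\mathbb{C}}}$ is the algebra of quaternions $\zeta=\zeta_01+\zeta_1I+\zeta_2J+\zeta_3K$ with $\zeta_j\in\mathcal{A}_{\mathbb{C}}$, $I^2=J^2=K^2=-1$, $IJ=-JI=K$; $\widehat{\zeta}$ is obtained by replacing each coefficient $u+\sigma v$ ($u,v\in\mathbb{C}$) by $u-\sigma v$. $\mathbb{H}_0=\{p_01+ip_1I+p_2J+ip_3K:p_j\in\mathcal{A}\}$, $\mathbb{H}_1=\{iq_01+q_1I+iq_2J+q_3K:q_j\in\mathcal{A}\}$. On $\mathbb{H}_0$, $H(p,p')=p_0p_0'-p_1p_1'+p_2p_2'-p_3p_3'\in\mathcal{A}$; $Spin(2,2)=\{p\in\mathbb{H}_0:H(p,p)=1\}$. $\mathbb{R}^{2,2}$ is identified with $\{\sigma i x_01+x_1I+ix_2J+x_3K:x_j\in\mathbb{R}\}\subset\mathbb{H}_1$. For $a=u+\sigma v\in\mathcal{A}$, $\cosh a=\cosh u\cosh v+\sigma\sinh u\sinh v$, $\sinh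 a=\sinh u\cosh v+\sigma\cosh u\sinh v$. $\mathcal{U}$ is a simply connected open subset of $\mathcal{A}$ with coordinate $a=u+\sigma v$. A smooth map $\psi$ from $\mathcal{U}$ to $\mathcal{A}$ or $\mathcal{A}^n$ (e.g. to $\mathbb{H}_0\simeq\mathcal{A}^4$) is conformal if $\partial_v\psi=\sigma\,\partial_u\psi$; then $d\psi=\psi'\,da$ with $da=du+\sigma dv$, $\psi'=\partial_u\psi$. An $\mathcal{A}$-valued function $x+\sigma y$ on $\mathcal{U}$ is identified with the vector field $x\partial_u+y\partial_v$. $F=\int\xi$ means $dF=\xi$. For a Lorentzian surface in $\mathbb{R}^{2,2}$, $K$ is the Gauss curvature, $K_N$ the curvature of the normal bundle; the Gauss map $G$ sends $x$ to $u_1\wedge u_2\in\Lambda^2\mathbb{R}^{2,2}$, $(u_1,u_2)$ a positively oriented orthogonal basis of $T_xM$ with $|u_1|^2=-|u_2|^2=-1$; it is regular if $dG_x$ is injective for all $x$. $\Delta=\det_g\delta$ is the determinant with respect to the induced metric of the quadratic form $\delta(u)=\frac12dG_x(u)\wedge dG_x(u)\in\Lambda^4\mathbb{R}^{2,2}\simeq\mathbb{R}$ (via the canonical volume element $e_0\wedge e_1\wedge e_2\wedge e_3$). *)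

theory Defs
  imports "HOL-Analysis.Analysis"
begin

section \<open>Split-complex numbers\<close>

text \<open>\<^term>\<open>SC u v\<close> stands for $u + \sigma v$ with $\sigma^2 = 1$. The norm is
  $|u| + |v|$: it induces the product topology and is submultiplicative (the Euclidean one is not).\<close>

datatype 'a splitc = SC (sre: 'a) (sim: 'a)

instantiation splitc :: (ab_group_add) ab_group_add
begin
definition "0 = SC 0 0"
definition "a + b = SC (sre a + sre b) (sim a + sim b)"
definition "a - b = SC (sre a - sre b) (sim a - sim b)"
definition "- a = SC (- sre a) (- sim a)"
instance
  by standard (auto simp: zero_splitc_def plus_splitc_def minus_splitc_def uminus_splitc_def
      algebra_simps)
end

instantiation splitc :: (comm_ring_1) comm_ring_1
begin
definition "1 = SC 1 0"
definition "a * b = SC (sre a * sre b + sim a * sim b) (sre a * sim b + sim a * sre b)"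
instance
  by standard (auto simp: zero_splitc_def one_splitc_def plus_splitc_def minus_splitc_def
      times_splitc_def algebra_simps)
end

instantiation splitc :: (real_normed_vector) real_normed_vector
begin
definition "r *\<^sub>R a = SC (r *\<^sub>R sre a) (r *\<^sub>R sim a)"
definition "norm a = norm (sre a) + norm (sim a)"
definition "dist a b = norm (a - b)" for a b :: "'a splitc"
definition "sgn a = inverse (norm a) *\<^sub>R a" for a :: "'a splitc"
definition "(uniformity :: ('a splitc \<times> 'a splitc) filter)
  = (INF e\<in>{0<..}. principal {(x, y). dist x y < e})"
definition "open U \<longleftrightarrow> (\<forall>x\<in>U. \<forall>\<^sub>F (x', y) in uniformity. x' = x \<longrightarrow> y \<in> U)"
  for U :: "'a splitc set"
instance
proof
  fix a b :: "'a splitc"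
  show "(norm a = 0) = (a = 0)"
    by (cases a) (simp add: norm_splitc_def zero_splitc_def add_nonneg_eq_0_iff)
  show "norm (a + b) \<le> norm a + norm b"
    using norm_triangle_ineq[of "sre a" "sre b"] norm_triangle_ineq[of "sim a" "sim b"]
    by (simp add: norm_splitc_def plus_splitc_def)
qed (auto simp: scaleR_splitc_def plus_splitc_def norm_splitc_def dist_splitc_def sgn_splitc_def
      uniformity_splitc_def open_splitc_def algebra_simps)
end

instance splitc :: ("{comm_ring_1, real_normed_algebra_1}") real_normed_algebra_1
proof
  fix a b :: "'a splitc"
  have "norm (a * b) \<le> (norm (sre a) * norm (sre b) + norm (sim a) * norm (sim b))
      + (norm (sre a) * norm (sim b) + norm (sim a) * norm (sre b))"
    unfolding norm_splitc_def times_splitc_def splitc.sel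
    by (intro add_mono order.trans[OF norm_triangle_ineq] norm_mult_ineq)
  then show "norm (a * b) \<le> norm a * norm b"
    by (simp add: norm_splitc_def algebra_simps)
qed (auto simp: scaleR_splitc_def times_splitc_def norm_splitc_def one_splitc_def algebra_simps)

definition sigma :: "'a::comm_ring_1 splitc" (\<open>\<sigma>\<close>) where
  "\<sigma> = SC 0 1"

definition sconj :: "'a::ab_group_add splitc \<Rightarrow> 'a splitc" where
  "sconj a = SC (sre a) (- sim a)"

type_synonym A = "real splitc"
type_synonym AC = "complex splitc"

definition A_cosh :: "A \<Rightarrow> A" where
  "A_cosh a = SC (cosh (sre a) * cosh (sim a)) (sinh (sre a) * sinh (sim a))"

definition A_sinh :: "A \<Rightarrow> A" where
  "A_sinh a = SC (sinh (sre a) * cosh (sim a)) (cosh (sre a) * sinh (sim a))"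

definition AC_of :: "A \<Rightarrow> AC" where
  "AC_of a = SC (of_real (sre a)) (of_real (sim a))"


section \<open>Quaternions over a commutative ring\<close>

datatype 'a quat = Quat (q0: 'a) (q1: 'a) (q2: 'a) (q3: 'a)

instantiation quat :: (ab_group_add) ab_group_add
begin
definition "0 = Quat 0 0 0 0"
definition "p + q = Quat (q0 p + q0 q) (q1 p + q1 q) (q2 p + q2 q) (q3 p + q3 q)"
definition "p - q = Quat (q0 p - q0 q) (q1 p - q1 q) (q2 p - q2 q) (q3 p - q3 q)"
definition "- p = Quat (- q0 p) (- q1 p) (- q2 p) (- q3 p)"
instance
  by standard (auto simp: zero_quat_def plus_quat_def minus_quat_def uminus_quat_def algebra_simps)
end

instantiation quat :: (comm_ring_1) ring_1
begin
definition "1 = Quat 1 0 0 0"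
definition "p * q = Quat
  (q0 p * q0 q - q1 p * q1 q - q2 p * q2 q - q3 p * q3 q)
  (q0 p * q1 q + q1 p * q0 q + q2 p * q3 q - q3 p * q2 q)
  (q0 p * q2 q - q1 p * q3 q + q2 p * q0 q + q3 p * q1 q)
  (q0 p * q3 q + q1 p * q2 q - q2 p * q1 q + q3 p * q0 q)"
instance
  by standard (auto simp: zero_quat_def one_quat_def plus_quat_def minus_quat_def
      times_quat_def algebra_simps)
end

instantiation quat :: (real_normed_vector) real_normed_vector
begin
definition "r *\<^sub>R p = Quat (r *\<^sub>R q0 p) (r *\<^sub>R q1 p) (r *\<^sub>R q2 p) (r *\<^sub>R q3 p)"
definition "norm p = norm (q0 p) + norm (q1 p) + norm (q2 p) + norm (q3 p)"
definition "dist p q = norm (p - q)" for p q :: "'a quat"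
definition "sgn p = inverse (norm p) *\<^sub>R p" for p :: "'a quat"
definition "(uniformity :: ('a quat \<times> 'a quat) filter)
  = (INF e\<in>{0<..}. principal {(x, y). dist x y < e})"
definition "open U \<longleftrightarrow> (\<forall>x\<in>U. \<forall>\<^sub>F (x', y) in uniformity. x' = x \<longrightarrow> y \<in> U)"
  for U :: "'a quat set"
instance
proof
  fix p q :: "'a quat"
  show "(norm p = 0) = (p = 0)"
    by (cases p) (simp add: norm_quat_def zero_quat_def add_nonneg_eq_0_iff)
  show "norm (p + q) \<le> norm p + norm q"
    using norm_triangle_ineq[of "q0 p" "q0 q"] norm_triangle_ineq[of "q1 p" "q1 q"]
      norm_triangle_ineq[of "q2 p" "q2 q"] norm_triangle_ineq[of "q3 p" "q3 q"]
    by (simp add: norm_quat_def plus_quat_def)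
qed (auto simp: scaleR_quat_def plus_quat_def norm_quat_def dist_quat_def sgn_quat_def
      uniformity_quat_def open_quat_def algebra_simps)
end

instance quat :: ("{comm_ring_1, real_normed_algebra_1}") real_normed_algebra_1
proof
  fix p q :: "'a quat"
  have d: "norm (x - y) \<le> B + C" if "norm x \<le> B" "norm y \<le> C" for x y :: 'a and B C
    using norm_triangle_ineq4[of x y] that by linarith
  have s: "norm (x + y) \<le> B + C" if "norm x \<le> B" "norm y \<le> C" for x y :: 'a and B C
    using norm_triangle_ineq[of x y] that by linarith
  let ?n = "\<lambda>x y :: 'a. norm x * norm y"
  have "norm (p * q) \<le>
      (?n (q0 p) (q0 q) + ?n (q1 p) (q1 q) + ?n (q2 p) (q2 q) + ?n (q3 p) (q3 q))
    + (?n (q0 p) (q1 q) + ?n (q1 p) (q0 q) + ?n (q2 p) (q3 q) + ?n (q3 p) (q2 q))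
    + (?n (q0 p) (q2 q) + ?n (q1 p) (q3 q) + ?n (q2 p) (q0 q) + ?n (q3 p) (q1 q))
    + (?n (q0 p) (q3 q) + ?n (q1 p) (q2 q) + ?n (q2 p) (q1 q) + ?n (q3 p) (q0 q))"
    unfolding norm_quat_def times_quat_def quat.sel
    by (intro add_mono d s norm_mult_ineq)
  then show "norm (p * q) \<le> norm p * norm q"
    by (simp add: norm_quat_def algebra_simps)
qed (auto simp: scaleR_quat_def times_quat_def norm_quat_def one_quat_def algebra_simps)

type_synonym HAC = "AC quat"

definition Iq :: HAC where "Iq = Quat 0 1 0 0"
definition Jq :: HAC where "Jq = Quat 0 0 1 0"
definition Kq :: HAC where "Kq = Quat 0 0 0 1"

definition HAC_scalar :: "AC \<Rightarrow> HAC" where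
  "HAC_scalar z = Quat z 0 0 0"

text \<open>The imaginary unit of $\mathbb{C}$ (not the quaternion $I$).\<close>

definition imag :: HAC where
  "imag = HAC_scalar (SC \<i> 0)"

definition HAC_of_A :: "A \<Rightarrow> HAC" where
  "HAC_of_A a = HAC_scalar (AC_of a)"

definition hat :: "HAC \<Rightarrow> HAC" where
  "hat z = Quat (sconj (q0 z)) (sconj (q1 z)) (sconj (q2 z)) (sconj (q3 z))"

definition HAC_inv :: "HAC \<Rightarrow> HAC" where
  "HAC_inv z = (THE y. z * y = 1 \<and> y * z = 1)"

definition h0 :: "A \<Rightarrow> A \<Rightarrow> A \<Rightarrow> A \<Rightarrow> HAC" where
  "h0 p0 p1 p2 p3 = HAC_of_A p0 + imag * HAC_of_A p1 * Iq
     + HAC_of_A p2 * Jq + imag * HAC_of_A p3 * Kq"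

text \<open>The condition $p_0^2 - p_1^2 + p_2^2 - p_3^2 = 1$ is an equation in $\mathcal{A}$.\<close>

definition Spin22 :: "HAC set" where
  "Spin22 = {h0 p0 p1 p2 p3 | p0 p1 p2 p3. p0 * p0 - p1 * p1 + p2 * p2 - p3 * p3 = 1}"


section \<open>The pseudo-Euclidean space of signature (2,2)\<close>

text \<open>Vectors are elements of \<^typ>\<open>real^4\<close> with coordinates indexed by $0,1,2,3$
  (in the index type, $0 = 4$).\<close>

definition ip22 :: "real^4 \<Rightarrow> real^4 \<Rightarrow> real" where
  "ip22 x y = - (x$0 * y$0) + x$1 * y$1 - x$2 * y$2 + x$3 * y$3"

definition r22 :: "real^4 \<Rightarrow> HAC" where
  "r22 x = HAC_scalar \<sigma> * imag * of_real (x$0) + of_real (x$1) * Iq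
     + imag * of_real (x$2) * Jq + of_real (x$3) * Kq"

text \<open>Bivectors are represented by antisymmetric matrices of coefficients, and 4-vectors by their
  coefficient on $e_0 \wedge e_1 \wedge e_2 \wedge e_3$.\<close>

definition wedge1 :: "real^4 \<Rightarrow> real^4 \<Rightarrow> real^4^4" where
  "wedge1 x y = (\<chi> i j. x$i * y$j - x$j * y$i)"

definition wedge2 :: "real^4^4 \<Rightarrow> real^4^4 \<Rightarrow> real" where
  "wedge2 \<omega> \<eta> = \<omega>$0$1 * \<eta>$2$3 - \<omega>$0$2 * \<eta>$1$3 + \<omega>$0$3 * \<eta>$1$2
     + \<omega>$1$2 * \<eta>$0$3 - \<omega>$1$3 * \<eta>$0$2 + \<omega>$2$3 * \<eta>$0$1"


section \<open>Smooth maps\<close>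

text \<open>Meant for open sets in finite-dimensional spaces, where being of class $C^{k+1}$ amounts to
  being differentiable with all directional derivatives of class $C^k$.\<close>

primrec Ck_on :: "nat \<Rightarrow> 'a::real_normed_vector set \<Rightarrow> ('a \<Rightarrow> 'b::real_normed_vector) \<Rightarrow> bool" where
  "Ck_on 0 U f \<longleftrightarrow> continuous_on U f"
| "Ck_on (Suc k) U f \<longleftrightarrow> (\<forall>x\<in>U. f differentiable (at x))
     \<and> (\<forall>h. Ck_on k U (\<lambda>x. frechet_derivative f (at x) h))"

definition smooth_on :: "'a::real_normed_vector set \<Rightarrow> ('a \<Rightarrow> 'b::real_normed_vector) \<Rightarrow> bool" where
  "smooth_on U f \<longleftrightarrow> (\<forall>k. Ck_on k U f)"

definition d_u :: "(A \<Rightarrow> 'b::real_normed_vector) \<Rightarrow> A \<Rightarrow> 'b" where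
  "d_u f a = frechet_derivative f (at a) 1"

definition d_v :: "(A \<Rightarrow> 'b::real_normed_vector) \<Rightarrow> A \<Rightarrow> 'b" where
  "d_v f a = frechet_derivative f (at a) \<sigma>"

definition conformal_A :: "A set \<Rightarrow> (A \<Rightarrow> A) \<Rightarrow> bool" where
  "conformal_A U \<psi> \<longleftrightarrow> smooth_on U \<psi> \<and> (\<forall>a\<in>U. d_v \<psi> a = \<sigma> * d_u \<psi> a)"

definition conformal_H :: "A set \<Rightarrow> (A \<Rightarrow> HAC) \<Rightarrow> bool" where
  "conformal_H U g \<longleftrightarrow> smooth_on U g \<and> (\<forall>a\<in>U. d_v g a = HAC_scalar \<sigma> * d_u g a)"


section \<open>Parametrized Lorentzian surfaces\<close>

text \<open>The parameter domain is an open subset of $\mathcal{A}$, regarded as the plane with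
  coordinates $(u,v)$; its tangent vectors are elements $x + \sigma y$ of $\mathcal{A}$, and its
  orientation is $(\partial_u, \partial_v)$. All quantities below are only meaningful for
  Lorentzian immersions.\<close>

definition tang :: "(A \<Rightarrow> real^4) \<Rightarrow> A \<Rightarrow> A \<Rightarrow> real^4" where
  "tang X a h = frechet_derivative X (at a) h"

definition first_form :: "(A \<Rightarrow> real^4) \<Rightarrow> A \<Rightarrow> A \<Rightarrow> A \<Rightarrow> real" where
  "first_form X a h k = ip22 (tang X a h) (tang X a k)"

text \<open>An orthonormal basis of squared norms $-1$, $1$ exists iff the metric has signature (1,1).\<close>

definition lorentzian_immersion :: "A set \<Rightarrow> (A \<Rightarrow> real^4) \<Rightarrow> bool" where
  "lorentzian_immersion U X \<longleftrightarrow> smooth_on U X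
     \<and> (\<forall>a\<in>U. inj (tang X a)
          \<and> (\<exists>h k. first_form X a h h = -1 \<and> first_form X a k k = 1 \<and> first_form X a h k = 0))"

text \<open>Index 1 stands for the coordinate $u$, index 2 for $v$.\<close>

definition coord :: "2 \<Rightarrow> A" where
  "coord i = (if i = 1 then 1 else \<sigma>)"

definition metric :: "(A \<Rightarrow> real^4) \<Rightarrow> A \<Rightarrow> real^2^2" where
  "metric X a = (\<chi> i j. first_form X a (coord i) (coord j))"

definition d_metric :: "(A \<Rightarrow> real^4) \<Rightarrow> A \<Rightarrow> 2 \<Rightarrow> 2 \<Rightarrow> 2 \<Rightarrow> real" where
  "d_metric X a l i j = frechet_derivative (\<lambda>b. metric X b $ i $ j) (at a) (coord l)"

definition christoffel :: "(A \<Rightarrow> real^4) \<Rightarrow> A \<Rightarrow> 2 \<Rightarrow> 2 \<Rightarrow> 2 \<Rightarrow> real" where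
  "christoffel X a l i j = (1/2) * (\<Sum>m\<in>UNIV. matrix_inv (metric X a) $ l $ m
     * (d_metric X a i j m + d_metric X a j i m - d_metric X a m i j))"

text \<open>The component on $\partial_l$ of $R(\partial_i, \partial_j)\partial_k$, where
  $R(X,Y) = \nabla_X\nabla_Y - \nabla_Y\nabla_X - \nabla_{[X,Y]}$.\<close>

definition riemann :: "(A \<Rightarrow> real^4) \<Rightarrow> A \<Rightarrow> 2 \<Rightarrow> 2 \<Rightarrow> 2 \<Rightarrow> 2 \<Rightarrow> real" where
  "riemann X a i j k l =
     frechet_derivative (\<lambda>b. christoffel X b l j k) (at a) (coord i)
     - frechet_derivative (\<lambda>b. christoffel X b l i k) (at a) (coord j)
     + (\<Sum>m\<in>UNIV. christoffel X a l i m * christoffel X a m j k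
          - christoffel X a l j m * christoffel X a m i k)"

definition gauss_curvature :: "(A \<Rightarrow> real^4) \<Rightarrow> A \<Rightarrow> real" where
  "gauss_curvature X a = (\<Sum>l\<in>UNIV. riemann X a 1 2 2 l * metric X a $ l $ 1) / det (metric X a)"

definition tangent_frame :: "(A \<Rightarrow> real^4) \<Rightarrow> A \<Rightarrow> A \<Rightarrow> A \<Rightarrow> bool" where
  "tangent_frame X a h k \<longleftrightarrow> sre h * sim k - sim h * sre k > 0
     \<and> first_form X a h h = -1 \<and> first_form X a k k = 1 \<and> first_form X a h k = 0"

definition is_normal :: "(A \<Rightarrow> real^4) \<Rightarrow> A \<Rightarrow> real^4 \<Rightarrow> bool" where
  "is_normal X a n \<longleftrightarrow> (\<forall>h. ip22 n (tang X a h) = 0)"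

definition normal_part :: "(A \<Rightarrow> real^4) \<Rightarrow> A \<Rightarrow> real^4 \<Rightarrow> real^4" where
  "normal_part X a w = (THE n. is_normal X a n \<and> w - n \<in> range (tang X a))"

definition normal_deriv :: "(A \<Rightarrow> real^4) \<Rightarrow> A \<Rightarrow> A \<Rightarrow> (A \<Rightarrow> real^4) \<Rightarrow> real^4" where
  "normal_deriv X h a N = normal_part X a (frechet_derivative N (at a) h)"

text \<open>The curvature of the normal connection applied to a normal vector \<open>n\<close> at \<open>a\<close>, computed
  with the constant (hence commuting) parameter fields \<open>h\<close>, \<open>k\<close> and the normal field extending
  \<open>n\<close> obtained by projection.\<close>

definition normal_curv :: "(A \<Rightarrow> real^4) \<Rightarrow> A \<Rightarrow> A \<Rightarrow> A \<Rightarrow> real^4 \<Rightarrow> real^4" where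
  "normal_curv X a h k n = (let N = (\<lambda>b. normal_part X b n) in
     normal_deriv X h a (\<lambda>b. normal_deriv X k b N)
     - normal_deriv X k a (\<lambda>b. normal_deriv X h b N))"

definition normal_frame :: "(A \<Rightarrow> real^4) \<Rightarrow> A \<Rightarrow> A \<Rightarrow> A \<Rightarrow> real^4 \<Rightarrow> real^4 \<Rightarrow> bool" where
  "normal_frame X a h k n1 n2 \<longleftrightarrow> is_normal X a n1 \<and> is_normal X a n2
     \<and> ip22 n1 n1 = -1 \<and> ip22 n2 n2 = 1 \<and> ip22 n1 n2 = 0
     \<and> wedge2 (wedge1 (tang X a h) (tang X a k)) (wedge1 n1 n2) > 0"

text \<open>The value does not depend on the chosen positively oriented orthonormal frames.\<close>

definition normal_curvature :: "(A \<Rightarrow> real^4) \<Rightarrow> A \<Rightarrow> real" where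
  "normal_curvature X a =
     (let (h, k, n1, n2) = SOME (h, k, n1, n2). tangent_frame X a h k \<and> normal_frame X a h k n1 n2
      in ip22 (normal_curv X a h k n1) n2)"

text \<open>Again independent of the chosen frame.\<close>

definition gauss_map :: "(A \<Rightarrow> real^4) \<Rightarrow> A \<Rightarrow> real^4^4" where
  "gauss_map X a = (let (h, k) = SOME (h, k). tangent_frame X a h k
     in wedge1 (tang X a h) (tang X a k))"

definition regular_gauss_map :: "A set \<Rightarrow> (A \<Rightarrow> real^4) \<Rightarrow> bool" where
  "regular_gauss_map U X \<longleftrightarrow> (\<forall>a\<in>U. inj (frechet_derivative (gauss_map X) (at a)))"

definition delta_form :: "(A \<Rightarrow> real^4) \<Rightarrow> A \<Rightarrow> A \<Rightarrow> real" where
  "delta_form X a h = (1/2) * wedge2 (frechet_derivative (gauss_map X) (at a) h)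
     (frechet_derivative (gauss_map X) (at a) h)"

definition polar :: "(A \<Rightarrow> real) \<Rightarrow> A \<Rightarrow> A \<Rightarrow> real" where
  "polar q h k = (q (h + k) - q h - q k) / 2"

text \<open>The determinant of a quadratic form with respect to the metric $g$ is the determinant of the
  endomorphism that corresponds to the form through $g$.\<close>

definition Delta :: "(A \<Rightarrow> real^4) \<Rightarrow> A \<Rightarrow> real" where
  "Delta X a = det ((\<chi> i j. polar (delta_form X a) (coord i) (coord j)) :: real^2^2)
     / det (metric X a)"


section \<open>Abstract surfaces\<close>

definition chart :: "'m topology \<Rightarrow> 'm set \<Rightarrow> ('m \<Rightarrow> A) \<Rightarrow> bool" where
  "chart M V c \<longleftrightarrow> openin M V \<and> open (c ` V)
     \<and> homeomorphic_map (subtopology M V) (top_of_set (c ` V)) c"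

definition compatible :: "'m set \<Rightarrow> ('m \<Rightarrow> A) \<Rightarrow> 'm set \<Rightarrow> ('m \<Rightarrow> A) \<Rightarrow> bool" where
  "compatible V c W d \<longleftrightarrow> smooth_on (c ` (V \<inter> W)) (d \<circ> the_inv_into V c)
     \<and> smooth_on (d ` (V \<inter> W)) (c \<circ> the_inv_into W d)"

definition smooth_surface :: "'m topology \<Rightarrow> ('m set \<times> ('m \<Rightarrow> A)) set \<Rightarrow> bool" where
  "smooth_surface M \<A> \<longleftrightarrow> Hausdorff_space M \<and> second_countable M
     \<and> (\<Union>(V, c)\<in>\<A>. V) = topspace M
     \<and> (\<forall>(V, c)\<in>\<A>. chart M V c)
     \<and> (\<forall>(V, c)\<in>\<A>. \<forall>(W, d)\<in>\<A>. compatible V c W d)"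

definition smooth_chart ::
  "'m topology \<Rightarrow> ('m set \<times> ('m \<Rightarrow> A)) set \<Rightarrow> 'm set \<Rightarrow> ('m \<Rightarrow> A) \<Rightarrow> bool" where
  "smooth_chart M \<A> V c \<longleftrightarrow> chart M V c \<and> (\<forall>(W, d)\<in>\<A>. compatible V c W d)"

text \<open>\<open>P\<close> holds for the local expressions of \<open>F\<close> in all charts of the atlas.\<close>

definition in_charts :: "('m set \<times> ('m \<Rightarrow> A)) set \<Rightarrow> (A set \<Rightarrow> (A \<Rightarrow> 'b) \<Rightarrow> bool) \<Rightarrow> ('m \<Rightarrow> 'b) \<Rightarrow> bool" where
  "in_charts \<A> P F \<longleftrightarrow> (\<forall>(V, c)\<in>\<A>. P (c ` V) (F \<circ> the_inv_into V c))"


section \<open>The representation\<close>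

definition N1_field :: "real \<Rightarrow> (A \<Rightarrow> real) \<Rightarrow> (A \<Rightarrow> real) \<Rightarrow> (A \<Rightarrow> real) \<Rightarrow> A \<Rightarrow> A" where
  "N1_field \<epsilon> \<theta>1 lam mu a = (\<epsilon> * (exp (\<theta>1 a) / sqrt 2)) *\<^sub>R SC (1 / lam a) (1 / mu a)"

definition N2_field :: "(A \<Rightarrow> real) \<Rightarrow> (A \<Rightarrow> real) \<Rightarrow> (A \<Rightarrow> real) \<Rightarrow> A \<Rightarrow> A" where
  "N2_field \<theta>1 lam mu a = (exp (- \<theta>1 a) / sqrt 2) *\<^sub>R SC (1 / lam a) (- (1 / mu a))"

text \<open>A 1-form \<open>w\<close> is evaluated as \<open>w a h\<close> at the point \<open>a\<close> on the tangent vector \<open>h\<close>.\<close>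

definition dual_forms ::
  "A set \<Rightarrow> (A \<Rightarrow> A) \<Rightarrow> (A \<Rightarrow> A) \<Rightarrow> (A \<Rightarrow> A \<Rightarrow> real) \<Rightarrow> (A \<Rightarrow> A \<Rightarrow> real) \<Rightarrow> bool" where
  "dual_forms U N1 N2 w1 w2 \<longleftrightarrow> (\<forall>a\<in>U. linear (w1 a) \<and> linear (w2 a)
     \<and> w1 a (N1 a) = 1 \<and> w1 a (N2 a) = 0 \<and> w2 a (N1 a) = 0 \<and> w2 a (N2 a) = 1)"

definition representation_data :: "A set \<Rightarrow> (A \<Rightarrow> A) \<Rightarrow> (A \<Rightarrow> real) \<Rightarrow> (A \<Rightarrow> real) \<Rightarrow>
    (A \<Rightarrow> real) \<Rightarrow> (A \<Rightarrow> real) \<Rightarrow> real \<Rightarrow> (A \<Rightarrow> HAC) \<Rightarrow> (A \<Rightarrow> A \<Rightarrow> real) \<Rightarrow> (A \<Rightarrow> A \<Rightarrow> real) \<Rightarrow> bool" where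
  "representation_data U \<psi> \<theta>1 \<theta>2 lam mu \<epsilon> g w1 w2 \<longleftrightarrow>
     open U \<and> simply_connected U
     \<and> conformal_A U \<psi> \<and> (\<forall>a\<in>U. \<psi> a = SC (\<theta>1 a) (\<theta>2 a))
     \<and> smooth_on U lam \<and> smooth_on U mu
     \<and> (\<forall>a\<in>U. d_u mu a = - lam a * d_u \<theta>2 a \<and> d_v lam a = - mu a * d_v \<theta>2 a)
     \<and> (\<forall>a\<in>U. lam a * mu a \<noteq> 0)
     \<and> (\<epsilon> = 1 \<or> \<epsilon> = -1)
     \<and> conformal_H U g \<and> g ` U \<subseteq> Spin22
     \<and> (\<epsilon> = 1 \<longrightarrow> (\<forall>a\<in>U. d_u g a * HAC_inv (g a)
            = HAC_of_A (A_cosh (\<psi> a)) * Jq + imag * HAC_of_A (A_sinh (\<psi> a)) * Kq))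
     \<and> (\<epsilon> = -1 \<longrightarrow> (\<forall>a\<in>U. d_u g a * HAC_inv (g a)
            = HAC_of_A (A_sinh (\<psi> a)) * Jq + imag * HAC_of_A (A_cosh (\<psi> a)) * Kq))
     \<and> dual_forms U (N1_field \<epsilon> \<theta>1 lam mu) (N2_field \<theta>1 lam mu) w1 w2"

definition xi_form ::
  "(A \<Rightarrow> HAC) \<Rightarrow> (A \<Rightarrow> A \<Rightarrow> real) \<Rightarrow> (A \<Rightarrow> A \<Rightarrow> real) \<Rightarrow> A \<Rightarrow> A \<Rightarrow> HAC" where
  "xi_form g w1 w2 a h = imag * HAC_inv (g a)
     * (((w2 a h - w1 a h) / sqrt 2) *\<^sub>R Jq + ((w2 a h + w1 a h) / sqrt 2) *\<^sub>R (imag * Kq))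
     * hat (g a)"

definition primitive_of :: "A set \<Rightarrow> (A \<Rightarrow> A \<Rightarrow> HAC) \<Rightarrow> (A \<Rightarrow> real^4) \<Rightarrow> bool" where
  "primitive_of U \<xi> F \<longleftrightarrow> (\<forall>a\<in>U. ((r22 \<circ> F) has_derivative \<xi> a) (at a))"

end

theory Submission
  imports Defs "HOL-Complex_Analysis.Complex_Analysis"
begin

text \<open>
  The space \<open>\<real>\<^sup>2\<^sup>,\<^sup>2\<close> is the tensor product of two copies of the plane \<open>\<real>\<^sup>2\<close>, whose elements are
  called spinors here: a vector is a real \<open>2 \<times> 2\<close> matrix and its squared norm is minus the determinant.
  Correspondingly \<open>Spin(2,2)\<close> is \<open>SL(2,\<real>) \<times> SL(2,\<real>)\<close>: the two factors are the components of a
  split-complex number \<open>p\<close> on the idempotents, \<open>sre p + sim p\<close> and \<open>sre p - sim p\<close>, and a conformal map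
  of the split-complex plane is a pair of functions, one of \<open>s = u + v\<close> and one of \<open>t = u - v\<close>.

  Along a Lorentzian immersion choose unimodular pairs of spinors \<open>x, x'\<close> and \<open>y, y'\<close> such that
  \<open>x \<otimes> y'\<close> and \<open>x' \<otimes> y\<close> are tangent null vectors; then \<open>x \<otimes> y\<close> and \<open>x' \<otimes> y'\<close> are normal null vectors.
  Write \<open>dx = \<omega> x + c x'\<close>, \<open>dx' = b x - \<omega> x'\<close>, and the same with \<open>\<omega>', c', b'\<close> for \<open>y, y'\<close>. The vanishing
  of \<open>ddx\<close> and \<open>ddy\<close> gives \<open>d\<omega> = c \<and> b\<close> and \<open>d\<omega>' = c' \<and> b'\<close>, and all the invariants can be read off:
  the Gauss curvature is a non-zero multiple of \<open>c \<and> b - c' \<and> b'\<close> (Gauss equation), the normal curvature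
  is a non-zero multiple of \<open>c \<and> b + c' \<and> b'\<close> (curvature of the connection \<open>\<omega> + \<omega>'\<close>), and the quadratic
  form \<open>\<delta>\<close> of the Gauss map is \<open>b' c' - b c\<close>. When both curvatures vanish, \<open>\<Delta>\<close> has the sign of
  \<open>(b \<and> b') (c \<and> c')\<close>.

  For the immersions given by the representation formula, the equation satisfied by \<open>g\<close> says exactly that
  \<open>\<omega> = \<omega>' = 0\<close>, that \<open>b, c\<close> are multiples of \<open>ds\<close> and \<open>b', c'\<close> multiples of \<open>dt\<close>, with coefficients
  that are exponentials of \<open>\<theta>\<^sub>1 \<plusminus> \<theta>\<^sub>2\<close> (\<open>frame_forms\<close>). The equations on \<open>\<lambda>, \<mu>\<close> make the form \<open>\<xi>\<close> closed, hence
  exact on the simply connected domain (\<open>closed_form_exact\<close>), and the formulas above give the signs and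
  the zeros of the invariants (\<open>representation_immersion\<close>).

  Conversely, if both curvatures vanish then \<open>c \<and> b = 0 = c' \<and> b'\<close>, so \<open>\<omega>\<close> and \<open>\<omega>'\<close> are closed and can be
  removed by rescaling the spinors (\<open>flat_frame\<close>). Then \<open>b, c\<close> and \<open>b', c'\<close> are closed and proportional:
  \<open>b = \<kappa> c\<close> and \<open>b' = \<kappa>' c'\<close>, where \<open>\<Delta> > 0\<close> says that \<open>c \<and> c' \<noteq> 0\<close> and \<open>\<kappa> \<kappa>' > 0\<close>. Since \<open>d\<kappa>\<close> is a multiple
  of \<open>c\<close>, the forms \<open>\<bar>\<kappa>\<bar>\<^sup>1\<^sup>/\<^sup>2 c\<close> and \<open>\<bar>\<kappa>'\<bar>\<^sup>1\<^sup>/\<^sup>2 c'\<close> are closed as well, and their primitives are, up to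
  sign, the coordinates \<open>s, t\<close> in which the frame satisfies the equation for \<open>g\<close>; \<open>\<epsilon>\<close> is minus the
  sign of \<open>\<kappa>\<close>. The remaining part of the representation, the shape of the dual forms and the equations on
  \<open>\<lambda>, \<mu>\<close>, is the symmetry of the second derivatives of the immersion (\<open>codazzi\<close>,
  \<open>frame_representation\<close>).
\<close>

section \<open>Calculus of smooth maps\<close>

text \<open>The derivative of \<open>f\<close> at \<open>x\<close> in the direction \<open>h\<close>; with \<open>f\<close> fixed, \<open>d_u\<close>, \<open>d_v\<close> and \<open>tang\<close> are
  instances of it.\<close>

abbreviation dd :: "'a::real_normed_vector \<Rightarrow> ('a \<Rightarrow> 'b::real_normed_vector) \<Rightarrow> 'a \<Rightarrow> 'b" where
  "dd h f x \<equiv> frechet_derivative f (at x) h"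

lemma dd_eqI: "(f has_derivative f') (at x) \<Longrightarrow> dd h f x = f' h"
  by (metis frechet_derivative_at)

lemma dd_eqI': "(f has_derivative f') (at x) \<Longrightarrow> f' h = v \<Longrightarrow> dd h f x = v"
  using dd_eqI by metis

lemma dd_cong:
  assumes "open U" "x \<in> U" "\<And>y. y \<in> U \<Longrightarrow> f y = g y"
  shows "dd h f x = dd h g x"
proof -
  have "(f has_derivative F) (at x) \<longleftrightarrow> (g has_derivative F) (at x)" for F
    using has_derivative_transform_within_open[OF _ assms(1,2), of f F UNIV g]
      has_derivative_transform_within_open[OF _ assms(1,2), of g F UNIV f] assms(3) by auto
  then show ?thesis
    by (simp add: frechet_derivative_def)
qed

lemma Ck_on_SucD:
  "Ck_on (Suc k) U f \<Longrightarrow> x \<in> U \<Longrightarrow> (f has_derivative (\<lambda>h. dd h f x)) (at x)"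
  by (simp add: frechet_derivative_works)

lemma Ck_on_cong:
  assumes "open U" "\<And>x. x \<in> U \<Longrightarrow> f x = g x" "Ck_on k U f"
  shows "Ck_on k U g"
  using assms(2,3)
proof (induction k arbitrary: f g)
  case 0
  then show ?case by (simp cong: continuous_on_cong)
next
  case (Suc k)
  have "(g has_derivative (\<lambda>h. dd h f x)) (at x)" if "x \<in> U" for x
    using has_derivative_transform_within_open[OF Ck_on_SucD[OF Suc.prems(2) that] assms(1) that]
      Suc.prems(1) by auto
  moreover have "Ck_on k U (\<lambda>x. dd h g x)" for h
    using Suc.IH[of "\<lambda>x. dd h f x" "\<lambda>x. dd h g x"] Suc.prems dd_cong[OF assms(1), of _ f g]
    by auto
  ultimately show ?case
    by (auto simp: differentiable_def)
qed

lemma Ck_on_SucI: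
  assumes "open U" "\<And>x. x \<in> U \<Longrightarrow> (f has_derivative f' x) (at x)" "\<And>h. Ck_on k U (\<lambda>x. f' x h)"
  shows "Ck_on (Suc k) U f"
proof -
  have "Ck_on k U (\<lambda>x. dd h f x)" for h
    by (rule Ck_on_cong[OF assms(1) _ assms(3)[of h]]) (simp add: dd_eqI[OF assms(2)])
  then show ?thesis
    using assms(2) by (auto simp: differentiable_def)
qed

lemma Ck_on_Suc_imp: "Ck_on (Suc k) U f \<Longrightarrow> Ck_on k U f"
proof (induction k arbitrary: f)
  case 0
  then show ?case
    by (auto intro!: differentiable_imp_continuous_on simp: differentiable_on_def differentiable_at_withinI)
next
  case (Suc k)
  have "Ck_on k U (\<lambda>x. dd h f x)" for h
    using Suc.prems by (intro Suc.IH) auto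
  then show ?case using Suc.prems by simp
qed

lemma Ck_on_const: "Ck_on k U (\<lambda>x. c)"
  by (induction k arbitrary: c) auto

lemma Ck_on_add:
  assumes "open U" shows "Ck_on k U f \<Longrightarrow> Ck_on k U g \<Longrightarrow> Ck_on k U (\<lambda>x. f x + g x)"
proof (induction k arbitrary: f g)
  case 0
  then show ?case by (auto intro: continuous_intros)
next
  case (Suc k)
  show ?case
    by (rule Ck_on_SucI[OF assms, where f' = "\<lambda>x h. dd h f x + dd h g x"])
      (use Suc in \<open>auto intro!: derivative_intros Ck_on_SucD\<close>)
qed

lemma Ck_on_bounded_linear:
  assumes "open U" "bounded_linear L" shows "Ck_on k U f \<Longrightarrow> Ck_on k U (\<lambda>x. L (f x))"
proof (induction k arbitrary: f)
  case 0
  then show ?case using assms(2) by (auto intro: bounded_linear.continuous_on)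
next
  case (Suc k)
  show ?case
    by (rule Ck_on_SucI[OF assms(1), where f' = "\<lambda>x h. L (dd h f x)"])
      (use Suc in \<open>auto intro!: bounded_linear.has_derivative[OF assms(2)] Ck_on_SucD\<close>)
qed

lemma Ck_on_bounded_bilinear:
  assumes "open U" "bounded_bilinear p"
  shows "Ck_on k U f \<Longrightarrow> Ck_on k U g \<Longrightarrow> Ck_on k U (\<lambda>x. p (f x) (g x))"
proof (induction k arbitrary: f g)
  case 0
  then show ?case using bounded_bilinear.continuous_on[OF assms(2)] by auto
next
  case (Suc k)
  have fg: "Ck_on k U f" "Ck_on k U g"
    using Suc.prems by (auto intro: Ck_on_Suc_imp simp del: Ck_on.simps)
  show ?case
  proof (rule Ck_on_SucI[OF assms(1), where f' = "\<lambda>x h. p (f x) (dd h g x) + p (dd h f x) (g x)"])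
    show "((\<lambda>x. p (f x) (g x)) has_derivative (\<lambda>h. p (f x) (dd h g x) + p (dd h f x) (g x))) (at x)"
      if "x \<in> U" for x
      using bounded_bilinear.FDERIV[OF assms(2) Ck_on_SucD[OF Suc.prems(1) that]
          Ck_on_SucD[OF Suc.prems(2) that]] .
    show "Ck_on k U (\<lambda>x. p (f x) (dd h g x) + p (dd h f x) (g x))" for h
      using Suc.IH[of f "\<lambda>x. dd h g x"] Suc.IH[of "\<lambda>x. dd h f x" g] Suc.prems fg
      by (intro Ck_on_add[OF assms(1)]) auto
  qed
qed

lemma Ck_on_sum:
  assumes "open U" "finite I" "\<And>i. i \<in> I \<Longrightarrow> Ck_on k U (f i)"
  shows "Ck_on k U (\<lambda>x. \<Sum>i\<in>I. f i x)"
  using assms(2,3) by (induction I rule: finite_induct) (auto intro: Ck_on_const Ck_on_add[OF assms(1)])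

text \<open>The derivative of \<open>g \<circ> f\<close> contains the derivative of \<open>g\<close> in a direction that moves with the
  point. A finite basis \<open>e\<close> of the target, with coordinate functionals \<open>\<phi>\<close>, replaces it by derivatives of
  \<open>g\<close> in fixed directions, to which the induction hypothesis applies.\<close>

lemma Ck_on_compose:
  fixes \<phi> :: "'i \<Rightarrow> 'b::real_normed_vector \<Rightarrow> real" and e :: "'i \<Rightarrow> 'b" and S :: "'b set"
  assumes "open U" "open S" "finite I" "\<And>i. i \<in> I \<Longrightarrow> bounded_linear (\<phi> i)"
    and coord: "\<And>y. (\<Sum>i\<in>I. \<phi> i y *\<^sub>R e i) = y"
  shows "Ck_on k S g \<Longrightarrow> Ck_on k U f \<Longrightarrow> f ` U \<subseteq> S \<Longrightarrow> Ck_on k U (\<lambda>x. g (f x))"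
proof (induction k arbitrary: g)
  case 0
  then show ?case by (auto intro: continuous_on_compose2)
next
  case (Suc k)
  show ?case
  proof (rule Ck_on_SucI[OF assms(1), where f' = "\<lambda>x h. \<Sum>i\<in>I. \<phi> i (dd h f x) *\<^sub>R dd (e i) g (f x)"])
    fix x assume "x \<in> U"
    have g: "(g has_derivative (\<lambda>h. dd h g (f x))) (at (f x))"
      using Suc.prems \<open>x \<in> U\<close> by (intro Ck_on_SucD[OF Suc.prems(1)]) auto
    have 1: "((\<lambda>x. g (f x)) has_derivative (\<lambda>h. dd (dd h f x) g (f x))) (at x)"
      using has_derivative_compose[OF Ck_on_SucD[OF Suc.prems(2) \<open>x \<in> U\<close>] g] .
    have 2: "dd h' g (f x) = (\<Sum>i\<in>I. \<phi> i h' *\<^sub>R dd (e i) g (f x))" for h'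
    proof -
      interpret l: linear "\<lambda>h. dd h g (f x)"
        using has_derivative_linear[OF g] .
      have "dd h' g (f x) = dd (\<Sum>i\<in>I. \<phi> i h' *\<^sub>R e i) g (f x)" by (simp add: coord)
      then show ?thesis by (simp add: l.sum l.scaleR)
    qed
    show "((\<lambda>x. g (f x)) has_derivative (\<lambda>h. \<Sum>i\<in>I. \<phi> i (dd h f x) *\<^sub>R dd (e i) g (f x))) (at x)"
      by (rule has_derivative_eq_rhs[OF 1]) (rule ext, rule 2)
  next
    fix h
    have 1: "Ck_on k U (\<lambda>x. dd (e i) g (f x))" for i
      using Suc.prems by (intro Suc.IH[of "\<lambda>y. dd (e i) g y"] Ck_on_Suc_imp[of k U f]) auto
    have 2: "Ck_on k U (\<lambda>x. \<phi> i (dd h f x))" if "i \<in> I" for i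
      using Suc.prems by (intro Ck_on_bounded_linear[OF assms(1) assms(4)[OF that]]) auto
    show "Ck_on k U (\<lambda>x. \<Sum>i\<in>I. \<phi> i (dd h f x) *\<^sub>R dd (e i) g (f x))"
      by (rule Ck_on_sum[OF assms(1,3)])
        (rule Ck_on_bounded_bilinear[OF assms(1) bounded_bilinear_scaleR 2 1])
  qed
qed

lemma smooth_on_subset: "smooth_on U f \<Longrightarrow> V \<subseteq> U \<Longrightarrow> smooth_on V f"
proof -
  have "Ck_on k U f \<Longrightarrow> V \<subseteq> U \<Longrightarrow> Ck_on k V f" for k
    by (induction k arbitrary: f) (auto intro: continuous_on_subset)
  then show "smooth_on U f \<Longrightarrow> V \<subseteq> U \<Longrightarrow> smooth_on V f"
    by (auto simp: smooth_on_def)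
qed

lemma smooth_on_differentiable: "smooth_on U f \<Longrightarrow> x \<in> U \<Longrightarrow> f differentiable (at x)"
  using Ck_on.simps(2)[of 0 U f] by (auto simp: smooth_on_def)

lemma smooth_on_deriv: "smooth_on U f \<Longrightarrow> x \<in> U \<Longrightarrow> (f has_derivative (\<lambda>h. dd h f x)) (at x)"
  using smooth_on_differentiable frechet_derivative_works by blast

lemma smooth_on_dd: "smooth_on U f \<Longrightarrow> smooth_on U (\<lambda>x. dd h f x)"
  unfolding smooth_on_def using Ck_on.simps(2) by blast

lemma smooth_on_continuous: "smooth_on U f \<Longrightarrow> continuous_on U f"
  unfolding smooth_on_def using Ck_on.simps(1) by blast

lemma smooth_on_cong:
  "open U \<Longrightarrow> (\<And>x. x \<in> U \<Longrightarrow> f x = g x) \<Longrightarrow> smooth_on U f \<Longrightarrow> smooth_on U g"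
  unfolding smooth_on_def using Ck_on_cong by blast

text \<open>This is how solutions of differential equations and primitives are recognized as smooth.\<close>

lemma smooth_onI:
  assumes "open U" "\<And>x. x \<in> U \<Longrightarrow> (f has_derivative f' x) (at x)" "\<And>h. smooth_on U (\<lambda>x. f' x h)"
  shows "smooth_on U f"
proof -
  have "Ck_on (Suc k) U f" for k
    using Ck_on_SucI[OF assms(1,2)] assms(3) by (auto simp: smooth_on_def)
  then show ?thesis
    unfolding smooth_on_def using Ck_on_Suc_imp by blast
qed

named_theorems smooth_intros

lemma smooth_on_const [smooth_intros]: "smooth_on U (\<lambda>x. c)"
  by (simp add: smooth_on_def Ck_on_const)

lemma smooth_on_bounded_linear:
  "open U \<Longrightarrow> bounded_linear L \<Longrightarrow> smooth_on U f \<Longrightarrow> smooth_on U (\<lambda>x. L (f x))"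
  unfolding smooth_on_def using Ck_on_bounded_linear by blast

lemma smooth_on_id [smooth_intros]: "open U \<Longrightarrow> smooth_on U (\<lambda>x. x)"
  by (rule smooth_onI[where f' = "\<lambda>x h. h"]) (auto intro: smooth_on_const)

lemma smooth_on_add [smooth_intros]:
  "open U \<Longrightarrow> smooth_on U f \<Longrightarrow> smooth_on U g \<Longrightarrow> smooth_on U (\<lambda>x. f x + g x)"
  unfolding smooth_on_def using Ck_on_add by blast

lemma smooth_on_bounded_bilinear:
  "open U \<Longrightarrow> bounded_bilinear p \<Longrightarrow> smooth_on U f \<Longrightarrow> smooth_on U g \<Longrightarrow> smooth_on U (\<lambda>x. p (f x) (g x))"
  unfolding smooth_on_def using Ck_on_bounded_bilinear by blast

lemma smooth_on_minus [smooth_intros]: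
  "open U \<Longrightarrow> smooth_on U f \<Longrightarrow> smooth_on U (\<lambda>x. - f x)"
  by (rule smooth_on_bounded_linear[OF _ bounded_linear_minus[OF bounded_linear_ident]])

lemma smooth_on_diff [smooth_intros]:
  "open U \<Longrightarrow> smooth_on U f \<Longrightarrow> smooth_on U g \<Longrightarrow> smooth_on U (\<lambda>x. f x - g x)"
  using smooth_on_add[of U f "\<lambda>x. - g x"] smooth_on_minus[of U g] by simp

lemma smooth_on_mult [smooth_intros]:
  fixes f g :: "'a::real_normed_vector \<Rightarrow> 'b::real_normed_algebra"
  shows "open U \<Longrightarrow> smooth_on U f \<Longrightarrow> smooth_on U g \<Longrightarrow> smooth_on U (\<lambda>x. f x * g x)"
  by (rule smooth_on_bounded_bilinear[OF _ bounded_bilinear_mult])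

lemma smooth_on_scaleR [smooth_intros]:
  "open U \<Longrightarrow> smooth_on U f \<Longrightarrow> smooth_on U g \<Longrightarrow> smooth_on U (\<lambda>x. f x *\<^sub>R g x)"
  by (rule smooth_on_bounded_bilinear[OF _ bounded_bilinear_scaleR])

lemma smooth_on_Pair [smooth_intros]:
  assumes "open U" "smooth_on U f" "smooth_on U g"
  shows "smooth_on U (\<lambda>x. (f x, g x))"
proof -
  have "smooth_on U (\<lambda>x. (f x, 0) + (0, g x))"
    by (intro smooth_on_add assms smooth_on_bounded_linear[OF assms(1) _ assms(2)]
        smooth_on_bounded_linear[OF assms(1) _ assms(3)] bounded_linear_Pair
        bounded_linear_ident bounded_linear_zero)
  then show ?thesis by simp
qed

lemma bounded_linear_sre: "bounded_linear (sre :: 'a::real_normed_vector splitc \<Rightarrow> 'a)"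
  by (rule bounded_linear_intro[where K=1]) (auto simp: plus_splitc_def scaleR_splitc_def norm_splitc_def)

lemma bounded_linear_sim: "bounded_linear (sim :: 'a::real_normed_vector splitc \<Rightarrow> 'a)"
  by (rule bounded_linear_intro[where K=1]) (auto simp: plus_splitc_def scaleR_splitc_def norm_splitc_def)

lemma bounded_linear_SC:
  assumes "bounded_linear f" "bounded_linear g" shows "bounded_linear (\<lambda>x. SC (f x) (g x))"
proof -
  interpret f: bounded_linear f by fact
  interpret g: bounded_linear g by fact
  show ?thesis
  proof (rule bounded_linear_intro[where K="onorm f + onorm g"])
    fix x show "norm (SC (f x) (g x)) \<le> norm x * (onorm f + onorm g)"
      using onorm[OF assms(1), of x] onorm[OF assms(2), of x] by (simp add: norm_splitc_def algebra_simps)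
  qed (auto simp: plus_splitc_def scaleR_splitc_def f.add g.add f.scaleR g.scaleR)
qed

lemmas smooth_on_sre [smooth_intros] = smooth_on_bounded_linear[OF _ bounded_linear_sre]
lemmas smooth_on_sim [smooth_intros] = smooth_on_bounded_linear[OF _ bounded_linear_sim]

lemma splitc_eq_iff: "a = b \<longleftrightarrow> sre a = sre b \<and> sim a = sim b"
  by (cases a; cases b) auto

lemma splitc_sel_simps [simp]:
  "sre (a + b) = sre a + sre b" "sim (a + b) = sim a + sim b"
  "sre (0 :: 'c::ab_group_add splitc) = 0" "sim (0 :: 'c splitc) = 0"
  "sre (a - b) = sre a - sre b" "sim (a - b) = sim a - sim b"
  "sre (- a) = - sre a" "sim (- a) = - sim a"
  "sre (x * y) = sre x * sre y + sim x * sim y" "sim (x * y) = sre x * sim y + sim x * sre y"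
  "sre (1 :: 'd::comm_ring_1 splitc) = 1" "sim (1 :: 'd splitc) = 0"
  "sre (r *\<^sub>R z) = r *\<^sub>R sre z" "sim (r *\<^sub>R z) = r *\<^sub>R sim z"
  "sre (\<sigma> :: 'd splitc) = 0" "sim (\<sigma> :: 'd splitc) = 1"
  for a b :: "'c::ab_group_add splitc" and x y :: "'d::comm_ring_1 splitc"
    and z :: "'e::real_normed_vector splitc"
  by (auto simp: plus_splitc_def zero_splitc_def minus_splitc_def uminus_splitc_def
      times_splitc_def one_splitc_def scaleR_splitc_def sigma_def)

lemma A_basis: "h = sre h *\<^sub>R 1 + sim h *\<^sub>R \<sigma>" for h :: A
  by (simp add: splitc_eq_iff)

lemma linear_A_expand:
  fixes f :: "A \<Rightarrow> 'b::real_normed_vector"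
  assumes "linear f" shows "f h = sre h *\<^sub>R f 1 + sim h *\<^sub>R f \<sigma>"
  by (subst A_basis[of h]) (simp only: linear_add[OF assms] linear_scale[OF assms])

lemma dd_expand:
  fixes f :: "A \<Rightarrow> 'b::real_normed_vector"
  assumes "f differentiable (at a)" shows "dd h f a = sre h *\<^sub>R dd 1 f a + sim h *\<^sub>R dd \<sigma> f a"
  by (rule linear_A_expand) (use assms has_derivative_linear frechet_derivative_works in blast)

lemma has_derivative_SC:
  assumes "(f has_derivative f') F" "(g has_derivative g') F"
  shows "((\<lambda>a. SC (f a) (g a :: real)) has_derivative (\<lambda>h. SC (f' h) (g' h))) F"
proof -
  have "SC u v = u *\<^sub>R 1 + v *\<^sub>R \<sigma>" for u v :: real by (simp add: splitc_eq_iff)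
  then show ?thesis
    using has_derivative_add[OF has_derivative_scaleR_left[OF assms(1), of 1] has_derivative_scaleR_left[OF assms(2), of \<sigma>]]
    by simp
qed

lemma smooth_on_SC [smooth_intros]:
  assumes "open U" "smooth_on U f" "smooth_on U g"
  shows "smooth_on U (\<lambda>x. SC (f x) (g x :: 'b::real_normed_vector))"
proof -
  have "smooth_on U (\<lambda>x. SC (f x) 0 + SC 0 (g x))"
    by (intro smooth_on_add assms smooth_on_bounded_linear[OF assms(1) _ assms(2)]
        smooth_on_bounded_linear[OF assms(1) _ assms(3)] bounded_linear_SC
        bounded_linear_ident bounded_linear_zero)
  then show ?thesis by (simp add: plus_splitc_def)
qed

lemma Ck_on_compose_A:
  fixes f :: "'a::real_normed_vector \<Rightarrow> A"
  assumes "open U" "open S" "Ck_on k S g" "Ck_on k U f" "f ` U \<subseteq> S"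
  shows "Ck_on k U (\<lambda>x. g (f x))"
  by (rule Ck_on_compose[where I = "{True, False}" and \<phi> = "\<lambda>b. if b then sre else sim"
        and e = "\<lambda>b. if b then 1 else \<sigma>", OF assms(1,2)])
    (use assms in \<open>auto simp: bounded_linear_sre bounded_linear_sim splitc_eq_iff\<close>)

lemma smooth_on_compose_A:
  fixes f :: "'a::real_normed_vector \<Rightarrow> A"
  shows "open U \<Longrightarrow> open S \<Longrightarrow> smooth_on S g \<Longrightarrow> smooth_on U f \<Longrightarrow> f ` U \<subseteq> S \<Longrightarrow>
    smooth_on U (\<lambda>x. g (f x))"
  unfolding smooth_on_def using Ck_on_compose_A by blast

lemma smooth_on_compose_real:
  fixes f :: "'a::real_normed_vector \<Rightarrow> real"
  assumes "open U" "open S" "smooth_on S g" "smooth_on U f" "f ` U \<subseteq> S"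
  shows "smooth_on U (\<lambda>x. g (f x))"
proof -
  have "Ck_on k U (\<lambda>x. g (f x))" for k
    by (rule Ck_on_compose[where I = "{()}" and \<phi> = "\<lambda>b x. x"
          and e = "\<lambda>b. 1", OF assms(1,2)])
      (use assms in \<open>auto simp: smooth_on_def bounded_linear_ident\<close>)
  then show ?thesis by (simp add: smooth_on_def)
qed

lemma smooth_on_exp_real: "smooth_on UNIV (exp :: real \<Rightarrow> real)"
proof -
  have "Ck_on k UNIV (exp :: real \<Rightarrow> real)" for k
  proof (induction k)
    case 0 show ?case by (auto intro: continuous_intros)
  next
    case (Suc k)
    show ?case
      by (rule Ck_on_SucI[where f' = "\<lambda>x h. h * exp x"])
        (auto intro!: derivative_eq_intros Ck_on_bounded_linear[OF _ bounded_linear_mult_right] Suc)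
  qed
  then show ?thesis by (simp add: smooth_on_def)
qed

lemma smooth_on_inverse_real: "smooth_on (- {0}) (inverse :: real \<Rightarrow> real)"
proof -
  have "Ck_on k (- {0}) (inverse :: real \<Rightarrow> real)" for k
  proof (induction k)
    case 0 show ?case by (auto intro!: continuous_intros)
  next
    case (Suc k)
    have "Ck_on k (- {0}) (\<lambda>x. (- h) * (inverse x * inverse x))" for h :: real
      by (intro Ck_on_bounded_linear[OF _ bounded_linear_mult_right]
          Ck_on_bounded_bilinear[OF _ bounded_bilinear_mult] Suc) auto
    then show ?case
      by (intro Ck_on_SucI[where f' = "\<lambda>x h. (- h) * (inverse x * inverse x)"])
        (auto intro!: derivative_eq_intros simp: power2_eq_square)
  qed
  then show ?thesis by (simp add: smooth_on_def)
qed

lemma smooth_on_exp [smooth_intros]: "open U \<Longrightarrow> smooth_on U f \<Longrightarrow> smooth_on U (\<lambda>x. exp (f x :: real))"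
  by (rule smooth_on_compose_real[OF _ _ smooth_on_exp_real]) auto

lemma smooth_on_inverse [smooth_intros]:
  "open U \<Longrightarrow> smooth_on U f \<Longrightarrow> (\<And>x. x \<in> U \<Longrightarrow> f x \<noteq> 0) \<Longrightarrow> smooth_on U (\<lambda>x. inverse (f x :: real))"
  by (rule smooth_on_compose_real[OF _ _ smooth_on_inverse_real]) auto

lemma smooth_on_divide [smooth_intros]:
  "open U \<Longrightarrow> smooth_on U f \<Longrightarrow> smooth_on U g \<Longrightarrow> (\<And>x. x \<in> U \<Longrightarrow> g x \<noteq> 0) \<Longrightarrow>
   smooth_on U (\<lambda>x. f x / (g x :: real))"
  unfolding divide_inverse by (intro smooth_intros) auto

lemma smooth_on_ln [smooth_intros]:
  assumes "open U" "smooth_on U f" "\<And>x. x \<in> U \<Longrightarrow> f x > 0"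
  shows "smooth_on U (\<lambda>x. ln (f x :: real))"
proof -
  have "smooth_on {0<..} (ln :: real \<Rightarrow> real)"
    by (rule smooth_onI[where f' = "\<lambda>x h. h * inverse x"])
      (auto intro!: derivative_eq_intros smooth_intros simp: field_simps)
  from smooth_on_compose_real[OF assms(1) _ this assms(2)] show ?thesis
    using assms(3) by auto
qed

lemma smooth_on_sqrt [smooth_intros]:
  assumes "open U" "smooth_on U f" "\<And>x. x \<in> U \<Longrightarrow> f x > 0"
  shows "smooth_on U (\<lambda>x. sqrt (f x))"
proof (rule smooth_on_cong[OF assms(1)])
  show "smooth_on U (\<lambda>x. exp (ln (f x) * (1/2)))"
    by (intro smooth_intros assms)
  show "exp (ln (f x) * (1/2)) = sqrt (f x)" if "x \<in> U" for x
    using assms(3)[OF that] by (simp add: powr_half_sqrt[symmetric] powr_def)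
qed

subsection \<open>Symmetry of second derivatives\<close>

lemma dd_line:
  assumes "(f has_derivative f') (at (a + t *\<^sub>R h))"
  shows "((\<lambda>t. f (a + t *\<^sub>R h)) has_real_derivative f' h) (at t)"
proof -
  have "((\<lambda>t. a + t *\<^sub>R h) has_derivative (\<lambda>t. t *\<^sub>R h)) (at t)"
    by (auto intro!: derivative_eq_intros)
  from has_derivative_compose[OF this assms]
  have "((\<lambda>t. f (a + t *\<^sub>R h)) has_derivative (\<lambda>s. s * f' h)) (at t)"
    using linear_scale[OF has_derivative_linear[OF assms]] by simp
  then show ?thesis
    unfolding has_field_derivative_def by (rule has_derivative_eq_rhs) (simp add: fun_eq_iff)
qed

text \<open>The mean value theorem in the direction \<open>h\<close>, then in the direction \<open>k\<close>.\<close>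

lemma second_difference:
  fixes f :: "'a::real_normed_vector \<Rightarrow> real"
  assumes f: "smooth_on U f" and r: "r > 0"
    and U: "\<And>s t. 0 \<le> s \<Longrightarrow> s \<le> r \<Longrightarrow> 0 \<le> t \<Longrightarrow> t \<le> r \<Longrightarrow> a + s *\<^sub>R h + t *\<^sub>R k \<in> U"
  shows "\<exists>s t. 0 < s \<and> s < r \<and> 0 < t \<and> t < r \<and>
    f (a + r *\<^sub>R h + r *\<^sub>R k) - f (a + r *\<^sub>R h) - f (a + r *\<^sub>R k) + f a
      = r * r * dd k (dd h f) (a + s *\<^sub>R h + t *\<^sub>R k)"
proof -
  define G where "G t = f ((a + r *\<^sub>R k) + t *\<^sub>R h) - f (a + t *\<^sub>R h)" for t
  have "\<exists>s>0. s < r \<and> G r - G 0 = (r - 0) * (dd h f (a + s *\<^sub>R h + r *\<^sub>R k) - dd h f (a + s *\<^sub>R h))"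
  proof (rule MVT2[OF r])
    fix s assume s: "0 \<le> s" "s \<le> r"
    have 1: "(f has_derivative (\<lambda>h. dd h f (a + s *\<^sub>R h' + r *\<^sub>R k))) (at ((a + r *\<^sub>R k) + s *\<^sub>R h'))"
      if "h' = h" for h'
      using smooth_on_deriv[OF f U[OF s, of r]] r that by (simp add: algebra_simps)
    have 2: "(f has_derivative (\<lambda>h. dd h f (a + s *\<^sub>R h'))) (at (a + s *\<^sub>R h'))"
      if "h' = h" for h'
      using smooth_on_deriv[OF f U[OF s, of 0]] r that by simp
    show "(G has_real_derivative dd h f (a + s *\<^sub>R h + r *\<^sub>R k) - dd h f (a + s *\<^sub>R h)) (at s)"
      unfolding G_def
      using DERIV_diff[OF dd_line[OF 1[OF refl]] dd_line[OF 2[OF refl]]] by simp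
  qed
  then obtain s where s: "0 < s" "s < r"
    "G r - G 0 = r * (dd h f (a + s *\<^sub>R h + r *\<^sub>R k) - dd h f (a + s *\<^sub>R h))" by auto
  have "\<exists>t>0. t < r \<and> dd h f (a + s *\<^sub>R h + r *\<^sub>R k) - dd h f (a + s *\<^sub>R h + 0 *\<^sub>R k)
      = (r - 0) * dd k (dd h f) (a + s *\<^sub>R h + t *\<^sub>R k)"
  proof (rule MVT2[OF r])
    fix t assume t: "0 \<le> t" "t \<le> r"
    show "((\<lambda>t. dd h f (a + s *\<^sub>R h + t *\<^sub>R k)) has_real_derivative
        dd k (dd h f) (a + s *\<^sub>R h + t *\<^sub>R k)) (at t)"
      by (rule dd_line[OF smooth_on_deriv[OF smooth_on_dd[OF f]]]) (use s t in \<open>auto intro: U\<close>)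
  qed
  then obtain t where t: "0 < t" "t < r"
    "dd h f (a + s *\<^sub>R h + r *\<^sub>R k) - dd h f (a + s *\<^sub>R h)
      = r * dd k (dd h f) (a + s *\<^sub>R h + t *\<^sub>R k)" by auto
  have "G r - G 0 = f (a + r *\<^sub>R h + r *\<^sub>R k) - f (a + r *\<^sub>R h) - f (a + r *\<^sub>R k) + f a"
    by (simp add: G_def algebra_simps)
  then have "f (a + r *\<^sub>R h + r *\<^sub>R k) - f (a + r *\<^sub>R h) - f (a + r *\<^sub>R k) + f a
      = r * r * dd k (dd h f) (a + s *\<^sub>R h + t *\<^sub>R k)"
    using s(3) t(3) by (simp add: mult.assoc)
  then show ?thesis using s(1,2) t(1,2) by blast
qed

text \<open>The second difference is symmetric in \<open>h\<close> and \<open>k\<close>, so both iterated derivatives take a common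
  value at points arbitrarily close to \<open>a\<close>.\<close>

lemma dd_commute_real:
  fixes f :: "'a::real_normed_vector \<Rightarrow> real"
  assumes "open U" "a \<in> U" "smooth_on U f"
  shows "dd k (dd h f) a = dd h (dd k f) a"
proof (rule ccontr)
  assume ne: "dd k (dd h f) a \<noteq> dd h (dd k f) a"
  define \<epsilon> where "\<epsilon> = \<bar>dd k (dd h f) a - dd h (dd k f) a\<bar> / 2"
  have "\<epsilon> > 0" using ne by (simp add: \<epsilon>_def)
  have "isCont (dd k (dd h f)) a" "isCont (dd h (dd k f)) a"
    using smooth_on_continuous[OF smooth_on_dd[OF smooth_on_dd[OF assms(3)]]]
      continuous_on_eq_continuous_at[OF assms(1)] assms(2) by blast+
  then obtain d1 d2 where d: "d1 > 0" "d2 > 0"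
    "\<And>y. dist y a < d1 \<Longrightarrow> dist (dd k (dd h f) y) (dd k (dd h f) a) < \<epsilon>"
    "\<And>y. dist y a < d2 \<Longrightarrow> dist (dd h (dd k f) y) (dd h (dd k f) a) < \<epsilon>"
    using \<open>\<epsilon> > 0\<close> unfolding continuous_at_eps_delta by metis
  obtain d3 where d3: "d3 > 0" "ball a d3 \<subseteq> U"
    using assms openE by blast
  define d where "d = min d1 (min d2 d3)"
  \<comment> \<open>The parallelogram spanned by \<open>r h\<close> and \<open>r k\<close> lies in the ball of radius \<open>d\<close>.\<close>
  define r where "r = d / (2 * (norm h + norm k + 1))"
  have pos: "norm h + norm k + 1 > 0" by (simp add: add_nonneg_pos)
  have "d > 0" using d d3 by (simp add: d_def)
  then have "r > 0" using pos by (simp add: r_def)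
  have near: "dist (a + s *\<^sub>R h + t *\<^sub>R k) a < d" if "0 \<le> s" "s \<le> r" "0 \<le> t" "t \<le> r" for s t
  proof -
    have "dist (a + s *\<^sub>R h + t *\<^sub>R k) a \<le> s * norm h + t * norm k"
      using norm_triangle_ineq[of "s *\<^sub>R h" "t *\<^sub>R k"] that by (simp add: dist_norm algebra_simps)
    also have "\<dots> \<le> r * norm h + r * norm k"
      using that by (intro add_mono mult_right_mono) auto
    also have "\<dots> \<le> r * (norm h + norm k + 1)" using \<open>r > 0\<close> by (simp add: algebra_simps)
    also have "\<dots> = d / 2" using pos by (simp add: r_def del: distrib_left_numeral)
    finally show ?thesis using \<open>d > 0\<close> by simp
  qed
  have inU: "a + s *\<^sub>R h + t *\<^sub>R k \<in> U" if "0 \<le> s" "s \<le> r" "0 \<le> t" "t \<le> r" for s t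
    using near[OF that] d3(2) by (auto simp: d_def dist_commute subset_iff)
  obtain s t where st: "0 < s" "s < r" "0 < t" "t < r"
    "f (a + r *\<^sub>R h + r *\<^sub>R k) - f (a + r *\<^sub>R h) - f (a + r *\<^sub>R k) + f a
      = r * r * dd k (dd h f) (a + s *\<^sub>R h + t *\<^sub>R k)"
    using second_difference[OF assms(3) \<open>r > 0\<close> inU] by auto
  have inU': "a + s *\<^sub>R k + t *\<^sub>R h \<in> U" if "0 \<le> s" "s \<le> r" "0 \<le> t" "t \<le> r" for s t
    using inU[of t s] that by (simp add: algebra_simps)
  obtain s' t' where st': "0 < s'" "s' < r" "0 < t'" "t' < r"
    "f (a + r *\<^sub>R k + r *\<^sub>R h) - f (a + r *\<^sub>R k) - f (a + r *\<^sub>R h) + f a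
      = r * r * dd h (dd k f) (a + s' *\<^sub>R k + t' *\<^sub>R h)"
    using second_difference[OF assms(3) \<open>r > 0\<close> inU'] by auto
  have "r * r * dd k (dd h f) (a + s *\<^sub>R h + t *\<^sub>R k) = r * r * dd h (dd k f) (a + t' *\<^sub>R h + s' *\<^sub>R k)"
    using st(5) st'(5) by (simp add: algebra_simps)
  then have eq: "dd k (dd h f) (a + s *\<^sub>R h + t *\<^sub>R k) = dd h (dd k f) (a + t' *\<^sub>R h + s' *\<^sub>R k)"
    using \<open>r > 0\<close> by simp
  have 1: "dist (a + s *\<^sub>R h + t *\<^sub>R k) a < d" using st by (intro near) auto
  have 2: "dist (a + t' *\<^sub>R h + s' *\<^sub>R k) a < d" using st' by (intro near) auto
  have "\<bar>dd k (dd h f) (a + s *\<^sub>R h + t *\<^sub>R k) - dd k (dd h f) a\<bar> < \<epsilon>"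
    using d(3)[of "a + s *\<^sub>R h + t *\<^sub>R k"] 1 by (simp add: d_def dist_real_def)
  moreover have "\<bar>dd h (dd k f) (a + t' *\<^sub>R h + s' *\<^sub>R k) - dd h (dd k f) a\<bar> < \<epsilon>"
    using d(4)[of "a + t' *\<^sub>R h + s' *\<^sub>R k"] 2 by (simp add: d_def dist_real_def)
  ultimately show False
    using eq unfolding \<epsilon>_def by (simp add: abs_real_def field_simps split: if_splits)
qed

lemma dd_bounded_linear:
  assumes "bounded_linear L" "f differentiable (at a)"
  shows "dd h (\<lambda>x. L (f x)) a = L (dd h f a)"
  by (rule dd_eqI) (use bounded_linear.has_derivative[OF assms(1)] assms(2) frechet_derivative_works in blast)

lemma dd_commute:
  fixes f :: "'a::real_normed_vector \<Rightarrow> 'b::real_inner"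
  assumes U: "open U" "a \<in> U" and f: "smooth_on U f"
  shows "dd k (dd h f) a = dd h (dd k f) a"
proof -
  have "inner (dd k (dd h f) a) c = inner (dd h (dd k f) a) c" for c
  proof -
    note L = bounded_linear_inner_left[of c]
    have "dd k (dd h (\<lambda>x. inner (f x) c)) a = inner (dd k (dd h f) a) c" for h k
    proof -
      have "dd k (dd h (\<lambda>x. inner (f x) c)) a = dd k (\<lambda>x. inner (dd h f x) c) a"
        by (rule dd_cong[OF U]) (rule dd_bounded_linear[OF L smooth_on_differentiable[OF f]])
      also have "\<dots> = inner (dd k (dd h f) a) c"
        by (rule dd_bounded_linear[OF L smooth_on_differentiable[OF smooth_on_dd[OF f] U(2)]])
      finally show ?thesis .
    qed
    then show ?thesis
      using dd_commute_real[OF U smooth_on_bounded_linear[OF U(1) L f], of k h] by simp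
  qed
  then show ?thesis
    using vector_eq_rdot by blast
qed

section \<open>Closed one-forms on simply connected domains\<close>

text \<open>The primitive is \<open>F x = \<integral> \<omega>(\<gamma>\<^sub>t x) (x - c) dt\<close> over \<open>[0,1]\<close>, with \<open>\<gamma>\<^sub>t x = c + t (x - c)\<close>.
  By the symmetry of \<open>\<omega>'\<close>, the derivative of the integrand with respect to \<open>x\<close> is the derivative of
  \<open>t \<omega>(\<gamma>\<^sub>t x)\<close> with respect to \<open>t\<close>. The continuity of \<open>\<omega>'\<close> is required pointwise in its
  direction argument, which avoids an operator norm on bilinear forms.\<close>

lemma star_shaped_primitive:
  fixes \<omega> :: "'a::banach \<Rightarrow> 'a \<Rightarrow>\<^sub>L real"
  assumes S: "open S" "convex S" "c \<in> S"
    and d: "\<And>x. x \<in> S \<Longrightarrow> (\<omega> has_derivative \<omega>' x) (at x)"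
    and cont: "continuous_on (S \<times> UNIV) (\<lambda>(x, v). \<omega>' x v)"
    and sym: "\<And>x h k. x \<in> S \<Longrightarrow> \<omega>' x h k = \<omega>' x k h"
  shows "\<exists>F. \<forall>x\<in>S. (F has_derivative \<omega> x) (at x)"
proof -
  define \<gamma> where "\<gamma> x t = c + t *\<^sub>R (x - c)" for x and t :: real
  define fx where "fx x t = \<omega> (\<gamma> x t) + t *\<^sub>R \<omega>' (\<gamma> x t) (x - c)" for x t
  define F where "F x = integral (cbox 0 1) (\<lambda>t. \<omega> (\<gamma> x t) (x - c))" for x
  have \<gamma>: "\<gamma> x t \<in> S" if "x \<in> S" "t \<in> cbox 0 1" for x t
  proof -
    have "(1 - t) *\<^sub>R c + t *\<^sub>R x \<in> S"
      using that convexD_alt[OF S(2,3) that(1), of t] by auto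
    then show ?thesis by (simp add: \<gamma>_def algebra_simps)
  qed
  have \<omega>_cont: "continuous_on S \<omega>"
    using d by (meson continuous_at_imp_continuous_on has_derivative_continuous)
  have g_cont: "continuous_on X (\<lambda>p. \<gamma> (fst p) (snd p))" for X
    unfolding \<gamma>_def by (intro continuous_intros)
  have fx_cont: "continuous_on (S \<times> cbox 0 1) (\<lambda>(x, t). fx x t)"
  proof -
    have "continuous_on (S \<times> cbox 0 1) (\<lambda>p. \<omega>' (\<gamma> (fst p) (snd p)) (fst p - c))"
      using continuous_on_compose2[OF cont, of "S \<times> cbox 0 1" "\<lambda>p. (\<gamma> (fst p) (snd p), fst p - c)"]
        g_cont[of "S \<times> cbox 0 1"] \<gamma> by (force intro!: continuous_intros)
    moreover have "continuous_on (S \<times> cbox 0 1) (\<lambda>p. \<omega> (\<gamma> (fst p) (snd p)))"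
      by (rule continuous_on_compose2[OF \<omega>_cont g_cont]) (use \<gamma> in auto)
    ultimately show ?thesis
      unfolding fx_def split_beta by (intro continuous_intros)
  qed
  have "(F has_derivative \<omega> x) (at x)" if x: "x \<in> S" for x
  proof -
    have "(F has_derivative blinfun_apply (integral (cbox 0 1) (fx x))) (at x within S)"
      unfolding F_def
    proof (rule leibniz_rule[OF _ _ fx_cont x S(2)])
      fix y :: 'a and t :: real assume yt: "y \<in> S" "t \<in> cbox 0 1"
      have "((\<lambda>y. \<gamma> y t) has_derivative (\<lambda>h. t *\<^sub>R h)) (at y)"
        unfolding \<gamma>_def by (auto intro!: derivative_eq_intros simp: algebra_simps)
      from has_derivative_compose[OF this d[OF \<gamma>[OF yt]]]
      have "((\<lambda>y. \<omega> (\<gamma> y t)) has_derivative (\<lambda>h. \<omega>' (\<gamma> y t) (t *\<^sub>R h))) (at y)" .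
      then have 1: "((\<lambda>y. \<omega> (\<gamma> y t) (y - c)) has_derivative
          (\<lambda>h. \<omega> (\<gamma> y t) h + \<omega>' (\<gamma> y t) (t *\<^sub>R h) (y - c))) (at y)"
        by (auto intro!: derivative_eq_intros)
      have 2: "\<omega>' (\<gamma> y t) (t *\<^sub>R h) = t *\<^sub>R \<omega>' (\<gamma> y t) h" for h
        using linear_scale[OF has_derivative_linear[OF d[OF \<gamma>[OF yt]]]] by auto
      have "(\<lambda>h. \<omega> (\<gamma> y t) h + \<omega>' (\<gamma> y t) (t *\<^sub>R h) (y - c)) = fx y t"
        unfolding fx_def fun_eq_iff 2
        by (simp add: blinfun.add_left blinfun.scaleR_left sym[OF \<gamma>[OF yt], of _ "y - c"])
      then show "((\<lambda>y. \<omega> (\<gamma> y t) (y - c)) has_derivative fx y t) (at y within S)"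
        using 1 by (simp add: has_derivative_at_withinI)
    next
      fix y assume y: "y \<in> S"
      have "continuous_on (cbox 0 1) (\<lambda>t. \<omega> (\<gamma> y t))"
        by (rule continuous_on_compose2[OF \<omega>_cont]) (use \<gamma>[OF y] in \<open>auto simp: \<gamma>_def intro!: continuous_intros\<close>)
      then show "(\<lambda>t. \<omega> (\<gamma> y t) (y - c)) integrable_on cbox 0 1"
        by (intro integrable_continuous continuous_intros)
    qed
    moreover have "(fx x has_integral (1 *\<^sub>R \<omega> (\<gamma> x 1) - 0 *\<^sub>R \<omega> (\<gamma> x 0))) {0..1}"
    proof (rule fundamental_theorem_of_calculus)
      fix t :: real assume t: "t \<in> {0..1}"
      then have "\<gamma> x t \<in> S" using \<gamma>[OF x, of t] by simp
      have "((\<lambda>t. \<gamma> x t) has_derivative (\<lambda>s. s *\<^sub>R (x - c))) (at t)"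
        unfolding \<gamma>_def by (auto intro!: derivative_eq_intros)
      from has_derivative_compose[OF this d[OF \<open>\<gamma> x t \<in> S\<close>]]
      have *: "((\<lambda>t. \<omega> (\<gamma> x t)) has_derivative (\<lambda>s. \<omega>' (\<gamma> x t) (s *\<^sub>R (x - c)))) (at t)" .
      have **: "\<omega>' (\<gamma> x t) (s *\<^sub>R (x - c)) = s *\<^sub>R \<omega>' (\<gamma> x t) (x - c)" for s
        using linear_scale[OF has_derivative_linear[OF d[OF \<open>\<gamma> x t \<in> S\<close>]]] by auto
      have "((\<lambda>t. t *\<^sub>R \<omega> (\<gamma> x t)) has_derivative
          (\<lambda>s. t *\<^sub>R (s *\<^sub>R \<omega>' (\<gamma> x t) (x - c)) + s *\<^sub>R \<omega> (\<gamma> x t))) (at t)"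
        using has_derivative_scaleR[OF has_derivative_ident *] unfolding ** by simp
      moreover have "t *\<^sub>R (s *\<^sub>R B) + s *\<^sub>R W = s *\<^sub>R (W + t *\<^sub>R B)" for s and B W :: "'a \<Rightarrow>\<^sub>L real"
        by (simp add: scaleR_add_right mult.commute add.commute)
      ultimately show "((\<lambda>t. t *\<^sub>R \<omega> (\<gamma> x t)) has_vector_derivative fx x t) (at t within {0..1})"
        unfolding fx_def has_vector_derivative_def
        by (simp only: has_derivative_at_withinI)
    qed simp
    from integral_unique[OF this] have "integral (cbox 0 1) (fx x) = \<omega> x"
      by (simp add: \<gamma>_def)
    ultimately show ?thesis
      using at_within_open[OF x S(1)] by simp
  qed
  then show ?thesis by blast
qed

text \<open>The plane \<^typ>\<open>A\<close> carries the norm \<open>\<bar>u\<bar> + \<bar>v\<bar>\<close>, which is not Euclidean. Theorems on the complex plane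
  and on Euclidean spaces are transported along this linear isomorphism.\<close>

definition toC :: "A \<Rightarrow> complex" where "toC a = Complex (sre a) (sim a)"
definition ofC :: "complex \<Rightarrow> A" where "ofC z = SC (Re z) (Im z)"

lemma toC_ofC [simp]: "toC (ofC z) = z" and ofC_toC [simp]: "ofC (toC a) = a"
  by (simp_all add: toC_def ofC_def)

lemma Re_toC [simp]: "Re (toC a) = sre a" and Im_toC [simp]: "Im (toC a) = sim a"
  and sre_ofC [simp]: "sre (ofC z) = Re z" and sim_ofC [simp]: "sim (ofC z) = Im z"
  by (simp_all add: toC_def ofC_def)

lemma bounded_linear_toC: "bounded_linear toC"
  by (rule bounded_linear_intro[where K=1])
    (auto simp: complex_eq_iff norm_splitc_def intro: order_trans[OF cmod_le])

lemma bounded_linear_ofC: "bounded_linear ofC"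
  unfolding ofC_def by (intro bounded_linear_SC bounded_linear_Re bounded_linear_Im)

lemma homeomorphism_toC: "homeomorphism U (toC ` U) toC ofC"
  by (auto simp: homeomorphism_def image_image
      intro!: linear_continuous_on bounded_linear_toC bounded_linear_ofC)

lemma open_toC_image: "open U \<Longrightarrow> open (toC ` U)"
proof -
  assume "open U"
  have "toC ` U = ofC -` U"
    by (auto simp: image_iff) (metis toC_ofC)
  then show ?thesis
    using \<open>open U\<close> open_vimage[OF _ linear_continuous_on[OF bounded_linear_ofC]] by simp
qed

text \<open>By the Riemann mapping theorem the domain is diffeomorphic to a disc or to the plane, on which
  closed forms have primitives because these are convex.\<close>

lemma simply_connected_domain_chart:
  assumes "open U" "simply_connected (U :: A set)" "U \<noteq> {}"
  obtains T \<phi> \<eta> where "open T" "convex T" "T \<noteq> {}" "\<phi> holomorphic_on T" "\<eta> holomorphic_on (toC ` U)"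
    "\<And>z. z \<in> T \<Longrightarrow> \<phi> z \<in> toC ` U" "\<And>w. w \<in> toC ` U \<Longrightarrow> \<eta> w \<in> T \<and> \<phi> (\<eta> w) = w"
proof -
  have "simply_connected (toC ` U)"
    using homeomorphic_simply_connected_eq homeomorphism_toC assms(2) unfolding homeomorphic_def by blast
  then have "toC ` U = {} \<or> toC ` U = UNIV \<or>
           (\<exists>f g. f holomorphic_on (toC ` U) \<and> g holomorphic_on ball 0 1 \<and>
                 (\<forall>z \<in> toC ` U. f z \<in> ball 0 1 \<and> g(f z) = z) \<and>
                 (\<forall>z \<in> ball 0 1. g z \<in> toC ` U \<and> f(g z) = z))"
    using simply_connected_eq_biholomorphic_to_disc[OF open_toC_image[OF assms(1)]] by blast
  then consider "toC ` U = UNIV" | f g where "f holomorphic_on (toC ` U)" "g holomorphic_on ball 0 1"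
                 "\<forall>z \<in> toC ` U. f z \<in> ball 0 1 \<and> g(f z) = z"
                 "\<forall>z \<in> ball 0 1. g z \<in> toC ` U \<and> f(g z) = z"
    using assms(3) by (metis image_is_empty)
  then show ?thesis
  proof cases
    case 1
    then show ?thesis by (intro that[of UNIV "\<lambda>z. z" "\<lambda>z. z"]) (auto intro: holomorphic_intros)
  next
    case 2
    show ?thesis
      by (rule that[OF open_ball convex_ball _ 2(2,1)]) (use 2(3,4) in auto)
  qed
qed

text \<open>The form \<open>P du + Q dv\<close> is pulled back by the Riemann map \<open>\<phi>\<close> to a convex domain. The pull-back is
  still closed: the only new terms contain \<open>\<phi>'' k h\<close>, which is symmetric in \<open>h\<close> and \<open>k\<close>.\<close>

theorem closed_form_exact:
  fixes P Q :: "A \<Rightarrow> real"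
  assumes U: "open U" "simply_connected U" and P: "smooth_on U P" and Q: "smooth_on U Q"
    and closed: "\<And>a. a \<in> U \<Longrightarrow> dd \<sigma> P a = dd 1 Q a"
  obtains f where "\<And>a. a \<in> U \<Longrightarrow> (f has_derivative (\<lambda>h. sre h * P a + sim h * Q a)) (at a)"
proof (cases "U = {}")
  case True
  then show ?thesis using that by blast
next
  case False
  obtain T \<phi> \<eta> where T: "open T" "convex T" "T \<noteq> {}" and hol: "\<phi> holomorphic_on T" "\<eta> holomorphic_on (toC ` U)"
    and im: "\<And>z. z \<in> T \<Longrightarrow> \<phi> z \<in> toC ` U" and inv: "\<And>w. w \<in> toC ` U \<Longrightarrow> \<eta> w \<in> T \<and> \<phi> (\<eta> w) = w"
    using simply_connected_domain_chart[OF U False] by metis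
  have im': "ofC (\<phi> z) \<in> U" if "z \<in> T" for z
    using im[OF that] by auto
  define \<phi>1 where "\<phi>1 = deriv \<phi>"
  define \<phi>2 where "\<phi>2 = deriv \<phi>1"
  have \<phi>d: "(\<phi> has_derivative (\<lambda>h. \<phi>1 z * h)) (at z)" if "z \<in> T" for z
    using holomorphic_derivI[OF hol(1) T(1) that] by (simp add: \<phi>1_def has_field_derivative_def)
  have hol1: "\<phi>1 holomorphic_on T"
    unfolding \<phi>1_def by (rule holomorphic_deriv[OF hol(1) T(1)])
  have hol2: "\<phi>2 holomorphic_on T"
    unfolding \<phi>2_def by (rule holomorphic_deriv[OF hol1 T(1)])
  have \<phi>1d: "(\<phi>1 has_derivative (\<lambda>h. \<phi>2 z * h)) (at z)" if "z \<in> T" for z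
    using holomorphic_derivI[OF hol1 T(1) that] by (simp add: \<phi>2_def has_field_derivative_def)
  \<comment> \<open>The real and imaginary parts of multiplication by \<open>w\<close>, as elements of the dual space.\<close>
  define R where "R w = blinfun_compose (Blinfun Re) (blinfun_mult_right w)" for w
  define I where "I w = blinfun_compose (Blinfun Im) (blinfun_mult_right w)" for w
  have RI: "R w h = Re (w * h)" "I w h = Im (w * h)" for w h
    by (simp_all add: R_def I_def bounded_linear_Blinfun_apply bounded_linear_Re bounded_linear_Im)
  have blR: "bounded_linear R" unfolding R_def
    by (intro bounded_linear_compose[OF bounded_bilinear.bounded_linear_right[OF bounded_bilinear_blinfun_compose]] bounded_linear_blinfun_mult_right)
  have blI: "bounded_linear I" unfolding I_def
    by (intro bounded_linear_compose[OF bounded_bilinear.bounded_linear_right[OF bounded_bilinear_blinfun_compose]] bounded_linear_blinfun_mult_right)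
  define p where "p z = P (ofC (\<phi> z))" for z
  define q where "q z = Q (ofC (\<phi> z))" for z
  define D where "D G z k = Re (\<phi>1 z * k) * dd 1 G (ofC (\<phi> z)) + Im (\<phi>1 z * k) * dd \<sigma> G (ofC (\<phi> z))"
    for G :: "A \<Rightarrow> real" and z k
  have Dd: "((\<lambda>z. G (ofC (\<phi> z))) has_derivative D G z) (at z)" if G: "smooth_on U G" and z: "z \<in> T" for G z
  proof -
    have "((\<lambda>z. ofC (\<phi> z)) has_derivative (\<lambda>k. ofC (\<phi>1 z * k))) (at z)"
      by (rule bounded_linear.has_derivative[OF bounded_linear_ofC \<phi>d[OF z]])
    from has_derivative_compose[OF this smooth_on_deriv[OF G im'[OF z]]]
    have *: "((\<lambda>z. G (ofC (\<phi> z))) has_derivative (\<lambda>k. dd (ofC (\<phi>1 z * k)) G (ofC (\<phi> z)))) (at z)" .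
    interpret l: linear "\<lambda>h. dd h G (ofC (\<phi> z))"
      using has_derivative_linear[OF smooth_on_deriv[OF G im'[OF z]]] .
    have "dd (ofC w) G (ofC (\<phi> z)) = Re w * dd 1 G (ofC (\<phi> z)) + Im w * dd \<sigma> G (ofC (\<phi> z))" for w
      by (subst A_basis[of "ofC w"]) (simp add: l.add l.scaleR)
    then show ?thesis using * unfolding D_def by simp
  qed
  define \<omega> where "\<omega> z = p z *\<^sub>R R (\<phi>1 z) + q z *\<^sub>R I (\<phi>1 z)" for z
  define \<omega>' where "\<omega>' z k = p z *\<^sub>R R (\<phi>2 z * k) + D P z k *\<^sub>R R (\<phi>1 z)
      + (q z *\<^sub>R I (\<phi>2 z * k) + D Q z k *\<^sub>R I (\<phi>1 z))" for z k
  obtain c where "c \<in> T" using T(3) by blast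
  have c\<phi>: "continuous_on (T \<times> UNIV) (\<lambda>x. F (fst x))" if "F holomorphic_on T" for F :: "complex \<Rightarrow> complex"
    by (rule continuous_on_compose2[OF holomorphic_on_imp_continuous_on[OF that]]) (auto intro: continuous_intros)
  have cG: "continuous_on (T \<times> UNIV) (\<lambda>x. G (ofC (\<phi> (fst x))))" if "smooth_on U G" for G :: "A \<Rightarrow> real"
    by (rule continuous_on_compose2[OF smooth_on_continuous[OF that]
        bounded_linear.continuous_on[OF bounded_linear_ofC c\<phi>[OF hol(1)]]]) (use im' in auto)
  have "\<exists>F. \<forall>z\<in>T. (F has_derivative \<omega> z) (at z)"
  proof (rule star_shaped_primitive[OF T(1,2) \<open>c \<in> T\<close>])
    show "(\<omega> has_derivative \<omega>' z) (at z)" if "z \<in> T" for z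
      unfolding \<omega>_def \<omega>'_def p_def q_def
      by (intro has_derivative_add has_derivative_scaleR Dd P Q that
          bounded_linear.has_derivative[OF blR] bounded_linear.has_derivative[OF blI] \<phi>1d)
    show "continuous_on (T \<times> UNIV) (\<lambda>(x, v). \<omega>' x v)"
      unfolding \<omega>'_def D_def p_def q_def split_beta
      by (intro continuous_intros cG c\<phi> hol1 hol2 P Q smooth_on_dd
          bounded_linear.continuous_on[OF blR] bounded_linear.continuous_on[OF blI])
    show "\<omega>' z h k = \<omega>' z k h" if "z \<in> T" for z h k
      using closed[OF im'[OF that]]
      by (simp add: \<omega>'_def D_def blinfun.add_left blinfun.scaleR_left RI) (simp add: algebra_simps)
  qed
  then obtain F where F: "\<And>z. z \<in> T \<Longrightarrow> (F has_derivative \<omega> z) (at z)" by blast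
  show ?thesis
  proof (rule that)
    fix a assume a: "a \<in> U"
    define z where "z = \<eta> (toC a)"
    have z: "z \<in> T" "\<phi> z = toC a" using inv a by (auto simp: z_def)
    have \<eta>: "(\<eta> has_field_derivative deriv \<eta> (toC a)) (at (toC a))"
      using holomorphic_derivI[OF hol(2) open_toC_image[OF U(1)]] a by auto
    have "((\<lambda>w. \<phi> (\<eta> w)) has_field_derivative \<phi>1 z * deriv \<eta> (toC a)) (at (toC a))"
      using DERIV_chain2[OF _ \<eta>, of \<phi> "\<phi>1 z"] \<phi>d[OF z(1)] by (simp add: z_def has_field_derivative_def)
    moreover have "((\<lambda>w. \<phi> (\<eta> w)) has_field_derivative 1) (at (toC a))"
      by (rule has_field_derivative_transform_within_open[OF DERIV_ident open_toC_image[OF U(1)]])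
        (use a inv in auto)
    ultimately have one: "\<phi>1 z * deriv \<eta> (toC a) = 1"
      using DERIV_unique by blast
    have "((\<lambda>a. \<eta> (toC a)) has_derivative (\<lambda>h. deriv \<eta> (toC a) * toC h)) (at a)"
      using has_derivative_compose[OF bounded_linear_imp_has_derivative[OF bounded_linear_toC]
          \<eta>[unfolded has_field_derivative_def]] .
    from has_derivative_compose[OF this F[of "\<eta> (toC a)"]] z
    have "((\<lambda>a. F (\<eta> (toC a))) has_derivative (\<lambda>h. \<omega> z (deriv \<eta> (toC a) * toC h))) (at a)"
      by (simp add: z_def)
    moreover have "\<omega> z (deriv \<eta> (toC a) * toC h) = sre h * P a + sim h * Q a" for h
      using one z(2)
      by (simp add: \<omega>_def blinfun.add_left blinfun.scaleR_left RI p_def q_def mult.assoc[symmetric]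
          del: times_complex.sel)
    ultimately show "((\<lambda>a. F (\<eta> (toC a))) has_derivative (\<lambda>h. sre h * P a + sim h * Q a)) (at a)"
      by simp
  qed
qed

section \<open>Spinors\<close>

type_synonym spinor = "real \<times> real"

text \<open>The area form of the plane. The group \<open>SL(2,\<real>)\<close> consists of the linear maps that preserve it.\<close>

definition br :: "spinor \<Rightarrow> spinor \<Rightarrow> real" where
  "br x z = fst x * snd z - snd x * fst z"

text \<open>The isometry between \<open>2 \<times> 2\<close> matrices and \<open>\<real>\<^sup>2\<^sup>,\<^sup>2\<close> that comes from the quaternions: the vector
  \<open>V\<close> corresponds to the matrix with rows \<open>(V\<^sub>0 - V\<^sub>1, V\<^sub>2 - V\<^sub>3)\<close> and \<open>(-V\<^sub>2 - V\<^sub>3, V\<^sub>0 + V\<^sub>1)\<close>, and here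
  this matrix is the product of the column \<open>x\<close> and the row \<open>y\<close>.\<close>

definition tens :: "spinor \<Rightarrow> spinor \<Rightarrow> real^4" where
  "tens x y = (\<chi> i.
     if i = 0 then (fst x * fst y + snd x * snd y) / 2
     else if i = 1 then (snd x * snd y - fst x * fst y) / 2
     else if i = 2 then (fst x * snd y - snd x * fst y) / 2
     else - ((fst x * snd y + snd x * fst y) / 2))"

lemma tens_nth [simp]:
  "tens x y $ 0 = (fst x * fst y + snd x * snd y) / 2"
  "tens x y $ 1 = (snd x * snd y - fst x * fst y) / 2"
  "tens x y $ 2 = (fst x * snd y - snd x * fst y) / 2"
  "tens x y $ 3 = - ((fst x * snd y + snd x * fst y) / 2)"
  by (simp_all add: tens_def)

text \<open>In the index type the numeral \<open>4\<close> denotes \<open>0\<close>.\<close>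

lemma all_4: "(\<forall>i::4. P i) \<longleftrightarrow> P 0 \<and> P 1 \<and> P 2 \<and> P 3"
proof -
  have "P 4 = P 0" by (rule arg_cong[of _ _ P]) simp
  then show ?thesis unfolding forall_4 by blast
qed

lemma vec4_eq_iff: "v = w \<longleftrightarrow> v$0 = w$0 \<and> v$1 = w$1 \<and> v$2 = w$2 \<and> v$3 = w$3" for v w :: "real^4"
  by (simp add: vec_eq_iff all_4)

text \<open>The polarization of minus the determinant.\<close>

lemma ip22_tens: "ip22 (tens x y) (tens z w) = - (br x z * br y w) / 2"
  by (simp add: ip22_def br_def field_simps)

lemma br_simps [simp]: "br x x = 0" "br x (- z) = - br x z" "br (- x) z = - br x z"
  "br (x + w) z = br x z + br w z" "br x (z + w) = br x z + br x w"
  "br (x - w) z = br x z - br w z" "br x (z - w) = br x z - br x w"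
  "br (r *\<^sub>R x) z = r * br x z" "br x (r *\<^sub>R z) = r * br x z"
  by (simp_all add: br_def algebra_simps)

lemma br_commute: "br x z = - br z x"
  by (simp add: br_def)

text \<open>The area form gives the coordinates in a unimodular basis.\<close>

lemma spinor_expand: "br x x' = 1 \<Longrightarrow> v = br v x' *\<^sub>R x + br x v *\<^sub>R x'"
  by (simp add: br_def prod_eq_iff) algebra

lemma bounded_bilinear_br: "bounded_bilinear br"
  unfolding bilinear_conv_bounded_bilinear[symmetric] bilinear_def linear_iff by simp

lemma bounded_bilinear_tens: "bounded_bilinear tens"
  unfolding bilinear_conv_bounded_bilinear[symmetric] bilinear_def linear_iff
  by (simp add: vec4_eq_iff field_simps)

lemma bounded_bilinear_ip22: "bounded_bilinear ip22"
  unfolding bilinear_conv_bounded_bilinear[symmetric] bilinear_def linear_iff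
  by (simp add: ip22_def algebra_simps)

lemma bounded_bilinear_wedge1: "bounded_bilinear wedge1"
  unfolding bilinear_conv_bounded_bilinear[symmetric] bilinear_def linear_iff
  by (simp add: wedge1_def vec_eq_iff algebra_simps)

lemmas ip22_simps [simp] =
  bounded_bilinear.add_left[OF bounded_bilinear_ip22] bounded_bilinear.add_right[OF bounded_bilinear_ip22]
  bounded_bilinear.diff_left[OF bounded_bilinear_ip22] bounded_bilinear.diff_right[OF bounded_bilinear_ip22]
  bounded_bilinear.scaleR_left[OF bounded_bilinear_ip22] bounded_bilinear.scaleR_right[OF bounded_bilinear_ip22]
  bounded_bilinear.minus_left[OF bounded_bilinear_ip22] bounded_bilinear.minus_right[OF bounded_bilinear_ip22]
  bounded_bilinear.zero_left[OF bounded_bilinear_ip22] bounded_bilinear.zero_right[OF bounded_bilinear_ip22]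

lemma ip22_commute: "ip22 x y = ip22 y x"
  by (simp add: ip22_def mult.commute)

lemmas tens_add_left = bounded_bilinear.add_left[OF bounded_bilinear_tens]
lemmas tens_add_right = bounded_bilinear.add_right[OF bounded_bilinear_tens]
lemmas tens_diff_left = bounded_bilinear.diff_left[OF bounded_bilinear_tens]
lemmas tens_diff_right = bounded_bilinear.diff_right[OF bounded_bilinear_tens]
lemmas tens_scaleR_left = bounded_bilinear.scaleR_left[OF bounded_bilinear_tens]
lemmas tens_scaleR_right = bounded_bilinear.scaleR_right[OF bounded_bilinear_tens]
lemmas tens_linear = tens_add_left tens_add_right tens_diff_left tens_diff_right
  tens_scaleR_left tens_scaleR_right

lemmas smooth_on_br [smooth_intros] = smooth_on_bounded_bilinear[OF _ bounded_bilinear_br]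
lemmas smooth_on_tens [smooth_intros] = smooth_on_bounded_bilinear[OF _ bounded_bilinear_tens]
lemmas smooth_on_ip22 [smooth_intros] = smooth_on_bounded_bilinear[OF _ bounded_bilinear_ip22]

lemma dd_bilinear:
  assumes "bounded_bilinear p" "f differentiable (at a)" "g differentiable (at a)"
  shows "dd h (\<lambda>a. p (f a) (g a)) a = p (f a) (dd h g a) + p (dd h f a) (g a)"
  by (rule dd_eqI) (use bounded_bilinear.FDERIV[OF assms(1), of f _ a UNIV g] assms(2,3)
      in \<open>simp add: frechet_derivative_works\<close>)

lemma dd_add: "f differentiable (at a) \<Longrightarrow> g differentiable (at a) \<Longrightarrow>
    dd h (\<lambda>a. f a + g a) a = dd h f a + dd h g a"
  by (rule dd_eqI[where f' = "\<lambda>h. dd h f a + dd h g a"]) (auto intro: derivative_intros simp: frechet_derivative_works)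

lemmas dd_mult = dd_bilinear[OF bounded_bilinear_mult]
lemmas dd_br = dd_bilinear[OF bounded_bilinear_br]
lemmas dd_tens = dd_bilinear[OF bounded_bilinear_tens]
lemmas dd_ip22 = dd_bilinear[OF bounded_bilinear_ip22]
lemmas dd_wedge1 = dd_bilinear[OF bounded_bilinear_wedge1]

section \<open>Spinor frames\<close>

text \<open>A smooth map to \<open>SL(2,\<real>)\<close>, given by the columns of its values. Its Maurer-Cartan form has the
  entries \<open>om\<close>, \<open>cf\<close>, \<open>bf\<close> and has trace zero: \<open>dx = om x + cf x'\<close> and \<open>dx' = bf x - om x'\<close>.\<close>

locale spinor_pair =
  fixes U :: "A set" and x x' :: "A \<Rightarrow> spinor"
  assumes open_U: "open U" and smooth_x: "smooth_on U x" and smooth_x': "smooth_on U x'"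
    and unimodular: "\<And>a. a \<in> U \<Longrightarrow> br (x a) (x' a) = 1"
begin

definition om :: "A \<Rightarrow> A \<Rightarrow> real" where "om h a = br (dd h x a) (x' a)"
definition cf :: "A \<Rightarrow> A \<Rightarrow> real" where "cf h a = br (x a) (dd h x a)"
definition bf :: "A \<Rightarrow> A \<Rightarrow> real" where "bf h a = br (dd h x' a) (x' a)"

lemma diff_x: "a \<in> U \<Longrightarrow> x differentiable (at a)" and diff_x': "a \<in> U \<Longrightarrow> x' differentiable (at a)"
  using smooth_x smooth_x' smooth_on_differentiable by blast+

lemma smooth_om [smooth_intros]: "smooth_on U (om h)"
  unfolding om_def by (intro smooth_intros open_U smooth_x smooth_x' smooth_on_dd)

lemma smooth_cf [smooth_intros]: "smooth_on U (cf h)"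
  unfolding cf_def by (intro smooth_intros open_U smooth_x smooth_x' smooth_on_dd)

lemma smooth_bf [smooth_intros]: "smooth_on U (bf h)"
  unfolding bf_def by (intro smooth_intros open_U smooth_x smooth_x' smooth_on_dd)

lemma dd_x: "a \<in> U \<Longrightarrow> dd h x a = om h a *\<^sub>R x a + cf h a *\<^sub>R x' a"
  unfolding om_def cf_def by (rule spinor_expand[OF unimodular])

lemma dd_x': assumes a: "a \<in> U" shows "dd h x' a = bf h a *\<^sub>R x a - om h a *\<^sub>R x' a"
proof -
  have "dd h (\<lambda>a. br (x a) (x' a)) a = dd h (\<lambda>a. 1) a"
    by (rule dd_cong[OF open_U a unimodular])
  then have "br (x a) (dd h x' a) = - om h a"
    using dd_br[OF diff_x[OF a] diff_x'[OF a], of h] by (simp add: om_def)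
  then show ?thesis
    using spinor_expand[OF unimodular[OF a], of "dd h x' a"] by (simp add: bf_def)
qed

lemma om_linear: "a \<in> U \<Longrightarrow> linear (\<lambda>h. om h a)" and cf_linear: "a \<in> U \<Longrightarrow> linear (\<lambda>h. cf h a)"
  and bf_linear: "a \<in> U \<Longrightarrow> linear (\<lambda>h. bf h a)"
  using has_derivative_linear[OF smooth_on_deriv[OF smooth_x]]
    has_derivative_linear[OF smooth_on_deriv[OF smooth_x']]
  by (auto simp: linear_iff om_def cf_def bf_def)

text \<open>This and the next two lemmas are the structure equations of \<open>SL(2,\<real>)\<close>: they express that second
  derivatives of \<open>x\<close> and of \<open>x'\<close> commute.\<close>

lemma om_structure:
  assumes a: "a \<in> U"
  shows "dd h (om k) a - dd k (om h) a = cf h a * bf k a - cf k a * bf h a"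
proof -
  have 1: "dd h (om k) a = br (dd k x a) (dd h x' a) + br (dd h (dd k x) a) (x' a)" for h k
    unfolding om_def
    by (rule dd_br) (use a smooth_on_differentiable smooth_on_dd[OF smooth_x] diff_x' in auto)
  show ?thesis
    unfolding 1 dd_commute[OF open_U a smooth_x, of k h] dd_x[OF a] dd_x'[OF a]
    by (simp add: br_commute[of "x' a" "x a"] unimodular[OF a] algebra_simps)
qed

lemma cf_structure:
  assumes a: "a \<in> U"
  shows "dd h (cf k) a - dd k (cf h) a = 2 * (om h a * cf k a - om k a * cf h a)"
proof -
  have 1: "dd h (cf k) a = br (x a) (dd h (dd k x) a) + br (dd h x a) (dd k x a)" for h k
    unfolding cf_def
    by (rule dd_br) (use a smooth_on_differentiable smooth_on_dd[OF smooth_x] diff_x in auto)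
  show ?thesis
    unfolding 1 dd_commute[OF open_U a smooth_x, of k h] dd_x[OF a]
    by (simp add: br_commute[of "x' a" "x a"] unimodular[OF a] algebra_simps)
qed

lemma bf_structure:
  assumes a: "a \<in> U"
  shows "dd h (bf k) a - dd k (bf h) a = 2 * (bf h a * om k a - bf k a * om h a)"
proof -
  have 1: "dd h (bf k) a = br (dd k x' a) (dd h x' a) + br (dd h (dd k x') a) (x' a)" for h k
    unfolding bf_def
    by (rule dd_br) (use a smooth_on_differentiable smooth_on_dd[OF smooth_x'] diff_x' in auto)
  show ?thesis
    unfolding 1 dd_commute[OF open_U a smooth_x', of k h] dd_x'[OF a]
    by (simp add: br_commute[of "x' a" "x a"] unimodular[OF a] algebra_simps)
qed

end

text \<open>Two unimodular pairs give a frame of \<open>\<real>\<^sup>2\<^sup>,\<^sup>2\<close> by null vectors. The plane of \<open>T1, T2\<close>, meant to be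
  tangent to a surface, is orthogonal to the plane of \<open>E1, E2\<close>.\<close>

locale spinor_frame = L: spinor_pair U x x' + R: spinor_pair U y y' for U x x' y y'
begin

definition T1 where "T1 a = tens (x a) (y' a)"
definition T2 where "T2 a = tens (x' a) (y a)"
definition E1 where "E1 a = tens (x a) (y a)"
definition E2 where "E2 a = tens (x' a) (y' a)"

lemmas open_U = L.open_U

lemma frame_ip [simp]:
  assumes "a \<in> U"
  shows "ip22 (T1 a) (T1 a) = 0" "ip22 (T2 a) (T2 a) = 0" "ip22 (T1 a) (T2 a) = 1/2" "ip22 (T2 a) (T1 a) = 1/2"
    "ip22 (E1 a) (E1 a) = 0" "ip22 (E2 a) (E2 a) = 0" "ip22 (E1 a) (E2 a) = -1/2" "ip22 (E2 a) (E1 a) = -1/2"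
    "ip22 (T1 a) (E1 a) = 0" "ip22 (T1 a) (E2 a) = 0" "ip22 (T2 a) (E1 a) = 0" "ip22 (T2 a) (E2 a) = 0"
    "ip22 (E1 a) (T1 a) = 0" "ip22 (E2 a) (T1 a) = 0" "ip22 (E1 a) (T2 a) = 0" "ip22 (E2 a) (T2 a) = 0"
  using L.unimodular[OF assms] R.unimodular[OF assms] br_commute[of "x' a" "x a"] br_commute[of "y' a" "y a"]
  by (auto simp: T1_def T2_def E1_def E2_def ip22_tens)

lemma frame_expand:
  assumes "a \<in> U"
  shows "v = (2 * ip22 v (T2 a)) *\<^sub>R T1 a + (2 * ip22 v (T1 a)) *\<^sub>R T2 a
    - (2 * ip22 v (E2 a)) *\<^sub>R E1 a - (2 * ip22 v (E1 a)) *\<^sub>R E2 a"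
proof -
  have e: "fst (x a) * snd (x' a) - snd (x a) * fst (x' a) = 1" "fst (y a) * snd (y' a) - snd (y a) * fst (y' a) = 1"
    using L.unimodular[OF assms] R.unimodular[OF assms] by (auto simp: br_def)
  show ?thesis
    unfolding vec4_eq_iff
    using e by (simp add: T1_def T2_def E1_def E2_def ip22_def field_simps) algebra
qed

lemma smooth_frame [smooth_intros]: "smooth_on U T1" "smooth_on U T2" "smooth_on U E1" "smooth_on U E2"
  unfolding T1_def T2_def E1_def E2_def
  by (intro smooth_intros open_U L.smooth_x L.smooth_x' R.smooth_x R.smooth_x')+

lemma dd_frame:
  assumes a: "a \<in> U"
  shows "dd h T1 a = (L.om h a - R.om h a) *\<^sub>R T1 a + L.cf h a *\<^sub>R E2 a + R.bf h a *\<^sub>R E1 a"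
    "dd h T2 a = (R.om h a - L.om h a) *\<^sub>R T2 a + L.bf h a *\<^sub>R E1 a + R.cf h a *\<^sub>R E2 a"
    "dd h E1 a = (L.om h a + R.om h a) *\<^sub>R E1 a + L.cf h a *\<^sub>R T2 a + R.cf h a *\<^sub>R T1 a"
    "dd h E2 a = - (L.om h a + R.om h a) *\<^sub>R E2 a + L.bf h a *\<^sub>R T1 a + R.bf h a *\<^sub>R T2 a"
  unfolding T1_def T2_def E1_def E2_def
  by (simp_all add: dd_tens L.diff_x L.diff_x' R.diff_x R.diff_x' a L.dd_x L.dd_x' R.dd_x R.dd_x'
      tens_linear algebra_simps)

text \<open>The tangent part contains the connection form \<open>om - om'\<close> of the two pairs, and the normal part the
  second fundamental form.\<close>

lemma dd_combination:
  assumes p: "smooth_on U p" and q: "smooth_on U q" and a: "a \<in> U"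
  shows "dd j (\<lambda>a. p a *\<^sub>R T1 a + q a *\<^sub>R T2 a) a =
    (dd j p a + (L.om j a - R.om j a) * p a) *\<^sub>R T1 a
    + (dd j q a - (L.om j a - R.om j a) * q a) *\<^sub>R T2 a
    + (p a * R.bf j a + q a * L.bf j a) *\<^sub>R E1 a
    + (p a * L.cf j a + q a * R.cf j a) *\<^sub>R E2 a"
proof -
  have "dd j (\<lambda>a. p a *\<^sub>R T1 a + q a *\<^sub>R T2 a) a =
      (p a *\<^sub>R dd j T1 a + dd j p a *\<^sub>R T1 a) + (q a *\<^sub>R dd j T2 a + dd j q a *\<^sub>R T2 a)"
    by (rule dd_eqI', (rule has_derivative_add has_derivative_scaleR smooth_on_deriv[OF p a] smooth_on_deriv[OF q a]
        smooth_frame[THEN smooth_on_deriv, OF a])+) (rule refl)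
  then show ?thesis
    unfolding dd_frame[OF a] by (simp add: vec4_eq_iff algebra_simps)
qed

end

text \<open>The second condition says that \<open>E1\<close> and \<open>E2\<close> are normal to the surface. The immersion is encoded
  by the coefficients \<open>al\<close> and \<open>be\<close> of its differential on \<open>T1\<close> and \<open>T2\<close>.\<close>

locale spin_frame = spinor_frame +
  fixes X :: "A \<Rightarrow> real^4"
  assumes smooth_X: "smooth_on U X"
    and adapted: "\<And>a h. a \<in> U \<Longrightarrow> ip22 (tang X a h) (tens (x a) (y a)) = 0"
      "\<And>a h. a \<in> U \<Longrightarrow> ip22 (tang X a h) (tens (x' a) (y' a)) = 0"
begin

definition al where "al h a = 2 * ip22 (tang X a h) (T2 a)"
definition be where "be h a = 2 * ip22 (tang X a h) (T1 a)"

lemma tang_eq: "a \<in> U \<Longrightarrow> tang X a h = al h a *\<^sub>R T1 a + be h a *\<^sub>R T2 a"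
  using frame_expand[of a "tang X a h"] adapted[of a h] by (simp add: al_def be_def E1_def E2_def)

lemma smooth_tang [smooth_intros]: "smooth_on U (\<lambda>a. tang X a h)"
  unfolding tang_def by (rule smooth_on_dd[OF smooth_X])

lemma smooth_al [smooth_intros]: "smooth_on U (al h)" and smooth_be [smooth_intros]: "smooth_on U (be h)"
  unfolding al_def be_def by (intro smooth_intros open_U)+

lemma tang_linear: "a \<in> U \<Longrightarrow> linear (tang X a)"
  unfolding tang_def by (rule has_derivative_linear[OF smooth_on_deriv[OF smooth_X]])

lemma al_linear: "a \<in> U \<Longrightarrow> linear (\<lambda>h. al h a)" and be_linear: "a \<in> U \<Longrightarrow> linear (\<lambda>h. be h a)"
  using tang_linear[of a] by (auto simp: linear_iff al_def be_def)

lemma dd_tang: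
  assumes a: "a \<in> U"
  shows "dd j (\<lambda>a. tang X a k) a =
    (dd j (al k) a + (L.om j a - R.om j a) * al k a) *\<^sub>R T1 a
    + (dd j (be k) a - (L.om j a - R.om j a) * be k a) *\<^sub>R T2 a
    + (al k a * R.bf j a + be k a * L.bf j a) *\<^sub>R E1 a
    + (al k a * L.cf j a + be k a * R.cf j a) *\<^sub>R E2 a"
proof -
  have "dd j (\<lambda>a. tang X a k) a = dd j (\<lambda>a. al k a *\<^sub>R T1 a + be k a *\<^sub>R T2 a) a"
    by (rule dd_cong[OF open_U a tang_eq])
  then show ?thesis unfolding dd_combination[OF smooth_al smooth_be a] .
qed

lemma dd_tang_ip:
  assumes a: "a \<in> U"
  shows "ip22 (dd j (\<lambda>a. tang X a k) a) (E1 a) = - (al k a * L.cf j a + be k a * R.cf j a) / 2"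
    "ip22 (dd j (\<lambda>a. tang X a k) a) (E2 a) = - (al k a * R.bf j a + be k a * L.bf j a) / 2"
    "ip22 (dd j (\<lambda>a. tang X a k) a) (T1 a) = (dd j (be k) a - (L.om j a - R.om j a) * be k a) / 2"
    "ip22 (dd j (\<lambda>a. tang X a k) a) (T2 a) = (dd j (al k) a + (L.om j a - R.om j a) * al k a) / 2"
  using a by (simp_all add: dd_tang field_simps)

lemma dd_tang_commute: "a \<in> U \<Longrightarrow> dd j (\<lambda>a. tang X a k) a = dd k (\<lambda>a. tang X a j) a"
  unfolding tang_def by (rule dd_commute[OF open_U _ smooth_X])

text \<open>The components on \<open>E1\<close>, \<open>E2\<close>, \<open>T1\<close>, \<open>T2\<close> of the symmetry of the second derivatives of \<open>X\<close>: the
  symmetry of the second fundamental form, and the vanishing of the torsion.\<close>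

lemma codazzi:
  assumes a: "a \<in> U"
  shows "al k a * L.cf j a + be k a * R.cf j a = al j a * L.cf k a + be j a * R.cf k a"
    "al k a * R.bf j a + be k a * L.bf j a = al j a * R.bf k a + be j a * L.bf k a"
    "dd j (be k) a - (L.om j a - R.om j a) * be k a = dd k (be j) a - (L.om k a - R.om k a) * be j a"
    "dd j (al k) a + (L.om j a - R.om j a) * al k a = dd k (al j) a + (L.om k a - R.om k a) * al j a"
  using dd_tang_ip[OF a, of j k] dd_tang_ip[OF a, of k j] dd_tang_commute[OF a, of j k] by auto

end

subsection \<open>The Gauss equation\<close>

lemma coord_simps [simp]: "coord 1 = 1" "coord 2 = \<sigma>"
  by (simp_all add: coord_def)

text \<open>The vectors \<open>S j k\<close> are the values of the second fundamental form, that is the normal parts of the second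
  derivatives of \<open>X\<close>. The Christoffel symbols are determined by the tangent parts (\<open>key\<close> below);
  the derivative of this relation contains the third derivatives of \<open>X\<close>, which cancel in
  the curvature because they are symmetric.\<close>

lemma gauss_equation:
  assumes U: "open U" "a \<in> U" and X: "smooth_on U X" and nondeg: "\<And>b. b \<in> U \<Longrightarrow> det (metric X b) \<noteq> 0"
  obtains S :: "2 \<Rightarrow> 2 \<Rightarrow> real^4" where
    "\<And>j k. \<exists>p q. S j k = dd (coord j) (\<lambda>b. tang X b (coord k)) a - p *\<^sub>R tang X a 1 - q *\<^sub>R tang X a \<sigma>"
    "\<And>j k. ip22 (S j k) (tang X a 1) = 0" "\<And>j k. ip22 (S j k) (tang X a \<sigma>) = 0"
    "gauss_curvature X a * det (metric X a)
      = ip22 (S 2 2) (dd 1 (\<lambda>b. tang X b 1) a) - ip22 (S 1 2) (dd \<sigma> (\<lambda>b. tang X b 1) a)"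
proof -
  define V where "V i b = tang X b (coord i)" for i b
  define D where "D i j b = dd (coord i) (V j) b" for i j b
  define g where "g i j b = ip22 (V i b) (V j b)" for i j b
  define r where "r i j m b = ip22 (D i j b) (V m b)" for i j m b
  define \<Gamma> where "\<Gamma> l i j b = christoffel X b l i j" for l i j b
  have sV: "smooth_on U (V i)" for i
    unfolding V_def tang_def by (rule smooth_on_dd[OF X])
  have sD: "smooth_on U (D i j)" for i j
    unfolding D_def by (rule smooth_on_dd[OF sV])
  have sg: "smooth_on U (g i j)" for i j
    unfolding g_def by (intro smooth_intros U sV)
  have sr: "smooth_on U (r i j m)" for i j m
    unfolding r_def by (intro smooth_intros U sV sD)
  have Dsym: "D i j b = D j i b" if "b \<in> U" for i j b
    unfolding D_def V_def tang_def by (rule dd_commute[OF U(1) that X])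
  have gsym: "g i j b = g j i b" for i j b by (simp add: g_def ip22_commute)
  have met: "metric X b $ i $ j = g i j b" for b i j
    by (simp add: metric_def first_form_def g_def V_def)
  have dg: "dd (coord l) (g i j) b = r l i j b + r l j i b" if "b \<in> U" for l i j b
    unfolding g_def r_def D_def
    by (subst dd_ip22) (use that smooth_on_differentiable[OF sV] in \<open>auto simp: ip22_commute\<close>)
  have dm: "d_metric X b l i j = r l i j b + r l j i b" if "b \<in> U" for l i j b
    unfolding d_metric_def met dg[OF that, symmetric] ..
  have chr: "\<Gamma> l i j b = (\<Sum>m\<in>UNIV. matrix_inv (metric X b) $ l $ m * r i j m b)" if "b \<in> U" for l i j b
    unfolding \<Gamma>_def christoffel_def dm[OF that] sum_2
    by (simp add: r_def Dsym[OF that, of 2 1] Dsym[OF that, of i 1] Dsym[OF that, of i 2]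
        Dsym[OF that, of j 1] Dsym[OF that, of j 2] Dsym[OF that, of j i])
  \<comment> \<open>The tangent part of the second derivative is the combination of the \<open>V l\<close> with coefficients \<open>\<Gamma> l i j\<close>.\<close>
  have key: "\<Gamma> 1 i j b * g 1 m b + \<Gamma> 2 i j b * g 2 m b = r i j m b" if b: "b \<in> U" for i j m b
  proof -
    have "invertible (metric X b)" using nondeg[OF b] invertible_det_nz by blast
    then have "metric X b ** matrix_inv (metric X b) = mat 1"
      unfolding invertible_def matrix_inv_def by (rule someI2_ex) blast
    then have e: "(\<Sum>k\<in>UNIV. g m k b * matrix_inv (metric X b) $ k $ n) = (if m = n then 1 else 0)" for n
      by (auto simp: matrix_matrix_mult_def mat_def vec_eq_iff met)
    have "\<Gamma> 1 i j b * g 1 m b + \<Gamma> 2 i j b * g 2 m b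
       = (\<Sum>k\<in>UNIV. g m k b * matrix_inv (metric X b) $ k $ 1) * r i j 1 b
        + (\<Sum>k\<in>UNIV. g m k b * matrix_inv (metric X b) $ k $ 2) * r i j 2 b"
      unfolding chr[OF b] sum_2 by (simp add: gsym[of 1 m] gsym[of 2 m] algebra_simps)
    also have "\<dots> = r i j m b"
      unfolding e using exhaust_2[of m] by auto
    finally show ?thesis .
  qed
  have dn: "g 1 1 b * g 2 2 b - g 1 2 b * g 1 2 b \<noteq> 0" if "b \<in> U" for b
    using nondeg[OF that] by (simp add: det_2 met gsym[of 2 1])
  \<comment> \<open>Cramer's rule shows that the Christoffel symbols are smooth.\<close>
  have s\<Gamma>1: "smooth_on U (\<Gamma> 1 i j)" for i j
  proof (rule smooth_on_cong[OF U(1)])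
    show "smooth_on U (\<lambda>b. (r i j 1 b * g 2 2 b - r i j 2 b * g 1 2 b) / (g 1 1 b * g 2 2 b - g 1 2 b * g 1 2 b))"
      by (intro smooth_intros U sr sg dn)
    show "(r i j 1 b * g 2 2 b - r i j 2 b * g 1 2 b) / (g 1 1 b * g 2 2 b - g 1 2 b * g 1 2 b) = \<Gamma> 1 i j b"
      if "b \<in> U" for b
      using dn[OF that] unfolding key[OF that, symmetric] gsym[of 2 1] by (simp add: field_simps)
  qed
  have s\<Gamma>2: "smooth_on U (\<Gamma> 2 i j)" for i j
  proof (rule smooth_on_cong[OF U(1)])
    show "smooth_on U (\<lambda>b. (r i j 2 b * g 1 1 b - r i j 1 b * g 1 2 b) / (g 1 1 b * g 2 2 b - g 1 2 b * g 1 2 b))"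
      by (intro smooth_intros U sr sg dn)
    show "(r i j 2 b * g 1 1 b - r i j 1 b * g 1 2 b) / (g 1 1 b * g 2 2 b - g 1 2 b * g 1 2 b) = \<Gamma> 2 i j b"
      if "b \<in> U" for b
      using dn[OF that] unfolding key[OF that, symmetric] gsym[of 2 1] by (simp add: field_simps)
  qed
  have dkey: "dd (coord p) (\<Gamma> 1 i j) a * g 1 m a + \<Gamma> 1 i j a * (r p 1 m a + r p m 1 a)
      + (dd (coord p) (\<Gamma> 2 i j) a * g 2 m a + \<Gamma> 2 i j a * (r p 2 m a + r p m 2 a))
     = ip22 (dd (coord p) (D i j) a) (V m a) + ip22 (D i j a) (D p m a)" for p i j m
  proof -
    have "dd (coord p) (\<lambda>b. \<Gamma> 1 i j b * g 1 m b + \<Gamma> 2 i j b * g 2 m b) a = dd (coord p) (r i j m) a"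
      by (rule dd_cong[OF U key])
    moreover have "dd (coord p) (\<lambda>b. \<Gamma> 1 i j b * g 1 m b + \<Gamma> 2 i j b * g 2 m b) a
       = (\<Gamma> 1 i j a * dd (coord p) (g 1 m) a + dd (coord p) (\<Gamma> 1 i j) a * g 1 m a)
       + (\<Gamma> 2 i j a * dd (coord p) (g 2 m) a + dd (coord p) (\<Gamma> 2 i j) a * g 2 m a)"
      by (rule dd_eqI', (rule has_derivative_add has_derivative_mult
          s\<Gamma>1[THEN smooth_on_deriv, OF U(2)] s\<Gamma>2[THEN smooth_on_deriv, OF U(2)] sg[THEN smooth_on_deriv, OF U(2)])+)
        (rule refl)
    moreover have "dd (coord p) (r i j m) a = ip22 (dd (coord p) (D i j) a) (V m a) + ip22 (D i j a) (D p m a)"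
      unfolding r_def D_def[of p m]
      by (subst dd_ip22) (use U smooth_on_differentiable[OF sV] smooth_on_differentiable[OF sD] in auto)
    ultimately show ?thesis
      unfolding dg[OF U(2)] by (simp add: algebra_simps)
  qed
  define S where "S j k = D j k a - \<Gamma> 1 j k a *\<^sub>R V 1 a - \<Gamma> 2 j k a *\<^sub>R V 2 a" for j k
  show ?thesis
  proof (rule that[of S])
    show "\<exists>p q. S j k = dd (coord j) (\<lambda>b. tang X b (coord k)) a - p *\<^sub>R tang X a 1 - q *\<^sub>R tang X a \<sigma>" for j k
      by (intro exI[of _ "\<Gamma> 1 j k a"] exI[of _ "\<Gamma> 2 j k a"]) (simp add: S_def D_def V_def[abs_def])
    show "ip22 (S j k) (tang X a 1) = 0" "ip22 (S j k) (tang X a \<sigma>) = 0" for j k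
      using key[OF U(2), of j k 1] key[OF U(2), of j k 2]
      by (simp_all add: S_def r_def g_def V_def)
    have third: "dd 1 (D 2 2) a = dd \<sigma> (D 1 2) a"
      using dd_commute[OF U sV[of 2], of 1 \<sigma>] by (simp add: D_def[abs_def])
    have "det (metric X a) \<noteq> 0" using nondeg U(2) by blast
    then have "gauss_curvature X a * det (metric X a) = riemann X a 1 2 2 1 * g 1 1 a + riemann X a 1 2 2 2 * g 2 1 a"
      by (simp add: gauss_curvature_def sum_2 met)
    also have "\<dots> = ip22 (S 2 2) (D 1 1 a) - ip22 (S 1 2) (D 2 1 a)"
    proof -
      have p: "(\<Gamma> 1 1 1 a * \<Gamma> 1 2 2 a + \<Gamma> 1 1 2 a * \<Gamma> 2 2 2 a) * g 1 1 a
          + (\<Gamma> 2 1 1 a * \<Gamma> 1 2 2 a + \<Gamma> 2 1 2 a * \<Gamma> 2 2 2 a) * g 2 1 a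
          = \<Gamma> 1 2 2 a * r 1 1 1 a + \<Gamma> 2 2 2 a * r 1 2 1 a"
        "(\<Gamma> 1 2 1 a * \<Gamma> 1 1 2 a + \<Gamma> 1 2 2 a * \<Gamma> 2 1 2 a) * g 1 1 a
          + (\<Gamma> 2 2 1 a * \<Gamma> 1 1 2 a + \<Gamma> 2 2 2 a * \<Gamma> 2 1 2 a) * g 2 1 a
          = \<Gamma> 1 1 2 a * r 2 1 1 a + \<Gamma> 2 1 2 a * r 2 2 1 a"
        by (simp_all add: key[OF U(2), symmetric] algebra_simps)
      have q: "ip22 (S 2 2) (D 1 1 a) = ip22 (D 2 2 a) (D 1 1 a) - \<Gamma> 1 2 2 a * r 1 1 1 a - \<Gamma> 2 2 2 a * r 1 1 2 a"
        "ip22 (S 1 2) (D 2 1 a) = ip22 (D 1 2 a) (D 2 1 a) - \<Gamma> 1 1 2 a * r 2 1 1 a - \<Gamma> 2 1 2 a * r 2 1 2 a"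
        by (simp_all add: S_def r_def ip22_commute[of _ "D 1 1 a"] ip22_commute[of _ "D 2 1 a"])
      have rm: "riemann X a 1 2 2 l = dd 1 (\<Gamma> l 2 2) a - dd \<sigma> (\<Gamma> l 1 2) a
          + ((\<Gamma> l 1 1 a * \<Gamma> 1 2 2 a + \<Gamma> l 1 2 a * \<Gamma> 2 2 2 a) - (\<Gamma> l 2 1 a * \<Gamma> 1 1 2 a + \<Gamma> l 2 2 a * \<Gamma> 2 1 2 a))" for l
        by (simp add: riemann_def sum_2 \<Gamma>_def[abs_def])
      show ?thesis
        using dkey[where p=1 and i=2 and j=2 and m=1] dkey[where p=2 and i=1 and j=2 and m=1] third p q
        unfolding rm coord_simps by (simp add: algebra_simps)
    qed
    finally show "gauss_curvature X a * det (metric X a)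
      = ip22 (S 2 2) (dd 1 (\<lambda>b. tang X b 1) a) - ip22 (S 1 2) (dd \<sigma> (\<lambda>b. tang X b 1) a)"
      by (simp add: D_def V_def[abs_def])
  qed
qed

section \<open>Curvatures in terms of a spinor frame\<close>

lemma wedge2_bilinear: "bounded_bilinear wedge2"
  unfolding bilinear_conv_bounded_bilinear[symmetric] bilinear_def linear_iff
  by (simp add: wedge2_def algebra_simps)

lemmas wedge2_linear =
  bounded_bilinear.add_left[OF wedge2_bilinear] bounded_bilinear.add_right[OF wedge2_bilinear]
  bounded_bilinear.scaleR_left[OF wedge2_bilinear] bounded_bilinear.scaleR_right[OF wedge2_bilinear]
  bounded_bilinear.minus_left[OF wedge2_bilinear] bounded_bilinear.minus_right[OF wedge2_bilinear]

lemmas wedge1_linear =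
  bounded_bilinear.add_left[OF bounded_bilinear_wedge1] bounded_bilinear.add_right[OF bounded_bilinear_wedge1]
  bounded_bilinear.diff_left[OF bounded_bilinear_wedge1] bounded_bilinear.diff_right[OF bounded_bilinear_wedge1]
  bounded_bilinear.scaleR_left[OF bounded_bilinear_wedge1] bounded_bilinear.scaleR_right[OF bounded_bilinear_wedge1]

lemma wedge1_same [simp]: "wedge1 v v = 0"
  by (simp add: wedge1_def vec_eq_iff)

lemma wedge1_swap: "wedge1 v w = - wedge1 w v"
  by (simp add: wedge1_def vec_eq_iff)

lemma wedge2_repeated [simp]: "wedge2 (wedge1 u v) (wedge1 u z) = 0" "wedge2 (wedge1 v u) (wedge1 u z) = 0"
  "wedge2 (wedge1 u v) (wedge1 z u) = 0" "wedge2 (wedge1 v u) (wedge1 z u) = 0"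
  by (simp_all add: wedge2_def wedge1_def algebra_simps)

text \<open>The frame \<open>T1, T2, E1, E2\<close> has constant volume, and it is negatively oriented.\<close>

lemma wedge2_tens:
  "wedge2 (wedge1 (tens x y') (tens x' y)) (wedge1 (tens x y) (tens x' y')) = - (br x x' * br y y')\<^sup>2 / 4"
proof -
  have "4 * wedge2 (wedge1 (tens x y') (tens x' y)) (wedge1 (tens x y) (tens x' y')) + (br x x' * br y y')\<^sup>2 = 0"
    unfolding wedge2_def wedge1_def br_def power2_eq_square
    by (simp add: field_simps)
  then show ?thesis by simp
qed

text \<open>The condition says that \<open>al\<close> and \<open>be\<close> are linearly independent, so that \<open>X\<close> is an immersion and
  its tangent planes are spanned by \<open>T1\<close> and \<open>T2\<close>.\<close>

locale immersed_spin_frame = spin_frame +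
  assumes nondeg: "\<And>a. a \<in> U \<Longrightarrow> al 1 a * be \<sigma> a - al \<sigma> a * be 1 a \<noteq> 0"
begin

definition Jac :: "A \<Rightarrow> real" where "Jac a = al 1 a * be \<sigma> a - al \<sigma> a * be 1 a"

lemma Jac_nz: "a \<in> U \<Longrightarrow> Jac a \<noteq> 0"
  using nondeg by (simp add: Jac_def)

lemma al_be_coord:
  assumes "a \<in> U"
  shows "al h a = sre h * al 1 a + sim h * al \<sigma> a" "be h a = sre h * be 1 a + sim h * be \<sigma> a"
  using linear_A_expand[OF al_linear[OF assms], of h] linear_A_expand[OF be_linear[OF assms], of h] by simp_all

lemma al_be_wedge:
  assumes "a \<in> U"
  shows "al h a * be k a - al k a * be h a = Jac a * (sre h * sim k - sim h * sre k)"
  unfolding al_be_coord[OF assms, of h] al_be_coord[OF assms, of k] Jac_def by algebra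

lemma al_be_solve:
  assumes "a \<in> U"
  shows "\<exists>h. al h a = p \<and> be h a = q"
proof (intro exI conjI)
  let ?h = "SC ((p * be \<sigma> a - q * al \<sigma> a) / Jac a) ((q * al 1 a - p * be 1 a) / Jac a)"
  show "al ?h a = p" "be ?h a = q"
    unfolding al_be_coord[OF assms, of ?h] splitc.sel using Jac_nz[OF assms]
    by (simp_all add: field_simps, simp_all add: Jac_def algebra_simps)
qed

lemma al_be_inject:
  assumes a: "a \<in> U" and h: "al h a = 0" "be h a = 0" shows "h = 0"
proof -
  have "sre h * sim k - sim h * sre k = 0" for k
    using al_be_wedge[OF a, of h k] h Jac_nz[OF a] by simp
  from this[of 1] this[of \<sigma>] show ?thesis
    by (simp add: splitc_eq_iff)
qed

lemma first_form_eq: "a \<in> U \<Longrightarrow> first_form X a h k = (al h a * be k a + be h a * al k a) / 2"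
  by (simp add: first_form_def tang_eq[of a h] tang_eq[of a k] field_simps)

lemma det_metric: "a \<in> U \<Longrightarrow> det (metric X a) = - (Jac a)\<^sup>2 / 4"
  by (simp add: det_2 metric_def first_form_eq Jac_def field_simps power2_eq_square)

text \<open>For an orthonormal frame \<open>(h, k)\<close> the square of the left-hand side is \<open>(al h be k + al k be h)\<^sup>2 -
  4 al h be h al k be k = 4\<close>; its sign depends only on the orientation.\<close>

lemma tangent_frameD:
  assumes a: "a \<in> U" and "tangent_frame X a h k"
  shows "al h a * be k a - al k a * be h a = 2 * sgn (Jac a)"
proof -
  have e: "al h a * be h a = -1" "al k a * be k a = 1" "al h a * be k a + al k a * be h a = 0"
    and o: "sre h * sim k - sim h * sre k > 0"
    using assms by (auto simp: tangent_frame_def first_form_eq algebra_simps)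
  let ?w = "al h a * be k a - al k a * be h a"
  have "?w\<^sup>2 = 2\<^sup>2"
    using e by algebra
  then have "?w = 2 \<or> ?w = -2" by (simp only: power2_eq_iff)
  moreover have "sgn ?w = sgn (Jac a)"
    unfolding al_be_wedge[OF a] sgn_mult using o by simp
  ultimately show ?thesis by (auto simp: sgn_if split: if_splits)
qed

lemma tangent_frame_ex:
  assumes a: "a \<in> U" shows "\<exists>h k. tangent_frame X a h k"
proof -
  obtain h where h: "al h a = 1" "be h a = -1" using al_be_solve[OF a] by blast
  obtain k where k: "al k a = 1" "be k a = 1" using al_be_solve[OF a] by blast
  have m: "al (- k) a = - 1" "be (- k) a = -1"
    using linear_neg[OF al_linear[OF a], of k] linear_neg[OF be_linear[OF a], of k] k by auto
  have "Jac a * (sre h * sim k - sim h * sre k) = 2"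
    using al_be_wedge[OF a, of h k] h k by simp
  then have "sre h * sim k - sim h * sre k \<noteq> 0" by auto
  then consider "sre h * sim k - sim h * sre k > 0" | "sre h * sim (- k) - sim h * sre (- k) > 0"
    by fastforce
  then show ?thesis
  proof cases
    case 1 then show ?thesis
      by (intro exI[of _ h] exI[of _ k]) (use a h k in \<open>auto simp: tangent_frame_def first_form_eq\<close>)
  next
    case 2 then show ?thesis
      by (intro exI[of _ h] exI[of _ "- k"]) (use a h m in \<open>auto simp: tangent_frame_def first_form_eq\<close>)
  qed
qed

theorem lorentzian: "lorentzian_immersion U X"
  unfolding lorentzian_immersion_def
proof (intro conjI ballI smooth_X)
  fix a assume a: "a \<in> U"
  show "inj (tang X a)"
  proof (rule linear_injective_0[OF tang_linear[OF a], THEN iffD2], intro allI impI)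
    fix h assume h: "tang X a h = 0"
    show "h = 0" by (rule al_be_inject[OF a]) (simp_all add: al_def be_def h)
  qed
  show "\<exists>h k. first_form X a h h = - 1 \<and> first_form X a k k = 1 \<and> first_form X a h k = 0"
    using tangent_frame_ex[OF a] by (auto simp: tangent_frame_def)
qed

text \<open>In particular the value does not depend on the frame that is chosen in the definition of the Gauss map.\<close>

lemma gauss_map_eq:
  assumes a: "a \<in> U" shows "gauss_map X a = (2 * sgn (Jac a)) *\<^sub>R wedge1 (T1 a) (T2 a)"
proof -
  define hk where "hk = (SOME (h, k). tangent_frame X a h k)"
  have "tangent_frame X a (fst hk) (snd hk)"
    using someI_ex[of "\<lambda>(h, k). tangent_frame X a h k"] tangent_frame_ex[OF a]
    unfolding hk_def by (auto simp: case_prod_unfold)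
  from tangent_frameD[OF a this] have *: "al (fst hk) a * be (snd hk) a - al (snd hk) a * be (fst hk) a = 2 * sgn (Jac a)" .
  have "gauss_map X a = wedge1 (tang X a (fst hk)) (tang X a (snd hk))"
    unfolding gauss_map_def hk_def[symmetric] by (simp add: case_prod_unfold)
  also have "\<dots> = (al (fst hk) a * be (snd hk) a - al (snd hk) a * be (fst hk) a) *\<^sub>R wedge1 (T1 a) (T2 a)"
    using a by (simp add: tang_eq wedge1_linear wedge1_swap[of "T2 a" "T1 a"] algebra_simps)
  finally show ?thesis unfolding * .
qed

lemma dd_gauss_map:
  assumes a: "a \<in> U"
  shows "dd h (gauss_map X) a = (2 * sgn (Jac a)) *\<^sub>R
    (L.cf h a *\<^sub>R wedge1 (E2 a) (T2 a) + R.bf h a *\<^sub>R wedge1 (E1 a) (T2 a)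
     + L.bf h a *\<^sub>R wedge1 (T1 a) (E1 a) + R.cf h a *\<^sub>R wedge1 (T1 a) (E2 a))"
proof -
  have sJ: "smooth_on U Jac"
    unfolding Jac_def[abs_def] by (intro smooth_intros open_U)
  \<comment> \<open>The sign of \<open>Jac\<close> is constant near \<open>a\<close>, so that it can be taken out of the derivative.\<close>
  define V where "V = {b \<in> U. Jac b * Jac a > 0}"
  have "open V"
    unfolding V_def using smooth_on_continuous[OF sJ] open_U
    by (auto intro!: continuous_open_preimage[where T = "{0<..}", unfolded vimage_def Int_def, simplified] continuous_intros)
  have "a \<in> V" using a Jac_nz[OF a] by (auto simp: V_def zero_less_mult_iff neq_iff)
  have "sgn (Jac b) = sgn (Jac a)" if "b \<in> V" for b
    using that by (auto simp: V_def zero_less_mult_iff)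
  then have "gauss_map X b = (2 * sgn (Jac a)) *\<^sub>R wedge1 (T1 b) (T2 b)" if "b \<in> V" for b
    using gauss_map_eq[of b] that by (auto simp: V_def)
  then have "dd h (gauss_map X) a = dd h (\<lambda>b. (2 * sgn (Jac a)) *\<^sub>R wedge1 (T1 b) (T2 b)) a"
    by (rule dd_cong[OF \<open>open V\<close> \<open>a \<in> V\<close>])
  also have "\<dots> = (2 * sgn (Jac a)) *\<^sub>R dd h (\<lambda>b. wedge1 (T1 b) (T2 b)) a"
    by (rule dd_bounded_linear[OF bounded_linear_scaleR_right])
      (rule smooth_on_differentiable[OF smooth_on_bounded_bilinear[OF open_U bounded_bilinear_wedge1] a]; rule smooth_frame)
  also have "dd h (\<lambda>b. wedge1 (T1 b) (T2 b)) a = wedge1 (T1 a) (dd h T2 a) + wedge1 (dd h T1 a) (T2 a)"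
    by (rule dd_wedge1) (use a smooth_on_differentiable smooth_frame in blast)+
  finally show ?thesis
    unfolding dd_frame[OF a] by (simp add: wedge1_linear algebra_simps)
qed

lemma delta_form_eq:
  assumes a: "a \<in> U"
  shows "delta_form X a h = R.bf h a * R.cf h a - L.bf h a * L.cf h a"
proof -
  have v: "wedge2 (wedge1 (T1 a) (T2 a)) (wedge1 (E1 a) (E2 a)) = - 1 / 4"
    using wedge2_tens[of "x a" "y' a" "x' a" "y a"] L.unimodular[OF a] R.unimodular[OF a]
    by (simp add: T1_def T2_def E1_def E2_def)
  have 1: "wedge2 (wedge1 (E2 a) (T2 a)) (wedge1 (T1 a) (E1 a)) = - 1 / 4"
    "wedge2 (wedge1 (T1 a) (E1 a)) (wedge1 (E2 a) (T2 a)) = - 1 / 4"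
    "wedge2 (wedge1 (E1 a) (T2 a)) (wedge1 (T1 a) (E2 a)) = 1 / 4"
    "wedge2 (wedge1 (T1 a) (E2 a)) (wedge1 (E1 a) (T2 a)) = 1 / 4"
    using v unfolding wedge2_def wedge1_def by (simp_all add: algebra_simps)
  have "sgn (Jac a) * sgn (Jac a) = 1"
    using Jac_nz[OF a] by (simp add: sgn_if)
  then show ?thesis
    unfolding delta_form_def dd_gauss_map[OF a] by (simp add: wedge2_linear 1 algebra_simps)
qed

lemma polar_delta_form:
  assumes a: "a \<in> U"
  shows "polar (delta_form X a) h k = (R.bf h a * R.cf k a + R.bf k a * R.cf h a
    - L.bf h a * L.cf k a - L.bf k a * L.cf h a) / 2"
  unfolding polar_def delta_form_eq[OF a]
  by (simp add: linear_add[OF L.bf_linear[OF a]] linear_add[OF L.cf_linear[OF a]]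
      linear_add[OF R.bf_linear[OF a]] linear_add[OF R.cf_linear[OF a]] algebra_simps)

text \<open>When \<open>cf \<and> bf\<close> vanishes for both pairs, the matrix of \<open>\<delta>\<close> is the difference of two matrices of rank one,
  with determinant minus the right-hand side; the metric has negative determinant.\<close>

theorem Delta_pos_iff:
  assumes a: "a \<in> U"
    and L: "L.cf 1 a * L.bf \<sigma> a = L.cf \<sigma> a * L.bf 1 a" and R: "R.cf 1 a * R.bf \<sigma> a = R.cf \<sigma> a * R.bf 1 a"
  shows "Delta X a > 0 \<longleftrightarrow>
    (L.bf 1 a * R.bf \<sigma> a - L.bf \<sigma> a * R.bf 1 a) * (L.cf 1 a * R.cf \<sigma> a - L.cf \<sigma> a * R.cf 1 a) > 0"
    (is "_ \<longleftrightarrow> ?Y > 0")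
proof -
  let ?m = "\<lambda>h k. R.bf h a * R.cf k a - L.bf h a * L.cf k a"
  have m: "polar (delta_form X a) 1 \<sigma> = ?m 1 \<sigma>" "polar (delta_form X a) \<sigma> 1 = ?m 1 \<sigma>"
    "polar (delta_form X a) 1 1 = ?m 1 1" "polar (delta_form X a) \<sigma> \<sigma> = ?m \<sigma> \<sigma>"
    using L R by (simp_all add: polar_delta_form[OF a] field_simps)
  have "Delta X a = (?m 1 1 * ?m \<sigma> \<sigma> - ?m 1 \<sigma> * ?m 1 \<sigma>) / (- (Jac a)\<^sup>2 / 4)"
    unfolding Delta_def det_metric[OF a] by (simp add: det_2 m)
  also have "?m 1 1 * ?m \<sigma> \<sigma> - ?m 1 \<sigma> * ?m 1 \<sigma> = - ?Y"
    using L R by algebra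
  finally have "Delta X a = 4 * (?Y / (Jac a)\<^sup>2)" by simp
  then show ?thesis
    using Jac_nz[OF a] by (simp only: zero_less_mult_iff[of 4] zero_less_divide_iff) auto
qed

text \<open>The Gauss equation, with the second fundamental form given by \<open>dd_tang_ip\<close>; the products
  that do not contain the area \<open>al \<and> be\<close> cancel.\<close>

theorem gauss_curvature_zero_iff:
  assumes a: "a \<in> U"
  shows "gauss_curvature X a = 0 \<longleftrightarrow>
    L.cf 1 a * L.bf \<sigma> a - L.cf \<sigma> a * L.bf 1 a = R.cf 1 a * R.bf \<sigma> a - R.cf \<sigma> a * R.bf 1 a"
proof -
  have dm: "det (metric X b) \<noteq> 0" if "b \<in> U" for b
    using det_metric[OF that] Jac_nz[OF that] by simp
  obtain S where S: "\<And>j k. \<exists>p q. S j k = dd (coord j) (\<lambda>b. tang X b (coord k)) a - p *\<^sub>R tang X a 1 - q *\<^sub>R tang X a \<sigma>"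
    "\<And>j k. ip22 (S j k) (tang X a 1) = 0" "\<And>j k. ip22 (S j k) (tang X a \<sigma>) = 0"
    "gauss_curvature X a * det (metric X a)
      = ip22 (S 2 2) (dd 1 (\<lambda>b. tang X b 1) a) - ip22 (S 1 2) (dd \<sigma> (\<lambda>b. tang X b 1) a)"
    using gauss_equation[OF open_U a smooth_X dm] by blast
  have T0: "ip22 (S j k) (T1 a) = 0 \<and> ip22 (S j k) (T2 a) = 0" for j k
  proof -
    obtain h where h: "al h a = 1" "be h a = 0" using al_be_solve[OF a] by blast
    obtain h' where h': "al h' a = 0" "be h' a = 1" using al_be_solve[OF a] by blast
    have "ip22 (S j k) (tang X a h) = 0" for h
      using S(2,3)[of j k] linear_add[OF tang_linear[OF a], of "sre h *\<^sub>R 1" "sim h *\<^sub>R \<sigma>"]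
        linear_scale[OF tang_linear[OF a]] A_basis[of h] by simp
    from this[of h] this[of h'] show ?thesis
      by (simp add: tang_eq[OF a] h h')
  qed
  have ipS: "ip22 (S j k) w = - 2 * (ip22 (dd (coord j) (\<lambda>b. tang X b (coord k)) a) (E2 a) * ip22 w (E1 a)
      + ip22 (dd (coord j) (\<lambda>b. tang X b (coord k)) a) (E1 a) * ip22 w (E2 a))" for j k w
  proof -
    have 1: "ip22 (S j k) (E1 a) = ip22 (dd (coord j) (\<lambda>b. tang X b (coord k)) a) (E1 a)"
      "ip22 (S j k) (E2 a) = ip22 (dd (coord j) (\<lambda>b. tang X b (coord k)) a) (E2 a)"
      using S(1)[of j k] a by (auto simp: tang_eq)
    show ?thesis
      by (subst frame_expand[OF a, of "S j k"])
        (simp add: T0 1 ip22_commute[of _ w] algebra_simps)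
  qed
  have "gauss_curvature X a * det (metric X a) = - (Jac a / 2) *
     ((L.cf 1 a * L.bf \<sigma> a - L.cf \<sigma> a * L.bf 1 a) - (R.cf 1 a * R.bf \<sigma> a - R.cf \<sigma> a * R.bf 1 a))"
    unfolding S(4) ipS coord_simps dd_tang_ip[OF a] Jac_def by (simp add: field_simps)
  then show ?thesis
    using dm[OF a] Jac_nz[OF a] by auto
qed

lemma is_normal_iff:
  assumes a: "a \<in> U"
  shows "is_normal X a n \<longleftrightarrow> ip22 n (T1 a) = 0 \<and> ip22 n (T2 a) = 0"
proof -
  obtain h where h: "al h a = 1" "be h a = 0" using al_be_solve[OF a] by blast
  obtain h' where h': "al h' a = 0" "be h' a = 1" using al_be_solve[OF a] by blast
  have e: "ip22 n (tang X a h) = ip22 n (T1 a)" "ip22 n (tang X a h') = ip22 n (T2 a)"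
    by (simp_all add: tang_eq[OF a] h h')
  show ?thesis
  proof
    assume "is_normal X a n"
    then show "ip22 n (T1 a) = 0 \<and> ip22 n (T2 a) = 0"
      unfolding is_normal_def e[symmetric] by blast
  next
    assume "ip22 n (T1 a) = 0 \<and> ip22 n (T2 a) = 0"
    then show "is_normal X a n"
      unfolding is_normal_def by (simp add: tang_eq[OF a])
  qed
qed

lemma normal_part_eq:
  assumes a: "a \<in> U"
  shows "normal_part X a w = - (2 * ip22 w (E2 a)) *\<^sub>R E1 a - (2 * ip22 w (E1 a)) *\<^sub>R E2 a" (is "_ = ?n")
  unfolding normal_part_def
proof (rule the_equality)
  obtain h where "al h a = 2 * ip22 w (T2 a)" "be h a = 2 * ip22 w (T1 a)"
    using al_be_solve[OF a] by blast
  then have "w - ?n = tang X a h"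
    using frame_expand[OF a, of w] by (simp add: tang_eq[OF a] algebra_simps)
  then show "is_normal X a ?n \<and> w - ?n \<in> range (tang X a)"
    using a by (auto simp: is_normal_iff[OF a])
next
  fix n assume n: "is_normal X a n \<and> w - n \<in> range (tang X a)"
  then obtain h where h: "w - n = tang X a h" by blast
  have "ip22 n (E1 a) = ip22 w (E1 a)" "ip22 n (E2 a) = ip22 w (E2 a)"
    using arg_cong[OF h, of "\<lambda>v. ip22 v (E1 a)"] arg_cong[OF h, of "\<lambda>v. ip22 v (E2 a)"] a
    by (simp_all add: tang_eq)
  then show "n = ?n"
    using frame_expand[OF a, of n] n by (simp add: is_normal_iff[OF a])
qed

lemma normal_deriv_eq:
  assumes a: "a \<in> U" and f: "smooth_on U f1" "smooth_on U f2"
    and N: "\<And>b. b \<in> U \<Longrightarrow> N b = f1 b *\<^sub>R E1 b + f2 b *\<^sub>R E2 b"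
  shows "normal_deriv X k a N = (dd k f1 a + (L.om k a + R.om k a) * f1 a) *\<^sub>R E1 a
    + (dd k f2 a - (L.om k a + R.om k a) * f2 a) *\<^sub>R E2 a"
proof -
  have "dd k N a = dd k (\<lambda>b. f1 b *\<^sub>R E1 b + f2 b *\<^sub>R E2 b) a"
    by (rule dd_cong[OF open_U a N])
  also have "\<dots> = (f1 a *\<^sub>R dd k E1 a + dd k f1 a *\<^sub>R E1 a) + (f2 a *\<^sub>R dd k E2 a + dd k f2 a *\<^sub>R E2 a)"
    by (rule dd_eqI', (rule has_derivative_add has_derivative_scaleR f[THEN smooth_on_deriv, OF a]
        smooth_frame[THEN smooth_on_deriv, OF a])+) (rule refl)
  finally show ?thesis
    unfolding normal_deriv_def normal_part_eq[OF a] using a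
    by (simp add: dd_frame) (simp add: vec4_eq_iff algebra_simps)
qed

text \<open>The curvature of the connection form \<open>om + om'\<close> of the normal bundle, by \<open>om_structure\<close>.\<close>

definition Om :: "A \<Rightarrow> real" where
  "Om a = (L.cf 1 a * L.bf \<sigma> a - L.cf \<sigma> a * L.bf 1 a) + (R.cf 1 a * R.bf \<sigma> a - R.cf \<sigma> a * R.bf 1 a)"

text \<open>In the frame \<open>E1, E2\<close> the normal connection is diagonal, with forms \<open>\<nu>\<close> and \<open>-\<nu>\<close>. Its curvature is
  \<open>d\<nu>\<close> on \<open>E1\<close> and \<open>-d\<nu>\<close> on \<open>E2\<close>.\<close>

lemma normal_curv_eq:
  assumes a: "a \<in> U"
  shows "normal_curv X a h k n = (Om a * (sre h * sim k - sim h * sre k)) *\<^sub>R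
    (- (2 * ip22 n (E2 a)) *\<^sub>R E1 a + (2 * ip22 n (E1 a)) *\<^sub>R E2 a)"
proof -
  define f1 where "f1 b = - (2 * ip22 n (E2 b))" for b
  define f2 where "f2 b = - (2 * ip22 n (E1 b))" for b
  define \<nu> where "\<nu> k b = L.om k b + R.om k b" for k b
  define N where "N = (\<lambda>b. normal_part X b n)"
  have s: "smooth_on U f1" "smooth_on U f2" "smooth_on U (\<nu> k)" for k
    unfolding f1_def[abs_def] f2_def[abs_def] \<nu>_def[abs_def]
    by (intro smooth_intros open_U L.smooth_om R.smooth_om)+
  have N: "N b = f1 b *\<^sub>R E1 b + f2 b *\<^sub>R E2 b" if "b \<in> U" for b
    using normal_part_eq[OF that] by (simp add: N_def f1_def f2_def)
  have 1: "normal_deriv X k b N = (dd k f1 b + \<nu> k b * f1 b) *\<^sub>R E1 b + (dd k f2 b - \<nu> k b * f2 b) *\<^sub>R E2 b"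
    if "b \<in> U" for b k
    using normal_deriv_eq[OF that s(1,2) N] by (simp add: \<nu>_def)
  have s2: "smooth_on U (\<lambda>b. dd k f1 b + \<nu> k b * f1 b)" "smooth_on U (\<lambda>b. dd k f2 b - \<nu> k b * f2 b)" for k
    by (intro smooth_intros open_U s smooth_on_dd)+
  have d1: "dd h (\<lambda>b. dd k f1 b + \<nu> k b * f1 b) a = dd h (dd k f1) a + (\<nu> k a * dd h f1 a + dd h (\<nu> k) a * f1 a)" for h k
    by (rule dd_eqI', (rule has_derivative_add has_derivative_mult s[THEN smooth_on_deriv, OF a]
        s(1)[THEN smooth_on_dd, THEN smooth_on_deriv, OF a])+) (rule refl)
  have d2: "dd h (\<lambda>b. dd k f2 b - \<nu> k b * f2 b) a = dd h (dd k f2) a - (\<nu> k a * dd h f2 a + dd h (\<nu> k) a * f2 a)" for h k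
    by (rule dd_eqI', (rule has_derivative_diff has_derivative_mult s[THEN smooth_on_deriv, OF a]
        s(2)[THEN smooth_on_dd, THEN smooth_on_deriv, OF a])+) (rule refl)
  have 2: "normal_deriv X h a (\<lambda>b. normal_deriv X k b N) =
      (dd h (dd k f1) a + (\<nu> k a * dd h f1 a + dd h (\<nu> k) a * f1 a) + \<nu> h a * (dd k f1 a + \<nu> k a * f1 a)) *\<^sub>R E1 a
      + (dd h (dd k f2) a - (\<nu> k a * dd h f2 a + dd h (\<nu> k) a * f2 a) - \<nu> h a * (dd k f2 a - \<nu> k a * f2 a)) *\<^sub>R E2 a" for h k
    by (subst normal_deriv_eq[OF a s2 1]) (simp_all only: d1 d2 \<nu>_def[symmetric])
  have d\<nu>: "dd h (\<nu> k) a - dd k (\<nu> h) a = Om a * (sre h * sim k - sim h * sre k)"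
  proof -
    have "dd h (\<nu> k) a = dd h (L.om k) a + dd h (R.om k) a" for h k
      unfolding \<nu>_def[abs_def]
      by (rule dd_add; rule smooth_on_differentiable[OF _ a]; rule L.smooth_om R.smooth_om)
    then have e: "dd h (\<nu> k) a - dd k (\<nu> h) a =
      (L.cf h a * L.bf k a - L.cf k a * L.bf h a) + (R.cf h a * R.bf k a - R.cf k a * R.bf h a)"
      using L.om_structure[OF a, of h k] R.om_structure[OF a, of h k] by simp
    note c = linear_A_expand[where 'b = real, unfolded real_scaleR_def]
    show ?thesis
      unfolding e Om_def c[OF L.cf_linear[OF a], of h] c[OF L.cf_linear[OF a], of k]
        c[OF L.bf_linear[OF a], of h] c[OF L.bf_linear[OF a], of k]
        c[OF R.cf_linear[OF a], of h] c[OF R.cf_linear[OF a], of k]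
        c[OF R.bf_linear[OF a], of h] c[OF R.bf_linear[OF a], of k]
      by algebra
  qed
  have c: "dd h (dd k f1) a = dd k (dd h f1) a" "dd h (dd k f2) a = dd k (dd h f2) a"
    by (rule dd_commute[OF open_U a s(1)], rule dd_commute[OF open_U a s(2)])
  have "normal_curv X a h k n = ((dd h (\<nu> k) a - dd k (\<nu> h) a) * f1 a) *\<^sub>R E1 a - ((dd h (\<nu> k) a - dd k (\<nu> h) a) * f2 a) *\<^sub>R E2 a"
    unfolding normal_curv_def Let_def N_def[symmetric] 2 c by (simp add: vec4_eq_iff algebra_simps)
  then show ?thesis
    unfolding d\<nu> by (simp add: f1_def f2_def vec4_eq_iff algebra_simps)
qed

lemma normal_frame_ex:
  assumes a: "a \<in> U" and hk: "tangent_frame X a h k"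
  shows "\<exists>n1 n2. normal_frame X a h k n1 n2"
proof (intro exI)
  have s: "sgn (Jac a) * sgn (Jac a) = 1"
    using Jac_nz[OF a] by (simp add: sgn_if)
  have "wedge1 (tang X a h) (tang X a k) = (al h a * be k a - al k a * be h a) *\<^sub>R wedge1 (T1 a) (T2 a)"
    using a by (simp add: tang_eq wedge1_linear wedge1_swap[of "T2 a" "T1 a"] algebra_simps)
  moreover have "wedge2 (wedge1 (T1 a) (T2 a)) (wedge1 (E1 a) (E2 a)) = - 1 / 4"
    using wedge2_tens[of "x a" "y' a" "x' a" "y a"] L.unimodular[OF a] R.unimodular[OF a]
    by (simp add: T1_def T2_def E1_def E2_def)
  moreover have "wedge1 (E1 a + E2 a) (sgn (Jac a) *\<^sub>R (E1 a - E2 a)) = (- 2 * sgn (Jac a)) *\<^sub>R wedge1 (E1 a) (E2 a)"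
    by (simp add: wedge1_def vec_eq_iff algebra_simps)
  ultimately have "wedge2 (wedge1 (tang X a h) (tang X a k)) (wedge1 (E1 a + E2 a) (sgn (Jac a) *\<^sub>R (E1 a - E2 a))) > 0"
    unfolding tangent_frameD[OF a hk] using s by (simp add: wedge2_linear)
  then show "normal_frame X a h k (E1 a + E2 a) (sgn (Jac a) *\<^sub>R (E1 a - E2 a))"
    using a s by (simp add: normal_frame_def is_normal_iff algebra_simps)
qed

text \<open>In terms of the coefficients \<open>p, q\<close> of normal vectors on \<open>E1, E2\<close>, the conditions on a normal frame are
  \<open>p\<^sub>1 q\<^sub>1 = 1\<close>, \<open>p\<^sub>2 q\<^sub>2 = -1\<close> and \<open>p\<^sub>1 q\<^sub>2 + q\<^sub>1 p\<^sub>2 = 0\<close>. They imply that the factor \<open>p\<^sub>1 q\<^sub>2\<close>, by which the normal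
  curvature differs from \<open>Om\<close> up to the area of \<open>(h, k)\<close>, does not vanish.\<close>

theorem normal_curvature_zero_iff:
  assumes a: "a \<in> U"
  shows "normal_curvature X a = 0 \<longleftrightarrow>
    (L.cf 1 a * L.bf \<sigma> a - L.cf \<sigma> a * L.bf 1 a) + (R.cf 1 a * R.bf \<sigma> a - R.cf \<sigma> a * R.bf 1 a) = 0"
proof -
  define fr where "fr = (SOME (h, k, n1, n2). tangent_frame X a h k \<and> normal_frame X a h k n1 n2)"
  obtain h k n1 n2 where fr: "fr = (h, k, n1, n2)" by (metis prod_cases4)
  have "case fr of (h, k, n1, n2) \<Rightarrow> tangent_frame X a h k \<and> normal_frame X a h k n1 n2"
    unfolding fr_def
    by (rule someI_ex) (use tangent_frame_ex[OF a] normal_frame_ex[OF a] in fastforce)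
  then have f: "tangent_frame X a h k" "normal_frame X a h k n1 n2" by (auto simp: fr)
  let ?p = "\<lambda>n. - 2 * ip22 n (E2 a)" and ?q = "\<lambda>n. - 2 * ip22 n (E1 a)"
  have e: "n = ?p n *\<^sub>R E1 a + ?q n *\<^sub>R E2 a" if "is_normal X a n" for n
    using frame_expand[OF a, of n] that by (simp add: is_normal_iff[OF a])
  have ip: "ip22 n m = - (?p n * ?q m + ?q n * ?p m) / 2" if "is_normal X a n" "is_normal X a m" for n m
    by (subst e[OF that(1)], subst e[OF that(2)]) (use a in \<open>simp add: field_simps\<close>)
  have n: "?p n1 * ?q n1 = 1" "?p n2 * ?q n2 = -1" "?p n1 * ?q n2 + ?q n1 * ?p n2 = 0"
    using f(2) ip[of n1 n1] ip[of n2 n2] ip[of n1 n2] unfolding normal_frame_def by (auto simp: mult.commute)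
  have nz: "?p n1 \<noteq> 0" "?q n2 \<noteq> 0"
    using n by auto
  have "normal_curvature X a = ip22 (normal_curv X a h k n1) n2"
    unfolding normal_curvature_def fr_def[symmetric] fr by simp
  also have "\<dots> = Om a * (sre h * sim k - sim h * sre k) * ((?q n1 * ?p n2 - ?p n1 * ?q n2) / 2)"
    unfolding normal_curv_eq[OF a] by (simp add: ip22_commute[of _ n2] algebra_simps)
  also have "(?q n1 * ?p n2 - ?p n1 * ?q n2) / 2 = - (?p n1 * ?q n2)"
    using n(3) by (simp add: field_simps)
  finally have "normal_curvature X a = Om a * (sre h * sim k - sim h * sre k) * - (?p n1 * ?q n2)" .
  then show ?thesis
    using nz f(1) by (auto simp: tangent_frame_def Om_def)
qed

end

section \<open>Quaternions and spinor frames\<close>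

lemma quat_sel_simps [simp]:
  "q0 (a + b) = q0 a + q0 b" "q1 (a + b) = q1 a + q1 b" "q2 (a + b) = q2 a + q2 b" "q3 (a + b) = q3 a + q3 b"
  "q0 (x * y) = q0 x * q0 y - q1 x * q1 y - q2 x * q2 y - q3 x * q3 y"
  "q1 (x * y) = q0 x * q1 y + q1 x * q0 y + q2 x * q3 y - q3 x * q2 y"
  "q2 (x * y) = q0 x * q2 y - q1 x * q3 y + q2 x * q0 y + q3 x * q1 y"
  "q3 (x * y) = q0 x * q3 y + q1 x * q2 y - q2 x * q1 y + q3 x * q0 y"
  "q0 (1 :: 'd::comm_ring_1 quat) = 1" "q1 (1 :: 'd quat) = 0" "q2 (1 :: 'd quat) = 0" "q3 (1 :: 'd quat) = 0"
  "q0 (r *\<^sub>R z) = r *\<^sub>R q0 z" "q1 (r *\<^sub>R z) = r *\<^sub>R q1 z" "q2 (r *\<^sub>R z) = r *\<^sub>R q2 z" "q3 (r *\<^sub>R z) = r *\<^sub>R q3 z"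
  for a b :: "'c::ab_group_add quat" and x y :: "'d::comm_ring_1 quat" and z :: "'e::real_normed_vector quat"
  by (auto simp: plus_quat_def times_quat_def one_quat_def scaleR_quat_def)

lemma quat_eq_iff: "a = b \<longleftrightarrow> q0 a = q0 b \<and> q1 a = q1 b \<and> q2 a = q2 b \<and> q3 a = q3 b"
  by (cases a; cases b) auto

lemma h0_eq: "h0 p0 p1 p2 p3 = Quat (SC (of_real (sre p0)) (of_real (sim p0)))
    (SC (\<i> * of_real (sre p1)) (\<i> * of_real (sim p1))) (SC (of_real (sre p2)) (of_real (sim p2)))
    (SC (\<i> * of_real (sre p3)) (\<i> * of_real (sim p3)))"
  by (simp add: h0_def quat_eq_iff splitc_eq_iff HAC_of_A_def HAC_scalar_def AC_of_def imag_def Iq_def Jq_def Kq_def)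

lemma r22_eq: "r22 x = Quat (SC 0 (\<i> * of_real (x$0))) (SC (of_real (x$1)) 0)
    (SC (\<i> * of_real (x$2)) 0) (SC (of_real (x$3)) 0)"
proof -
  have "(of_real c :: HAC) = Quat (SC (of_real c) 0) 0 0 0" for c
    by (simp add: of_real_def quat_eq_iff splitc_eq_iff)
  then show ?thesis
    by (simp add: r22_def quat_eq_iff splitc_eq_iff HAC_scalar_def imag_def Iq_def Jq_def Kq_def)
qed

definition r22_inv :: "HAC \<Rightarrow> real^4" where
  "r22_inv z = (\<chi> i. if i = 0 then Im (sim (q0 z)) else if i = 1 then Re (sre (q1 z))
     else if i = 2 then Im (sre (q2 z)) else Re (sre (q3 z)))"

lemma r22_inv_r22 [simp]: "r22_inv (r22 x) = x"
  by (simp add: r22_inv_def r22_eq vec4_eq_iff)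

lemma bounded_linear_r22: "bounded_linear r22"
  unfolding linear_conv_bounded_linear[symmetric] linear_iff
  by (simp add: r22_eq quat_eq_iff splitc_eq_iff complex_eq_iff)

lemma bounded_linear_qs:
  "bounded_linear (q0 :: 'a::real_normed_vector quat \<Rightarrow> 'a)" "bounded_linear (q1 :: 'a quat \<Rightarrow> 'a)"
  "bounded_linear (q2 :: 'a quat \<Rightarrow> 'a)" "bounded_linear (q3 :: 'a quat \<Rightarrow> 'a)"
  by (rule bounded_linear_intro[where K=1]; simp add: norm_quat_def)+

lemma bounded_linear_coefficients:
  "bounded_linear (\<lambda>z :: HAC. Re (sre (q0 z)))" "bounded_linear (\<lambda>z :: HAC. Re (sim (q0 z)))"
  "bounded_linear (\<lambda>z :: HAC. Im (sre (q1 z)))" "bounded_linear (\<lambda>z :: HAC. Im (sim (q1 z)))"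
  "bounded_linear (\<lambda>z :: HAC. Re (sre (q2 z)))" "bounded_linear (\<lambda>z :: HAC. Re (sim (q2 z)))"
  "bounded_linear (\<lambda>z :: HAC. Im (sre (q3 z)))" "bounded_linear (\<lambda>z :: HAC. Im (sim (q3 z)))"
  "bounded_linear (\<lambda>z :: HAC. Im (sim (q0 z)))" "bounded_linear (\<lambda>z :: HAC. Re (sre (q1 z)))"
  "bounded_linear (\<lambda>z :: HAC. Im (sre (q2 z)))" "bounded_linear (\<lambda>z :: HAC. Re (sre (q3 z)))"
  using bounded_linear_compose[OF bounded_linear_Re bounded_linear_compose[OF bounded_linear_sre]]
    bounded_linear_compose[OF bounded_linear_Re bounded_linear_compose[OF bounded_linear_sim]]
    bounded_linear_compose[OF bounded_linear_Im bounded_linear_compose[OF bounded_linear_sre]]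
    bounded_linear_compose[OF bounded_linear_Im bounded_linear_compose[OF bounded_linear_sim]]
    bounded_linear_qs[where 'a = AC] by blast+

lemma bounded_linear_r22_inv: "bounded_linear r22_inv"
proof -
  have "bounded_linear (\<lambda>z :: HAC. Im (sim (q0 z)) *\<^sub>R axis 0 1 + Re (sre (q1 z)) *\<^sub>R axis 1 1
      + Im (sre (q2 z)) *\<^sub>R axis 2 1 + Re (sre (q3 z)) *\<^sub>R (axis 3 1 :: real^4))"
    by (intro bounded_linear_add bounded_linear_coefficients
        bounded_linear_compose[OF bounded_linear_scaleR_left])
  moreover have "r22_inv = (\<lambda>z :: HAC. Im (sim (q0 z)) *\<^sub>R axis 0 1 + Re (sre (q1 z)) *\<^sub>R axis 1 1
      + Im (sre (q2 z)) *\<^sub>R axis 2 1 + Re (sre (q3 z)) *\<^sub>R (axis 3 1 :: real^4))"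
    by (rule ext) (simp add: r22_inv_def vec4_eq_iff axis_def)
  ultimately show ?thesis by simp
qed

text \<open>An element \<open>p\<^sub>0 + i p\<^sub>1 I + p\<^sub>2 J + i p\<^sub>3 K\<close> of \<open>\<H>\<^sub>0\<close> is a pair of real \<open>2 \<times> 2\<close> matrices, one for each
  idempotent of the split-complex numbers: \<open>iI\<close> is the diagonal matrix \<open>(1, -1)\<close>, and \<open>J\<close>, \<open>iK\<close> are the matrices
  with rows \<open>(0, 1), (-1, 0)\<close> and \<open>(0, 1), (1, 0)\<close>. The spinors \<open>spx\<close>, \<open>spx'\<close> are the columns of the
  adjugate of the first matrix (its inverse, for elements of \<open>Spin(2,2)\<close>), and \<open>spy\<close>, \<open>spy'\<close> are the rows of the second one.
  With these choices the form \<open>\<xi>\<close> is a combination of tensor products of spinors (\<open>sandwich_eq\<close>).\<close>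

definition spx :: "HAC \<Rightarrow> spinor" where
  "spx z = ((Re (sre (q0 z)) + Re (sim (q0 z))) - (Im (sre (q1 z)) + Im (sim (q1 z))),
    (Re (sre (q2 z)) + Re (sim (q2 z))) - (Im (sre (q3 z)) + Im (sim (q3 z))))"

definition spx' :: "HAC \<Rightarrow> spinor" where
  "spx' z = (- (Re (sre (q2 z)) + Re (sim (q2 z))) - (Im (sre (q3 z)) + Im (sim (q3 z))),
    (Re (sre (q0 z)) + Re (sim (q0 z))) + (Im (sre (q1 z)) + Im (sim (q1 z))))"

definition spy :: "HAC \<Rightarrow> spinor" where
  "spy z = ((Re (sre (q0 z)) - Re (sim (q0 z))) + (Im (sre (q1 z)) - Im (sim (q1 z))),
    (Re (sre (q2 z)) - Re (sim (q2 z))) + (Im (sre (q3 z)) - Im (sim (q3 z))))"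

definition spy' :: "HAC \<Rightarrow> spinor" where
  "spy' z = ((Im (sre (q3 z)) - Im (sim (q3 z))) - (Re (sre (q2 z)) - Re (sim (q2 z))),
    (Re (sre (q0 z)) - Re (sim (q0 z))) - (Im (sre (q1 z)) - Im (sim (q1 z))))"

lemma bounded_linear_sp: "bounded_linear spx" "bounded_linear spx'" "bounded_linear spy" "bounded_linear spy'"
  unfolding spx_def[abs_def] spx'_def[abs_def] spy_def[abs_def] spy'_def[abs_def]
  by (intro bounded_linear_Pair bounded_linear_add bounded_linear_sub bounded_linear_minus bounded_linear_coefficients)+

text \<open>The inverse of \<open>z \<mapsto> (spx z, spx' z, spy z, spy' z)\<close> on \<open>\<H>\<^sub>0\<close>.\<close>

definition qspin :: "spinor \<times> spinor \<times> spinor \<times> spinor \<Rightarrow> HAC" where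
  "qspin = (\<lambda>(x, x', y, y').
    (let half = (\<lambda>p m. SC ((p + m) / 4) ((p - m) / 4))
     in h0 (half (fst x + snd x') (fst y + snd y')) (half (snd x' - fst x) (fst y - snd y'))
        (half (snd x - fst x') (snd y - fst y')) (half (- snd x - fst x') (snd y + fst y'))))"

lemma bounded_linear_qspin: "bounded_linear qspin"
  unfolding linear_conv_bounded_linear[symmetric] linear_iff
  by (simp add: qspin_def h0_eq quat_eq_iff splitc_eq_iff complex_eq_iff Let_def split_beta field_simps)

lemma sp_qspin [simp]: "spx (qspin (x, x', y, y')) = x" "spx' (qspin (x, x', y, y')) = x'"
  "spy (qspin (x, x', y, y')) = y" "spy' (qspin (x, x', y, y')) = y'"
  by (simp_all add: qspin_def spx_def spx'_def spy_def spy'_def h0_eq Let_def prod_eq_iff field_simps)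

lemma qspin_sp: "z \<in> Spin22 \<Longrightarrow> qspin (spx z, spx' z, spy z, spy' z) = z"
  by (auto simp: Spin22_def qspin_def spx_def spx'_def spy_def spy'_def h0_eq Let_def
      quat_eq_iff splitc_eq_iff complex_eq_iff field_simps)

lemma Spin22_iff: "qspin (x, x', y, y') \<in> Spin22 \<longleftrightarrow> br x x' = 1 \<and> br y y' = 1"
proof -
  have inj: "h0 p0 p1 p2 p3 = h0 r0 r1 r2 r3 \<longleftrightarrow> p0 = r0 \<and> p1 = r1 \<and> p2 = r2 \<and> p3 = r3"
    for p0 p1 p2 p3 r0 r1 r2 r3
    by (auto simp: h0_eq splitc_eq_iff)
  have mem: "h0 p0 p1 p2 p3 \<in> Spin22 \<longleftrightarrow> p0 * p0 - p1 * p1 + p2 * p2 - p3 * p3 = 1" for p0 p1 p2 p3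
    by (auto simp: Spin22_def inj)
  have "qspin (x, x', y, y') \<in> Spin22 \<longleftrightarrow> br x x' + br y y' = 2 \<and> br x x' - br y y' = 0"
    unfolding qspin_def Let_def split_beta mem fst_conv snd_conv
    by (simp add: splitc_eq_iff br_def) (auto simp: field_simps)
  then show ?thesis by auto
qed

lemma HAC_inv_eq:
  assumes "p0 * p0 - p1 * p1 + p2 * p2 - p3 * p3 = 1"
  shows "HAC_inv (h0 p0 p1 p2 p3) = h0 p0 (- p1) (- p2) (- p3)"
    and "h0 p0 (- p1) (- p2) (- p3) * h0 p0 p1 p2 p3 = 1" and "h0 p0 p1 p2 p3 * h0 p0 (- p1) (- p2) (- p3) = 1"
proof -
  let ?z = "h0 p0 p1 p2 p3" and ?w = "h0 p0 (- p1) (- p2) (- p3)"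
  have "sre p0 * sre p0 + sim p0 * sim p0 - (sre p1 * sre p1 + sim p1 * sim p1)
      + (sre p2 * sre p2 + sim p2 * sim p2) - (sre p3 * sre p3 + sim p3 * sim p3) = 1"
    "sre p0 * sim p0 - sre p1 * sim p1 + sre p2 * sim p2 - sre p3 * sim p3 = 0"
    using assms by (auto simp: splitc_eq_iff algebra_simps)
  then show 1: "?w * ?z = 1" and 2: "?z * ?w = 1"
    by (simp_all add: h0_eq quat_eq_iff splitc_eq_iff complex_eq_iff algebra_simps)
  show "HAC_inv ?z = ?w"
    unfolding HAC_inv_def
  proof (rule the_equality)
    fix y assume "?z * y = 1 \<and> y * ?z = 1"
    then have "?w * (?z * y) = ?w" by simp
    then show "y = ?w" by (simp add: mult.assoc[symmetric] 1)
  qed (use 1 2 in simp)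
qed

lemma Spin22_inverse:
  assumes "z \<in> Spin22" shows "HAC_inv z * z = 1" "z * HAC_inv z = 1"
  using assms HAC_inv_eq by (auto simp: Spin22_def)

text \<open>In terms of matrices, \<open>r J + s i K\<close> has the entries \<open>r + s\<close> and \<open>s - r\<close> off the diagonal and zero on it, so
  the product of the inverse of the first matrix of \<open>z\<close>, of this one and of the second matrix of \<open>z\<close> (which the
  conjugate \<open>hat z\<close> puts in the first place) is a column times a row plus another column times a row.\<close>

lemma sandwich_eq:
  assumes "z \<in> Spin22"
  shows "imag * HAC_inv z * (r *\<^sub>R Jq + s *\<^sub>R (imag * Kq)) * hat z
    = r22 ((r + s) *\<^sub>R tens (spx z) (spy' z) + (s - r) *\<^sub>R tens (spx' z) (spy z))"
proof -
  obtain p0 p1 p2 p3 where p: "z = h0 p0 p1 p2 p3" "p0 * p0 - p1 * p1 + p2 * p2 - p3 * p3 = 1"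
    using assms by (auto simp: Spin22_def)
  show ?thesis
    unfolding p(1) HAC_inv_eq(1)[OF p(2)]
    by (simp add: h0_eq r22_eq hat_def sconj_def imag_def HAC_scalar_def Jq_def Kq_def spx_def spx'_def spy_def spy'_def
        quat_eq_iff splitc_eq_iff complex_eq_iff, simp add: field_simps)
qed

lemma left_mult_qspin:
  "(HAC_of_A C * Jq + imag * HAC_of_A S * Kq) * qspin (x, x', y, y')
    = qspin ((sre (C - S) + sim (C - S)) *\<^sub>R x', - (sre (C + S) + sim (C + S)) *\<^sub>R x,
        (sre (C + S) - sim (C + S)) *\<^sub>R y', - (sre (C - S) - sim (C - S)) *\<^sub>R y)"
  by (simp add: qspin_def h0_eq HAC_of_A_def HAC_scalar_def AC_of_def imag_def Jq_def Kq_def Let_def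
      quat_eq_iff splitc_eq_iff complex_eq_iff, simp add: field_simps)

text \<open>Multiplication by \<open>\<sigma>\<close> is the identity on the first idempotent and minus the identity on the second one.\<close>

lemma sigma_mult_qspin: "HAC_scalar \<sigma> * qspin (x, x', y, y') = qspin (x, x', - y, - y')"
  by (simp add: qspin_def h0_eq HAC_scalar_def Let_def quat_eq_iff splitc_eq_iff complex_eq_iff field_simps)

text \<open>The equation \<open>g'g\<^sup>-\<^sup>1 = \<dots>\<close> for a conformal map \<open>g\<close>, in terms of spinors. Here \<open>sre h + sim h\<close> and
  \<open>sre h - sim h\<close> are the differentials of \<open>u + v\<close> and \<open>u - v\<close>, and \<open>\<theta>\<^sub>1 \<plusminus> \<theta>\<^sub>2\<close> are the two components of \<open>\<psi>\<close>.\<close>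

definition frame_eqs :: "A set \<Rightarrow> (A \<Rightarrow> real) \<Rightarrow> (A \<Rightarrow> real) \<Rightarrow> real \<Rightarrow>
    (A \<Rightarrow> spinor) \<Rightarrow> (A \<Rightarrow> spinor) \<Rightarrow> (A \<Rightarrow> spinor) \<Rightarrow> (A \<Rightarrow> spinor) \<Rightarrow> bool" where
  "frame_eqs U \<theta>1 \<theta>2 \<epsilon> x x' y y' \<longleftrightarrow> (\<forall>a\<in>U. \<forall>h.
     dd h x a = (\<epsilon> * exp (- (\<theta>1 a + \<theta>2 a)) * (sre h + sim h)) *\<^sub>R x' a
     \<and> dd h x' a = - (exp (\<theta>1 a + \<theta>2 a) * (sre h + sim h)) *\<^sub>R x a
     \<and> dd h y a = (exp (\<theta>1 a - \<theta>2 a) * (sre h - sim h)) *\<^sub>R y' a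
     \<and> dd h y' a = - (\<epsilon> * exp (- (\<theta>1 a - \<theta>2 a)) * (sre h - sim h)) *\<^sub>R y a)"

text \<open>On the idempotents \<open>A_cosh\<close> and \<open>A_sinh\<close> are the usual hyperbolic functions of \<open>u \<plusminus> v\<close>.\<close>

lemma A_cosh_sinh:
  "sre (A_cosh a + A_sinh a) + sim (A_cosh a + A_sinh a) = exp (sre a + sim a)"
  "sre (A_cosh a + A_sinh a) - sim (A_cosh a + A_sinh a) = exp (sre a - sim a)"
  "sre (A_cosh a - A_sinh a) + sim (A_cosh a - A_sinh a) = exp (- (sre a + sim a))"
  "sre (A_cosh a - A_sinh a) - sim (A_cosh a - A_sinh a) = exp (- (sre a - sim a))"
  unfolding A_cosh_def A_sinh_def
  by (simp_all add: cosh_field_def sinh_field_def exp_add exp_minus exp_diff field_simps)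

definition eta :: "real \<Rightarrow> A \<Rightarrow> HAC" where
  "eta \<epsilon> z = (if \<epsilon> = 1 then HAC_of_A (A_cosh z) * Jq + imag * HAC_of_A (A_sinh z) * Kq
     else HAC_of_A (A_sinh z) * Jq + imag * HAC_of_A (A_cosh z) * Kq)"

definition spin_eq :: "A set \<Rightarrow> (A \<Rightarrow> A) \<Rightarrow> real \<Rightarrow> (A \<Rightarrow> HAC) \<Rightarrow> bool" where
  "spin_eq U \<psi> \<epsilon> g \<longleftrightarrow> conformal_H U g \<and> g ` U \<subseteq> Spin22
     \<and> (\<forall>a\<in>U. d_u g a * HAC_inv (g a) = eta \<epsilon> (\<psi> a))"

lemma eta_mult_qspin:
  assumes "\<epsilon> = 1 \<or> \<epsilon> = -1"
  shows "eta \<epsilon> z * qspin (x, x', y, y') = qspin ((\<epsilon> * exp (- (sre z + sim z))) *\<^sub>R x', - exp (sre z + sim z) *\<^sub>R x,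
        exp (sre z - sim z) *\<^sub>R y', - (\<epsilon> * exp (- (sre z - sim z))) *\<^sub>R y)"
proof -
  let ?C = "A_cosh z" and ?S = "A_sinh z"
  have m: "?S - ?C = - (?C - ?S)" "?S + ?C = ?C + ?S" by simp_all
  show ?thesis
  proof (cases "\<epsilon> = 1")
    case True
    then show ?thesis unfolding eta_def if_P[OF True] left_mult_qspin A_cosh_sinh by simp
  next
    case False
    then have e: "\<epsilon> = -1" using assms by simp
    have n: "sre (?S - ?C) + sim (?S - ?C) = - (sre (?C - ?S) + sim (?C - ?S))"
      "sre (?S - ?C) - sim (?S - ?C) = - (sre (?C - ?S) - sim (?C - ?S))" by simp_all
    show ?thesis unfolding eta_def if_not_P[OF False] left_mult_qspin n m(2) A_cosh_sinh by (simp add: e)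
  qed
qed

lemma spin_eq_iff:
  "spin_eq U \<psi> \<epsilon> g \<longleftrightarrow> conformal_H U g \<and> g ` U \<subseteq> Spin22 \<and> (\<forall>a\<in>U. d_u g a = eta \<epsilon> (\<psi> a) * g a)"
proof -
  have "d_u g a * HAC_inv (g a) = e \<longleftrightarrow> d_u g a = e * g a" if "g ` U \<subseteq> Spin22" "a \<in> U" for a e
    using Spin22_inverse[of "g a"] that by (auto simp: mult.assoc)
  then show ?thesis
    unfolding spin_eq_def by auto
qed

lemma spinors_of_spin:
  assumes U: "open U" and \<epsilon>: "\<epsilon> = 1 \<or> \<epsilon> = -1" and g: "spin_eq U \<psi> \<epsilon> g"
    and \<psi>_eq: "\<forall>a\<in>U. \<psi> a = SC (\<theta>1 a) (\<theta>2 a)"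
  shows "spinor_pair U (\<lambda>a. spx (g a)) (\<lambda>a. spx' (g a))" "spinor_pair U (\<lambda>a. spy (g a)) (\<lambda>a. spy' (g a))"
    "frame_eqs U \<theta>1 \<theta>2 \<epsilon> (\<lambda>a. spx (g a)) (\<lambda>a. spx' (g a)) (\<lambda>a. spy (g a)) (\<lambda>a. spy' (g a))"
proof -
  have c: "smooth_on U g" "\<And>a. a \<in> U \<Longrightarrow> dd \<sigma> g a = HAC_scalar \<sigma> * dd 1 g a"
    and S: "\<And>a. a \<in> U \<Longrightarrow> g a \<in> Spin22" and e: "\<And>a. a \<in> U \<Longrightarrow> dd 1 g a = eta \<epsilon> (\<psi> a) * g a"
    using g unfolding spin_eq_iff conformal_H_def d_u_def d_v_def by auto
  have \<psi>: "\<And>a. a \<in> U \<Longrightarrow> \<psi> a = SC (\<theta>1 a) (\<theta>2 a)" using \<psi>_eq by blast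
  have q: "g a = qspin (spx (g a), spx' (g a), spy (g a), spy' (g a))" if "a \<in> U" for a
    using qspin_sp[OF S[OF that]] by simp
  have br: "br (spx (g a)) (spx' (g a)) = 1 \<and> br (spy (g a)) (spy' (g a)) = 1" if "a \<in> U" for a
    using S[OF that] Spin22_iff q[OF that] by metis
  note sm = smooth_on_bounded_linear[OF U bounded_linear_sp(1) c(1)] smooth_on_bounded_linear[OF U bounded_linear_sp(2) c(1)]
    smooth_on_bounded_linear[OF U bounded_linear_sp(3) c(1)] smooth_on_bounded_linear[OF U bounded_linear_sp(4) c(1)]
  show "spinor_pair U (\<lambda>a. spx (g a)) (\<lambda>a. spx' (g a))" "spinor_pair U (\<lambda>a. spy (g a)) (\<lambda>a. spy' (g a))"
    by unfold_locales (use U sm br in auto)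
  show "frame_eqs U \<theta>1 \<theta>2 \<epsilon> (\<lambda>a. spx (g a)) (\<lambda>a. spx' (g a)) (\<lambda>a. spy (g a)) (\<lambda>a. spy' (g a))"
    unfolding frame_eqs_def
  proof (intro ballI allI)
    fix a h assume a: "a \<in> U"
    interpret l: linear "\<lambda>h. dd h g a"
      using has_derivative_linear[OF smooth_on_deriv[OF c(1) a]] .
    let ?x = "spx (g a)" and ?x' = "spx' (g a)" and ?y = "spy (g a)" and ?y' = "spy' (g a)"
    have "dd 1 g a = eta \<epsilon> (\<psi> a) * qspin (?x, ?x', ?y, ?y')"
      using e[OF a] q[OF a] by simp
    then have h1: "dd 1 g a = qspin ((\<epsilon> * exp (- (\<theta>1 a + \<theta>2 a))) *\<^sub>R ?x', - exp (\<theta>1 a + \<theta>2 a) *\<^sub>R ?x,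
        exp (\<theta>1 a - \<theta>2 a) *\<^sub>R ?y', - (\<epsilon> * exp (- (\<theta>1 a - \<theta>2 a))) *\<^sub>R ?y)" (is "_ = qspin (?q1, ?q2, ?q3, ?q4)")
      by (simp only: eta_mult_qspin[OF \<epsilon>] \<psi>[OF a] splitc.sel)
    have h2: "dd \<sigma> g a = qspin (?q1, ?q2, - ?q3, - ?q4)"
      unfolding c(2)[OF a] h1 sigma_mult_qspin ..
    have dh: "dd h g a = sre h *\<^sub>R dd 1 g a + sim h *\<^sub>R dd \<sigma> g a"
      by (subst A_basis[of h]) (simp only: l.add l.scaleR)
    have d: "dd h (\<lambda>a. L (g a)) a = sre h *\<^sub>R L (dd 1 g a) + sim h *\<^sub>R L (dd \<sigma> g a)" if "bounded_linear L" for L :: "HAC \<Rightarrow> spinor"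
      using dd_bounded_linear[OF that smooth_on_differentiable[OF c(1) a], of h] unfolding dh
      by (simp add: linear_add[OF bounded_linear.linear[OF that]] linear_scale[OF bounded_linear.linear[OF that]])
    show "dd h (\<lambda>a. spx (g a)) a = (\<epsilon> * exp (- (\<theta>1 a + \<theta>2 a)) * (sre h + sim h)) *\<^sub>R ?x'
       \<and> dd h (\<lambda>a. spx' (g a)) a = - (exp (\<theta>1 a + \<theta>2 a) * (sre h + sim h)) *\<^sub>R ?x
       \<and> dd h (\<lambda>a. spy (g a)) a = (exp (\<theta>1 a - \<theta>2 a) * (sre h - sim h)) *\<^sub>R ?y'
       \<and> dd h (\<lambda>a. spy' (g a)) a = - (\<epsilon> * exp (- (\<theta>1 a - \<theta>2 a)) * (sre h - sim h)) *\<^sub>R ?y"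
      unfolding d[OF bounded_linear_sp(1)] d[OF bounded_linear_sp(2)] d[OF bounded_linear_sp(3)] d[OF bounded_linear_sp(4)]
        h1 h2 sp_qspin by (simp add: algebra_simps)
  qed
qed

lemma spin_of_spinors:
  assumes \<epsilon>: "\<epsilon> = 1 \<or> \<epsilon> = -1" and x: "spinor_pair U x x'" and y: "spinor_pair U y y'"
    and fe: "frame_eqs U \<theta>1 \<theta>2 \<epsilon> x x' y y'" and \<psi>: "\<forall>a\<in>U. \<psi> a = SC (\<theta>1 a) (\<theta>2 a)"
  shows "spin_eq U \<psi> \<epsilon> (\<lambda>a. qspin (x a, x' a, y a, y' a))" (is "spin_eq U \<psi> \<epsilon> ?g")
proof -
  interpret L: spinor_pair U x x' by fact
  interpret R: spinor_pair U y y' by fact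
  have s: "smooth_on U (\<lambda>a. (x a, x' a, y a, y' a))"
    by (intro smooth_intros L.open_U L.smooth_x L.smooth_x' R.smooth_x R.smooth_x')
  have dg: "dd h ?g a = qspin (dd h x a, dd h x' a, dd h y a, dd h y' a)" if a: "a \<in> U" for h a
  proof -
    have "dd h ?g a = qspin (dd h (\<lambda>a. (x a, x' a, y a, y' a)) a)"
      by (rule dd_bounded_linear[OF bounded_linear_qspin smooth_on_differentiable[OF s a]])
    also have "dd h (\<lambda>a. (x a, x' a, y a, y' a)) a = (dd h x a, dd h x' a, dd h y a, dd h y' a)"
      by (rule dd_eqI) (intro has_derivative_Pair smooth_on_deriv[of U] a L.smooth_x L.smooth_x' R.smooth_x R.smooth_x')
    finally show ?thesis .
  qed
  show ?thesis
    unfolding spin_eq_iff conformal_H_def d_u_def d_v_def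
  proof (intro conjI ballI)
    show "smooth_on U ?g"
      by (rule smooth_on_bounded_linear[OF L.open_U bounded_linear_qspin s])
    show "?g ` U \<subseteq> Spin22"
      using L.unimodular R.unimodular by (auto simp: Spin22_iff)
  next
    fix a assume a: "a \<in> U"
    show "dd \<sigma> ?g a = HAC_scalar \<sigma> * dd 1 ?g a"
      using fe a unfolding frame_eqs_def dg[OF a] sigma_mult_qspin by simp
    show "dd 1 ?g a = eta \<epsilon> (\<psi> a) * ?g a"
      using fe a unfolding frame_eqs_def dg[OF a] eta_mult_qspin[OF \<epsilon>] \<psi>[rule_format, OF a] by simp
  qed
qed

lemma (in spinor_frame) frame_forms:
  assumes "frame_eqs U \<theta>1 \<theta>2 \<epsilon> x x' y y'" and a: "a \<in> U"
  shows "L.om h a = 0" "R.om h a = 0"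
    "L.cf h a = \<epsilon> * exp (- (\<theta>1 a + \<theta>2 a)) * (sre h + sim h)" "L.bf h a = - (exp (\<theta>1 a + \<theta>2 a) * (sre h + sim h))"
    "R.cf h a = exp (\<theta>1 a - \<theta>2 a) * (sre h - sim h)" "R.bf h a = - (\<epsilon> * exp (- (\<theta>1 a - \<theta>2 a)) * (sre h - sim h))"
  using assms L.unimodular[OF a] R.unimodular[OF a]
  unfolding L.om_def R.om_def L.cf_def L.bf_def R.cf_def R.bf_def frame_eqs_def by simp_all

lemma xi_form_eq:
  assumes "g a \<in> Spin22"
  shows "xi_form g w1 w2 a h = r22 ((sqrt 2 * w2 a h) *\<^sub>R tens (spx (g a)) (spy' (g a))
     + (sqrt 2 * w1 a h) *\<^sub>R tens (spx' (g a)) (spy (g a)))"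
proof -
  have "(w2 a h - w1 a h) / sqrt 2 + (w2 a h + w1 a h) / sqrt 2 = sqrt 2 * w2 a h"
    "(w2 a h + w1 a h) / sqrt 2 - (w2 a h - w1 a h) / sqrt 2 = sqrt 2 * w1 a h"
    by (simp_all add: field_simps)
  then show ?thesis
    unfolding xi_form_def sandwich_eq[OF assms] by simp
qed

text \<open>The map \<open>r22\<close> is a linear embedding, so it can be removed from the definition of a primitive.\<close>

lemma primitive_of_iff:
  assumes "\<forall>a\<in>U. \<forall>h. \<xi> a h = r22 (\<Xi> a h)"
  shows "primitive_of U \<xi> F \<longleftrightarrow> (\<forall>a\<in>U. (F has_derivative \<Xi> a) (at a))"
proof -
  have "((r22 \<circ> F) has_derivative \<xi> a) (at a) \<longleftrightarrow> (F has_derivative \<Xi> a) (at a)" if a: "a \<in> U" for a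
  proof
    assume "((r22 \<circ> F) has_derivative \<xi> a) (at a)"
    from bounded_linear.has_derivative[OF bounded_linear_r22_inv this]
    show "(F has_derivative \<Xi> a) (at a)" by (simp add: assms[rule_format, OF a])
  next
    assume "(F has_derivative \<Xi> a) (at a)"
    moreover have "\<xi> a = (\<lambda>h. r22 (\<Xi> a h))" using a assms by auto
    ultimately show "((r22 \<circ> F) has_derivative \<xi> a) (at a)"
      using bounded_linear.has_derivative[OF bounded_linear_r22, of F "\<Xi> a"] by (simp add: o_def)
  qed
  then show ?thesis by (simp add: primitive_of_def)
qed

text \<open>The formulas are obtained by inverting a \<open>2 \<times> 2\<close> matrix: every \<open>h\<close> has the components \<open>W1 h\<close>, \<open>W2 h\<close> on the
  basis \<open>N1, N2\<close>.\<close>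

lemma dual_forms_iff:
  assumes \<epsilon>: "\<epsilon> = 1 \<or> \<epsilon> = -1" and nz: "\<And>a. a \<in> U \<Longrightarrow> lam a * mu a \<noteq> 0"
  shows "dual_forms U (N1_field \<epsilon> \<theta>1 lam mu) (N2_field \<theta>1 lam mu) w1 w2 \<longleftrightarrow>
    (\<forall>a\<in>U. \<forall>h. w1 a h = \<epsilon> * exp (- \<theta>1 a) / sqrt 2 * (lam a * sre h + mu a * sim h)
       \<and> w2 a h = exp (\<theta>1 a) / sqrt 2 * (lam a * sre h - mu a * sim h))"
proof -
  define W1 where "W1 a h = \<epsilon> * exp (- \<theta>1 a) / sqrt 2 * (lam a * sre h + mu a * sim h)" for a h
  define W2 where "W2 a h = exp (\<theta>1 a) / sqrt 2 * (lam a * sre h - mu a * sim h)" for a h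
  let ?N1 = "N1_field \<epsilon> \<theta>1 lam mu" and ?N2 = "N2_field \<theta>1 lam mu"
  have ee: "\<epsilon> * \<epsilon> = 1" "\<epsilon> * (\<epsilon> * z) = z" for z using \<epsilon> by auto
  have x: "exp (- \<theta>1 a) = 1 / exp (\<theta>1 a)" for a by (simp add: exp_minus field_simps)
  have dual: "W1 a (?N1 a) = 1" "W1 a (?N2 a) = 0" "W2 a (?N1 a) = 0" "W2 a (?N2 a) = 1" if "a \<in> U" for a
    using nz[OF that] by (auto simp: W1_def W2_def N1_field_def N2_field_def x field_simps ee)
  have expand: "h = W1 a h *\<^sub>R ?N1 a + W2 a h *\<^sub>R ?N2 a" if "a \<in> U" for a h
    using nz[OF that] by (auto simp: W1_def W2_def N1_field_def N2_field_def x splitc_eq_iff field_simps ee)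
  have lin: "linear (W1 a)" "linear (W2 a)" for a
    by (simp_all add: linear_iff W1_def W2_def algebra_simps add_divide_distrib diff_divide_distrib)
  have key: "f h = f (?N1 a) * W1 a h + f (?N2 a) * W2 a h" if "a \<in> U" "linear f" for a h and f :: "A \<Rightarrow> real"
    by (subst expand[OF that(1), of h]) (simp add: linear_add[OF that(2)] linear_scale[OF that(2)] mult.commute)
  have "dual_forms U ?N1 ?N2 w1 w2 \<longleftrightarrow> (\<forall>a\<in>U. \<forall>h. w1 a h = W1 a h \<and> w2 a h = W2 a h)"
  proof
    assume d: "dual_forms U ?N1 ?N2 w1 w2"
    show "\<forall>a\<in>U. \<forall>h. w1 a h = W1 a h \<and> w2 a h = W2 a h"
    proof (intro ballI allI conjI)
      fix a h assume a: "a \<in> U"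
      show "w1 a h = W1 a h" "w2 a h = W2 a h"
        using key[OF a, of "w1 a" h] key[OF a, of "w2 a" h] d a by (simp_all add: dual_forms_def)
    qed
  next
    assume "\<forall>a\<in>U. \<forall>h. w1 a h = W1 a h \<and> w2 a h = W2 a h"
    then have "w1 a = W1 a" "w2 a = W2 a" if "a \<in> U" for a using that by auto
    then show "dual_forms U ?N1 ?N2 w1 w2"
      unfolding dual_forms_def by (simp add: dual lin)
  qed
  then show ?thesis by (simp add: W1_def W2_def)
qed

section \<open>The immersion defined by a solution\<close>

lemma closed_vector_form_exact:
  fixes P Q :: "A \<Rightarrow> 'b::euclidean_space"
  assumes U: "open U" "simply_connected U" and P: "smooth_on U P" and Q: "smooth_on U Q"
    and closed: "\<And>a. a \<in> U \<Longrightarrow> dd \<sigma> P a = dd 1 Q a"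
  obtains F where "\<And>a. a \<in> U \<Longrightarrow> (F has_derivative (\<lambda>h. sre h *\<^sub>R P a + sim h *\<^sub>R Q a)) (at a)"
proof -
  have "\<exists>f. \<forall>a\<in>U. (f has_derivative (\<lambda>h. sre h * (P a \<bullet> b) + sim h * (Q a \<bullet> b))) (at a)" for b
  proof -
    note L = bounded_linear_inner_left[of b]
    show ?thesis
    proof (rule closed_form_exact[OF U smooth_on_bounded_linear[OF U(1) L P] smooth_on_bounded_linear[OF U(1) L Q]])
      fix a assume a: "a \<in> U"
      show "dd \<sigma> (\<lambda>x. P x \<bullet> b) a = dd 1 (\<lambda>x. Q x \<bullet> b) a"
        using closed[OF a] a by (simp add: dd_bounded_linear[OF L] smooth_on_differentiable[OF P] smooth_on_differentiable[OF Q])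
    qed blast
  qed
  then obtain f where f: "\<And>b a. a \<in> U \<Longrightarrow> (f b has_derivative (\<lambda>h. sre h * (P a \<bullet> b) + sim h * (Q a \<bullet> b))) (at a)"
    by metis
  show ?thesis
  proof (rule that[of "\<lambda>a. \<Sum>b\<in>Basis. f b a *\<^sub>R b"])
    fix a assume a: "a \<in> U"
    have "((\<lambda>a. \<Sum>b\<in>Basis. f b a *\<^sub>R b) has_derivative
        (\<lambda>h. \<Sum>b\<in>Basis. (sre h * (P a \<bullet> b) + sim h * (Q a \<bullet> b)) *\<^sub>R b)) (at a)"
      by (intro has_derivative_sum has_derivative_scaleR_left f a)
    moreover have "(\<Sum>b\<in>Basis. (sre h * (P a \<bullet> b) + sim h * (Q a \<bullet> b)) *\<^sub>R b) = sre h *\<^sub>R P a + sim h *\<^sub>R Q a" for h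
      by (subst (3) euclidean_representation[symmetric], subst (4) euclidean_representation[symmetric])
        (simp add: scaleR_sum_right sum.distrib scaleR_add_left)
    ultimately show "((\<lambda>a. \<Sum>b\<in>Basis. f b a *\<^sub>R b) has_derivative (\<lambda>h. sre h *\<^sub>R P a + sim h *\<^sub>R Q a)) (at a)"
      by simp
  qed
qed

text \<open>The forms \<open>\<surd>2 w\<^sub>2\<close> and \<open>\<surd>2 w\<^sub>1\<close>; they are the coefficients \<open>al\<close>, \<open>be\<close> of the immersion on its frame.\<close>

definition al_form :: "(A \<Rightarrow> real) \<Rightarrow> (A \<Rightarrow> real) \<Rightarrow> (A \<Rightarrow> real) \<Rightarrow> A \<Rightarrow> A \<Rightarrow> real" where
  "al_form \<theta>1 lam mu h a = exp (\<theta>1 a) * (lam a * sre h - mu a * sim h)"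

definition be_form :: "real \<Rightarrow> (A \<Rightarrow> real) \<Rightarrow> (A \<Rightarrow> real) \<Rightarrow> (A \<Rightarrow> real) \<Rightarrow> A \<Rightarrow> A \<Rightarrow> real" where
  "be_form \<epsilon> \<theta>1 lam mu h a = \<epsilon> * exp (- \<theta>1 a) * (lam a * sre h + mu a * sim h)"

lemma dd_al_be_form:
  assumes "\<theta>1 differentiable (at a)" "lam differentiable (at a)" "mu differentiable (at a)"
  shows "dd j (al_form \<theta>1 lam mu h) a = exp (\<theta>1 a) *
      ((dd j lam a + dd j \<theta>1 a * lam a) * sre h - (dd j mu a + dd j \<theta>1 a * mu a) * sim h)"
    "dd j (be_form \<epsilon> \<theta>1 lam mu h) a = \<epsilon> * exp (- \<theta>1 a) *
      ((dd j lam a - dd j \<theta>1 a * lam a) * sre h + (dd j mu a - dd j \<theta>1 a * mu a) * sim h)"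
proof -
  note D = assms[unfolded frechet_derivative_works]
  show "dd j (al_form \<theta>1 lam mu h) a = exp (\<theta>1 a) *
      ((dd j lam a + dd j \<theta>1 a * lam a) * sre h - (dd j mu a + dd j \<theta>1 a * mu a) * sim h)"
    unfolding al_form_def[abs_def]
    by (rule dd_eqI) (auto intro!: derivative_eq_intros D simp: fun_eq_iff algebra_simps)
  show "dd j (be_form \<epsilon> \<theta>1 lam mu h) a = \<epsilon> * exp (- \<theta>1 a) *
      ((dd j lam a - dd j \<theta>1 a * lam a) * sre h + (dd j mu a - dd j \<theta>1 a * mu a) * sim h)"
    unfolding be_form_def[abs_def]
    by (rule dd_eqI) (auto intro!: derivative_eq_intros D simp: fun_eq_iff algebra_simps)
qed

lemma representation_data_iff:
  "representation_data U \<psi> \<theta>1 \<theta>2 lam mu \<epsilon> g w1 w2 \<longleftrightarrow>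
     open U \<and> simply_connected U \<and> conformal_A U \<psi> \<and> (\<forall>a\<in>U. \<psi> a = SC (\<theta>1 a) (\<theta>2 a))
     \<and> smooth_on U lam \<and> smooth_on U mu
     \<and> (\<forall>a\<in>U. dd 1 mu a = - lam a * dd 1 \<theta>2 a \<and> dd \<sigma> lam a = - mu a * dd \<sigma> \<theta>2 a)
     \<and> (\<forall>a\<in>U. lam a * mu a \<noteq> 0) \<and> (\<epsilon> = 1 \<or> \<epsilon> = -1) \<and> spin_eq U \<psi> \<epsilon> g
     \<and> (\<forall>a\<in>U. \<forall>h. w1 a h = be_form \<epsilon> \<theta>1 lam mu h a / sqrt 2 \<and> w2 a h = al_form \<theta>1 lam mu h a / sqrt 2)"
proof -
  have "dual_forms U (N1_field \<epsilon> \<theta>1 lam mu) (N2_field \<theta>1 lam mu) w1 w2 \<longleftrightarrow>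
    (\<forall>a\<in>U. \<forall>h. w1 a h = be_form \<epsilon> \<theta>1 lam mu h a / sqrt 2 \<and> w2 a h = al_form \<theta>1 lam mu h a / sqrt 2)"
    if "\<epsilon> = 1 \<or> \<epsilon> = -1" "\<forall>a\<in>U. lam a * mu a \<noteq> 0"
    using dual_forms_iff[of \<epsilon> U lam mu \<theta>1 w1 w2] that by (auto simp: al_form_def be_form_def)
  then show ?thesis
    unfolding representation_data_def spin_eq_def eta_def d_u_def d_v_def by auto
qed

text \<open>The Cauchy-Riemann equations of the split-complex plane.\<close>

lemma conformal_A_coefficients:
  assumes U: "open U" and \<psi>: "conformal_A U \<psi>" "\<forall>a\<in>U. \<psi> a = SC (\<theta>1 a) (\<theta>2 a)"
  shows "smooth_on U \<theta>1" "smooth_on U \<theta>2"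
    "\<And>a. a \<in> U \<Longrightarrow> dd \<sigma> \<theta>1 a = dd 1 \<theta>2 a" "\<And>a. a \<in> U \<Longrightarrow> dd \<sigma> \<theta>2 a = dd 1 \<theta>1 a"
proof -
  have s: "smooth_on U \<psi>" and c: "\<And>a. a \<in> U \<Longrightarrow> dd \<sigma> \<psi> a = \<sigma> * dd 1 \<psi> a"
    using \<psi>(1) by (auto simp: conformal_A_def d_u_def d_v_def)
  show "smooth_on U \<theta>1" "smooth_on U \<theta>2"
    by (rule smooth_on_cong[OF U _ smooth_on_sre[OF U s]], simp add: \<psi>(2))
      (rule smooth_on_cong[OF U _ smooth_on_sim[OF U s]], simp add: \<psi>(2))
  have d: "dd h \<theta>1 a = sre (dd h \<psi> a)" "dd h \<theta>2 a = sim (dd h \<psi> a)" if "a \<in> U" for h a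
    using dd_cong[OF U that, of "\<lambda>a. sre (\<psi> a)" \<theta>1] dd_cong[OF U that, of "\<lambda>a. sim (\<psi> a)" \<theta>2]
      dd_bounded_linear[OF bounded_linear_sre smooth_on_differentiable[OF s that]]
      dd_bounded_linear[OF bounded_linear_sim smooth_on_differentiable[OF s that]] by (simp_all add: \<psi>(2))
  show "dd \<sigma> \<theta>1 a = dd 1 \<theta>2 a" "dd \<sigma> \<theta>2 a = dd 1 \<theta>1 a" if "a \<in> U" for a
    using d[OF that] c[OF that] by simp_all
qed

text \<open>The tangent part of the closedness of \<open>\<xi>\<close> is the closedness of \<open>w\<^sub>1\<close> and \<open>w\<^sub>2\<close>, which is equivalent to
  the equations on \<open>\<lambda>, \<mu>\<close>; the normal part holds for every choice of \<open>\<lambda>, \<mu>\<close>. Since the forms \<open>cf, bf\<close> of each pair are multiples of one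
  form, both curvatures vanish.\<close>

theorem representation_immersion:
  assumes "representation_data U \<psi> \<theta>1 \<theta>2 lam mu \<epsilon> g w1 w2"
  shows "\<exists>F. primitive_of U (xi_form g w1 w2) F"
    and "primitive_of U (xi_form g w1 w2) F \<Longrightarrow> lorentzian_immersion U F
      \<and> (\<forall>a\<in>U. gauss_curvature F a = 0 \<and> normal_curvature F a = 0 \<and> Delta F a > 0)"
proof -
  have U: "open U" "simply_connected U" and \<psi>: "conformal_A U \<psi>" "\<forall>a\<in>U. \<psi> a = SC (\<theta>1 a) (\<theta>2 a)"
    and lm: "smooth_on U lam" "smooth_on U mu" "\<And>a. a \<in> U \<Longrightarrow> lam a * mu a \<noteq> 0"
      "\<And>a. a \<in> U \<Longrightarrow> dd 1 mu a = - lam a * dd 1 \<theta>2 a" "\<And>a. a \<in> U \<Longrightarrow> dd \<sigma> lam a = - mu a * dd \<sigma> \<theta>2 a"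
    and \<epsilon>: "\<epsilon> = 1 \<or> \<epsilon> = -1" and g: "spin_eq U \<psi> \<epsilon> g"
    and w: "\<And>a h. a \<in> U \<Longrightarrow> w1 a h = be_form \<epsilon> \<theta>1 lam mu h a / sqrt 2"
      "\<And>a h. a \<in> U \<Longrightarrow> w2 a h = al_form \<theta>1 lam mu h a / sqrt 2"
    using assms unfolding representation_data_iff by auto
  note \<theta> = conformal_A_coefficients[OF U(1) \<psi>]
  define x where "x a = spx (g a)" for a
  define x' where "x' a = spx' (g a)" for a
  define y where "y a = spy (g a)" for a
  define y' where "y' a = spy' (g a)" for a
  note spin = spinors_of_spin[OF U(1) \<epsilon> g \<psi>(2), folded x_def x'_def y_def y'_def]
  interpret G: spinor_frame U x x' y y' using spin(1,2) by (simp add: spinor_frame_def)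
  note forms = G.frame_forms[OF spin(3)]
  \<comment> \<open>\<open>\<Xi>\<close> is the vector-valued form that corresponds to \<open>\<xi>\<close> under \<open>r22\<close>.\<close>
  let ?al = "al_form \<theta>1 lam mu" and ?be = "be_form \<epsilon> \<theta>1 lam mu"
  define \<Xi> where "\<Xi> a h = ?al h a *\<^sub>R G.T1 a + ?be h a *\<^sub>R G.T2 a" for a h
  have sal: "smooth_on U (?al h)" for h
    unfolding al_form_def[abs_def] by (intro smooth_intros U lm \<theta>(1,2))
  have sbe: "smooth_on U (?be h)" for h
    unfolding be_form_def[abs_def]
    by (intro smooth_on_mult smooth_on_add smooth_on_exp smooth_on_minus smooth_on_const U lm(1,2) \<theta>(1,2))
  have s\<Xi>: "smooth_on U (\<lambda>a. \<Xi> a h)" for h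
    unfolding \<Xi>_def by (intro smooth_intros U sal sbe)
  have lin: "\<Xi> a h = sre h *\<^sub>R \<Xi> a 1 + sim h *\<^sub>R \<Xi> a \<sigma>" for a h
    by (simp add: \<Xi>_def al_form_def be_form_def algebra_simps)
  have "\<forall>a\<in>U. \<forall>h. xi_form g w1 w2 a h = r22 (\<Xi> a h)"
    using xi_form_eq[of g _ w1 w2] g by (auto simp: spin_eq_def w \<Xi>_def G.T1_def G.T2_def x_def x'_def y_def y'_def)
  note prim = primitive_of_iff[OF this]
  have closed: "dd \<sigma> (\<lambda>a. \<Xi> a 1) a = dd 1 (\<lambda>a. \<Xi> a \<sigma>) a" if a: "a \<in> U" for a
  proof -
    note e = dd_al_be_form[OF smooth_on_differentiable[OF \<theta>(1) a] smooth_on_differentiable[OF lm(1) a]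
        smooth_on_differentiable[OF lm(2) a]]
    have "dd \<sigma> (?al 1) a = dd 1 (?al \<sigma>) a" "dd \<sigma> (?be 1) a = dd 1 (?be \<sigma>) a"
      unfolding e lm(4,5)[OF a] \<theta>(3,4)[OF a] by (simp_all add: algebra_simps)
    moreover have "?al 1 a * G.R.bf \<sigma> a + ?be 1 a * G.L.bf \<sigma> a = ?al \<sigma> a * G.R.bf 1 a + ?be \<sigma> a * G.L.bf 1 a"
      "?al 1 a * G.L.cf \<sigma> a + ?be 1 a * G.R.cf \<sigma> a = ?al \<sigma> a * G.L.cf 1 a + ?be \<sigma> a * G.R.cf 1 a"
      unfolding forms[OF a] by (simp_all add: al_form_def be_form_def exp_add exp_minus exp_diff field_simps)
    ultimately show ?thesis
      unfolding \<Xi>_def G.dd_combination[OF sal sbe a] by (simp add: forms[OF a])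
  qed
  show "\<exists>F. primitive_of U (xi_form g w1 w2) F"
  proof -
    obtain F where F: "(F has_derivative (\<lambda>h. sre h *\<^sub>R \<Xi> a 1 + sim h *\<^sub>R \<Xi> a \<sigma>)) (at a)" if "a \<in> U" for a
      using closed_vector_form_exact[OF U s\<Xi> s\<Xi> closed] by blast
    have "(\<lambda>h. sre h *\<^sub>R \<Xi> a 1 + sim h *\<^sub>R \<Xi> a \<sigma>) = \<Xi> a" for a
      by (rule ext) (rule lin[symmetric])
    then show ?thesis unfolding prim using F by auto
  qed
  assume "primitive_of U (xi_form g w1 w2) F"
  then have F: "\<And>a. a \<in> U \<Longrightarrow> (F has_derivative \<Xi> a) (at a)" unfolding prim by blast
  have tang: "tang F a h = \<Xi> a h" if "a \<in> U" for a h
    unfolding tang_def by (rule dd_eqI[OF F[OF that]])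
  interpret S: spin_frame U x x' y y' F
  proof
    show "smooth_on U F" by (rule smooth_onI[OF U(1) F s\<Xi>])
    show "ip22 (tang F a h) (tens (x a) (y a)) = 0" "ip22 (tang F a h) (tens (x' a) (y' a)) = 0" if "a \<in> U" for a h
      by (simp_all add: tang[OF that] \<Xi>_def G.T1_def G.T2_def ip22_tens)
  qed
  have al: "S.al h a = ?al h a" and be: "S.be h a = ?be h a" if "a \<in> U" for a h
    using that by (simp_all add: S.al_def S.be_def tang \<Xi>_def)
  interpret S: immersed_spin_frame U x x' y y' F
  proof
    fix a assume a: "a \<in> U"
    have "S.al 1 a * S.be \<sigma> a - S.al \<sigma> a * S.be 1 a = 2 * \<epsilon> * (lam a * mu a)"
      unfolding al[OF a] be[OF a] al_form_def be_form_def by (simp add: exp_minus field_simps)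
    then show "S.al 1 a * S.be \<sigma> a - S.al \<sigma> a * S.be 1 a \<noteq> 0"
      using lm(3)[OF a] \<epsilon> by auto
  qed
  have "gauss_curvature F a = 0 \<and> normal_curvature F a = 0 \<and> Delta F a > 0" if a: "a \<in> U" for a
  proof -
    have flat: "G.L.cf 1 a * G.L.bf \<sigma> a = G.L.cf \<sigma> a * G.L.bf 1 a" "G.R.cf 1 a * G.R.bf \<sigma> a = G.R.cf \<sigma> a * G.R.bf 1 a"
      by (simp_all add: forms[OF a])
    have "(G.L.bf 1 a * G.R.bf \<sigma> a - G.L.bf \<sigma> a * G.R.bf 1 a) * (G.L.cf 1 a * G.R.cf \<sigma> a - G.L.cf \<sigma> a * G.R.cf 1 a)
      = (2 * \<epsilon>)\<^sup>2 * (exp (\<theta>1 a + \<theta>2 a) * exp (- (\<theta>1 a + \<theta>2 a))) * (exp (\<theta>1 a - \<theta>2 a) * exp (- (\<theta>1 a - \<theta>2 a)))"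
      unfolding forms[OF a] by (simp add: power2_eq_square algebra_simps del: exp_add)
    also have "\<dots> > 0"
      using \<epsilon> by auto
    finally show ?thesis
      using S.gauss_curvature_zero_iff[OF a] S.normal_curvature_zero_iff[OF a] S.Delta_pos_iff[OF a flat] flat by simp
  qed
  then show "lorentzian_immersion U F
      \<and> (\<forall>a\<in>U. gauss_curvature F a = 0 \<and> normal_curvature F a = 0 \<and> Delta F a > 0)"
    using S.lorentzian by blast
qed

section \<open>Smooth inverse functions of the plane\<close>

lemma open_nonzero_set:
  assumes "open U" "smooth_on U f" shows "open {a \<in> U. f a \<noteq> (0::real)}"
  using continuous_open_preimage[OF smooth_on_continuous[OF assms(2)] assms(1), of "- {0}"]
  by (simp add: vimage_def Int_def open_Compl)

lemma open_positive_set: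
  assumes "open U" "smooth_on U f" shows "open {a \<in> U. f a > (0::real)}"
  using continuous_open_preimage[OF smooth_on_continuous[OF assms(2)] assms(1), of "{0<..}"]
  by (simp add: vimage_def Int_def)

lemma cramer_2:
  fixes p1 :: real
  assumes "p1 * r2 - p2 * r1 \<noteq> 0"
  shows "x * p1 + y * r1 = k1 \<and> x * p2 + y * r2 = k2 \<longleftrightarrow>
    x = (k1 * r2 - k2 * r1) / (p1 * r2 - p2 * r1) \<and> y = (p1 * k2 - p2 * k1) / (p1 * r2 - p2 * r1)"
proof -
  let ?d = "p1 * r2 - p2 * r1"
  have "x * p1 + y * r1 = k1 \<and> x * p2 + y * r2 = k2 \<longleftrightarrow> x * ?d = k1 * r2 - k2 * r1 \<and> y * ?d = p1 * k2 - p2 * k1"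
  proof
    assume "x * p1 + y * r1 = k1 \<and> x * p2 + y * r2 = k2"
    then have e: "k1 = x * p1 + y * r1" "k2 = x * p2 + y * r2" by auto
    show "x * ?d = k1 * r2 - k2 * r1 \<and> y * ?d = p1 * k2 - p2 * k1"
      unfolding e by (simp add: algebra_simps)
  next
    assume *: "x * ?d = k1 * r2 - k2 * r1 \<and> y * ?d = p1 * k2 - p2 * k1"
    have "?d * (x * p1 + y * r1 - k1) = 0" "?d * (x * p2 + y * r2 - k2) = 0"
      using * by algebra+
    then show "x * p1 + y * r1 = k1 \<and> x * p2 + y * r2 = k2" using assms by simp
  qed
  then show ?thesis using assms by (simp add: nonzero_eq_divide_eq)
qed

text \<open>The inverse function theorem gives a differentiable inverse. Its derivative is given by Cramer's rule as a smooth function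
  \<open>G\<close> of the inverse itself, so that each degree of differentiability implies the next one. The image is
  shrunk to a ball, which is simply connected.\<close>

lemma smooth_inverse_function:
  fixes \<phi> :: "A \<Rightarrow> A"
  assumes U: "open U" "a0 \<in> U" and s: "smooth_on U \<phi>"
    and inj: "\<And>h. dd h \<phi> a0 = 0 \<Longrightarrow> h = 0"
  obtains B W \<phi>i where "open B" "a0 \<in> B" "B \<subseteq> U" "open W" "simply_connected W"
    "homeomorphism B W \<phi> \<phi>i" "smooth_on W \<phi>i"
    "\<And>w h. w \<in> W \<Longrightarrow> dd (dd h \<phi>i w) \<phi> (\<phi>i w) = h"
proof -
  define \<Delta> where "\<Delta> a = sre (dd 1 \<phi> a) * sim (dd \<sigma> \<phi> a) - sim (dd 1 \<phi> a) * sre (dd \<sigma> \<phi> a)" for a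
  have s\<Delta>: "smooth_on U \<Delta>"
    unfolding \<Delta>_def[abs_def] by (intro smooth_intros U smooth_on_dd s)
  define U0 where "U0 = {a \<in> U. \<Delta> a \<noteq> 0}"
  have U0: "open U0" "U0 \<subseteq> U"
    unfolding U0_def using open_nonzero_set[OF U(1) s\<Delta>] by auto
  have ex: "dd h \<phi> a = sre h *\<^sub>R dd 1 \<phi> a + sim h *\<^sub>R dd \<sigma> \<phi> a" if "a \<in> U" for h a
    by (rule dd_expand[OF smooth_on_differentiable[OF s that]])
  have "\<Delta> a0 \<noteq> 0"
  proof
    assume 0: "\<Delta> a0 = 0"
    have "dd (SC (sim (dd \<sigma> \<phi> a0)) (- sim (dd 1 \<phi> a0))) \<phi> a0 = 0"
      "dd (SC (sre (dd \<sigma> \<phi> a0)) (- sre (dd 1 \<phi> a0))) \<phi> a0 = 0"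
      using 0 by (simp_all add: ex[OF U(2), of "SC _ _"] splitc_eq_iff \<Delta>_def algebra_simps)
    from inj[OF this(1)] inj[OF this(2)] have "dd 1 \<phi> a0 = 0"
      by (simp add: splitc_eq_iff)
    from inj[OF this] show False by (simp add: splitc_eq_iff)
  qed
  then have "a0 \<in> U0" using U by (simp add: U0_def)
  define G where "G h a = SC ((sre h * sim (dd \<sigma> \<phi> a) - sim h * sre (dd \<sigma> \<phi> a)) / \<Delta> a)
      ((sre (dd 1 \<phi> a) * sim h - sim (dd 1 \<phi> a) * sre h) / \<Delta> a)" for h a
  have sG: "smooth_on U0 (G h)" for h
    unfolding G_def
    by (intro smooth_intros U0 smooth_on_subset[OF s\<Delta>] smooth_on_dd smooth_on_subset[OF s]) (auto simp: U0_def)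
  have G: "dd h \<phi> a = k \<longleftrightarrow> h = G k a" if "a \<in> U0" for h k a
  proof -
    have "a \<in> U" "\<Delta> a \<noteq> 0" using that by (auto simp: U0_def)
    then show ?thesis
      using cramer_2[of "sre (dd 1 \<phi> a)" "sim (dd \<sigma> \<phi> a)" "sim (dd 1 \<phi> a)" "sre (dd \<sigma> \<phi> a)"]
      unfolding ex[OF \<open>a \<in> U\<close>, of h] G_def \<Delta>_def by (simp add: splitc_eq_iff)
  qed
  define f where "f z = toC (\<phi> (ofC z))" for z
  define f' where "f' z = (blinfun_scaleR_left (toC (dd 1 \<phi> (ofC z))) o\<^sub>L Blinfun Re)
      + (blinfun_scaleR_left (toC (dd \<sigma> \<phi> (ofC z))) o\<^sub>L Blinfun Im)" for z
  have f'_apply: "f' z h = toC (dd (ofC h) \<phi> (ofC z))" if "ofC z \<in> U" for z h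
    unfolding ex[OF that, of "ofC h"]
    by (simp add: f'_def blinfun.add_left bounded_linear_Blinfun_apply bounded_linear_Re bounded_linear_Im
        linear_add[OF bounded_linear.linear[OF bounded_linear_toC]] linear_scale[OF bounded_linear.linear[OF bounded_linear_toC]])
  have cont_dd: "continuous_on (toC ` U0) (\<lambda>z. toC (dd h \<phi> (ofC z)))" for h
    by (rule continuous_on_compose2[OF bounded_linear.continuous_on[OF bounded_linear_toC continuous_on_subset[OF smooth_on_continuous[OF smooth_on_dd[OF s]] U0(2)]]])
      (auto intro: linear_continuous_on bounded_linear_ofC)
  define g0 where "g0 = Blinfun (\<lambda>h. toC (G (ofC h) a0))"
  have "bounded_linear (\<lambda>h. toC (G (ofC h) a0))"
    unfolding linear_conv_bounded_linear[symmetric] linear_iff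
    by (simp add: G_def complex_eq_iff add_divide_distrib diff_divide_distrib algebra_simps)
  then have g0: "g0 h = toC (G (ofC h) a0)" for h
    by (simp add: g0_def bounded_linear_Blinfun_apply)
  have g0f: "g0 o\<^sub>L f' (toC a0) = id_blinfun"
  proof (rule blinfun_eqI)
    fix h
    have "G (dd (ofC h) \<phi> a0) a0 = ofC h"
      using G[OF \<open>a0 \<in> U0\<close>, of "ofC h" "dd (ofC h) \<phi> a0"] by simp
    then show "(g0 o\<^sub>L f' (toC a0)) h = id_blinfun h"
      using f'_apply[of "toC a0" h] U by (simp add: g0)
  qed
  have df: "(f has_derivative f' z) (at z)" if "z \<in> toC ` U0" for z
  proof -
    have z: "ofC z \<in> U" using that U0 by auto
    have "((\<lambda>z. toC (\<phi> (ofC z))) has_derivative (\<lambda>h. toC (dd (ofC h) \<phi> (ofC z)))) (at z)"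
      by (rule bounded_linear.has_derivative[OF bounded_linear_toC
          has_derivative_compose[OF bounded_linear_imp_has_derivative[OF bounded_linear_ofC] smooth_on_deriv[OF s z]]])
    then show ?thesis unfolding f_def by (rule has_derivative_eq_rhs) (rule ext, simp add: f'_apply[OF z])
  qed
  have cf: "continuous_on (toC ` U0) f'"
    unfolding f'_def
    by (intro continuous_intros bounded_linear.continuous_on[OF bounded_linear_blinfun_scaleR_left] cont_dd)
  obtain U' V g g' where V: "open U'" "U' \<subseteq> toC ` U0" "toC a0 \<in> U'" "open V" "f (toC a0) \<in> V"
    "homeomorphism U' V f g" "\<And>y. y \<in> V \<Longrightarrow> (g has_derivative (g' y)) (at y)"
    using inverse_function_theorem[OF open_toC_image[OF U0(1)] df cf _ g0f] \<open>a0 \<in> U0\<close> by (metis image_eqI)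
  define V0 where "V0 = ofC ` V"
  have V0: "V0 = toC -` V" unfolding V0_def by (auto simp: image_iff) (metis ofC_toC)
  have "open V0"
    unfolding V0 by (rule open_vimage[OF V(4) linear_continuous_on[OF bounded_linear_toC]])
  moreover have "\<phi> a0 \<in> V0"
    using V(5) by (simp add: V0 f_def)
  ultimately obtain r where r: "r > 0" "ball (\<phi> a0) r \<subseteq> V0" by (meson openE)
  define W where "W = ball (\<phi> a0) r"
  define \<phi>i where "\<phi>i w = ofC (g (toC w))" for w
  have gV: "g y \<in> U'" "f (g y) = y" if "y \<in> V" for y
    using V(6) that by (auto simp: homeomorphism_def)
  have WV: "toC w \<in> V" if "w \<in> W" for w using that r by (auto simp: W_def V0)
  have \<phi>i: "\<phi>i w \<in> U0" "\<phi> (\<phi>i w) = w" if "w \<in> W" for w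
  proof -
    show "\<phi>i w \<in> U0" using gV(1)[OF WV[OF that]] V(2) by (auto simp: \<phi>i_def)
    have "toC (\<phi> (\<phi>i w)) = toC w" using gV(2)[OF WV[OF that]] by (simp add: f_def \<phi>i_def)
    then show "\<phi> (\<phi>i w) = w" by (metis ofC_toC)
  qed
  define B where "B = {a. toC a \<in> U' \<and> \<phi> a \<in> W}"
  have inj_toC: "toC a \<in> toC ` S \<longleftrightarrow> a \<in> S" for a S
    by (metis image_eqI imageE ofC_toC)
  have BU: "B \<subseteq> U0" using V(2) inj_toC[of _ U0] unfolding B_def by blast
  have "a0 \<in> B" using V(3) r by (simp add: B_def W_def)
  have "open B"
  proof -
    have o: "open (toC -` U')"
      by (rule open_vimage[OF V(1) linear_continuous_on[OF bounded_linear_toC]])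
    have "toC -` U' \<subseteq> U" using V(2) U0 inj_toC[of _ U0] by blast
    then have "open (toC -` U' \<inter> \<phi> -` W)"
      by (intro continuous_open_preimage[OF _ o] continuous_on_subset[OF smooth_on_continuous[OF s]]) (auto simp: W_def)
    then show ?thesis by (simp add: B_def vimage_def Int_def)
  qed
  have \<phi>i_B: "\<phi>i (\<phi> a) = a" if "a \<in> B" for a
  proof -
    have "g (f (toC a)) = toC a" using V(6) that by (auto simp: B_def homeomorphism_def)
    then show ?thesis by (simp add: \<phi>i_def f_def)
  qed
  have \<phi>i_in_B: "\<phi>i w \<in> B" if "w \<in> W" for w
    using \<phi>i[OF that] gV(1)[OF WV[OF that]] that by (simp add: B_def \<phi>i_def)
  have d\<phi>i: "(\<phi>i has_derivative (\<lambda>h. G h (\<phi>i w))) (at w)" if w: "w \<in> W" for w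
  proof -
    have d: "(\<phi>i has_derivative (\<lambda>h. ofC (g' (toC w) (toC h)))) (at w)"
      unfolding \<phi>i_def
      by (rule bounded_linear.has_derivative[OF bounded_linear_ofC
          has_derivative_compose[OF bounded_linear_imp_has_derivative[OF bounded_linear_toC] V(7)[OF WV[OF w]]]])
    have "\<phi>i w \<in> U" using \<phi>i(1)[OF w] U0 by blast
    from has_derivative_compose[OF d smooth_on_deriv[OF s this]]
    have c: "((\<lambda>w. \<phi> (\<phi>i w)) has_derivative (\<lambda>h. dd (ofC (g' (toC w) (toC h))) \<phi> (\<phi>i w))) (at w)" .
    have "((\<lambda>w. \<phi> (\<phi>i w)) has_derivative (\<lambda>h. h)) (at w)"
      by (rule has_derivative_transform_within_open[OF has_derivative_ident, of W]) (use w \<phi>i in \<open>auto simp: W_def\<close>)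
    from has_derivative_unique[OF c this] have "dd (ofC (g' (toC w) (toC h))) \<phi> (\<phi>i w) = h" for h
      by metis
    then have "ofC (g' (toC w) (toC h)) = G h (\<phi>i w)" for h
      using G[OF \<phi>i(1)[OF w]] by blast
    then show ?thesis using d by simp
  qed
  have oW: "open W" by (simp add: W_def)
  have "Ck_on k W \<phi>i" for k
  proof (induction k)
    case 0
    show ?case using d\<phi>i by (auto intro!: continuous_at_imp_continuous_on has_derivative_continuous)
  next
    case (Suc k)
    show ?case
    proof (rule Ck_on_SucI[OF oW d\<phi>i])
      show "Ck_on k W (\<lambda>w. G h (\<phi>i w))" for h
        by (rule Ck_on_compose_A[OF oW U0(1) _ Suc]) (use sG \<phi>i in \<open>auto simp: smooth_on_def\<close>)
    qed
  qed
  then have s\<phi>i: "smooth_on W \<phi>i" by (simp add: smooth_on_def)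
  show ?thesis
  proof (rule that[OF \<open>open B\<close> \<open>a0 \<in> B\<close> _ oW _ _ s\<phi>i])
    show "B \<subseteq> U" using BU U0 by blast
    show "simply_connected W" unfolding W_def by (intro convex_imp_simply_connected convex_ball)
    show "homeomorphism B W \<phi> \<phi>i"
    proof (rule homeomorphismI)
      show "continuous_on B \<phi>" using BU U0 continuous_on_subset[OF smooth_on_continuous[OF s]] by blast
      show "continuous_on W \<phi>i" by (rule smooth_on_continuous[OF s\<phi>i])
    qed (use \<phi>i_B \<phi>i_in_B \<phi>i in \<open>auto simp: B_def\<close>)
    show "dd (dd h \<phi>i w) \<phi> (\<phi>i w) = h" if "w \<in> W" for w h
      using dd_eqI[OF d\<phi>i[OF that], of h] G[OF \<phi>i(1)[OF that]] by simp
  qed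
qed

section \<open>Existence of spinor frames\<close>

text \<open>If \<open>v\<close> is the matrix of a linear map, \<open>cL v w\<close> is its value on \<open>w\<close> and \<open>cR v z\<close> the value of the transpose
  on \<open>z\<close>, after the plane is identified with its dual by the area form.\<close>

definition cL :: "real^4 \<Rightarrow> spinor \<Rightarrow> spinor" where
  "cL v w = (- 2 * ip22 v (tens (0, 1) w), 2 * ip22 v (tens (1, 0) w))"

definition cR :: "real^4 \<Rightarrow> spinor \<Rightarrow> spinor" where
  "cR v z = (- 2 * ip22 v (tens z (0, 1)), 2 * ip22 v (tens z (1, 0)))"

text \<open>A null vector is a matrix of determinant zero, so it is a column times a row; both can be obtained
  by evaluating the matrix on fixed spinors, and they depend smoothly on it.\<close>

lemma null_factor:
  assumes "ip22 v v = 0"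
  shows "(- 2 * ip22 v (tens z w)) *\<^sub>R v = tens (cL v w) (cR v z)"
proof -
  have "- (v$0 * v$0) + v$1 * v$1 - v$2 * v$2 + v$3 * v$3 = 0"
    using assms by (simp add: ip22_def)
  then show ?thesis
    unfolding vec4_eq_iff
    by (simp add: cL_def cR_def ip22_def) algebra
qed

lemma tens_spans:
  assumes "v \<noteq> 0" obtains z w where "ip22 v (tens z w) \<noteq> 0"
proof -
  have "\<exists>z w. ip22 v (tens z w) \<noteq> 0"
  proof (rule ccontr)
    assume "\<not> ?thesis"
    then have n: "ip22 v (tens z w) = 0" for z w by blast
    have "v = 0"
      using n[of "(1,0)" "(1,0)"] n[of "(0,1)" "(0,1)"] n[of "(1,0)" "(0,1)"] n[of "(0,1)" "(1,0)"]
      by (simp add: vec4_eq_iff ip22_def)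
    then show False using assms by simp
  qed
  then show ?thesis using that by blast
qed

text \<open>Two independent null tangent fields \<open>V1, V2\<close> are the roots of a quadratic equation with positive
  discriminant. Each of them is factored as a tensor product, and the four factors are rescaled.\<close>

theorem spin_frame_exists:
  assumes U: "open U" "a0 \<in> U" and X: "lorentzian_immersion U X"
  obtains B x x' y y' where "a0 \<in> B" "B \<subseteq> U" "immersed_spin_frame B x x' y y' X"
proof -
  have sX: "smooth_on U X" using X by (simp add: lorentzian_immersion_def)
  have stang: "smooth_on U (\<lambda>a. tang X a h)" for h
    unfolding tang_def by (rule smooth_on_dd[OF sX])
  have ltang: "linear (tang X a)" if "a \<in> U" for a
    unfolding tang_def by (rule has_derivative_linear[OF smooth_on_deriv[OF sX that]])
  obtain h k where hk: "first_form X a0 h h = -1" "first_form X a0 k k = 1" "first_form X a0 h k = 0"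
    using X U by (auto simp: lorentzian_immersion_def)
  \<comment> \<open>The vectors \<open>p, q\<close> are null at \<open>a0\<close>. Near \<open>a0\<close> the null directions are close to \<open>p\<close> and \<open>q\<close>.\<close>
  define p where "p = h + k"
  define q where "q = h - k"
  define gpp where "gpp a = ip22 (tang X a p) (tang X a p)" for a
  define gqq where "gqq a = ip22 (tang X a q) (tang X a q)" for a
  define gpq where "gpq a = ip22 (tang X a p) (tang X a q)" for a
  have sg: "smooth_on U gpp" "smooth_on U gqq" "smooth_on U gpq"
    unfolding gpp_def gqq_def gpq_def by (intro smooth_intros U stang)+
  have g0: "gpp a0 = 0" "gqq a0 = 0" "gpq a0 = -2"
    using hk unfolding first_form_def gpp_def gqq_def gpq_def p_def q_def
      linear_add[OF ltang[OF U(2)]] linear_diff[OF ltang[OF U(2)]]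
    by (simp_all add: ip22_commute[of "tang X a0 k" "tang X a0 h"])
  define E where "E = sre p * sim q - sim p * sre q"
  have "E \<noteq> 0"
  proof
    assume 0: "E = 0"
    have "gpp a0 * gqq a0 - gpq a0 * gpq a0 = E * E *
       (ip22 (tang X a0 1) (tang X a0 1) * ip22 (tang X a0 \<sigma>) (tang X a0 \<sigma>)
         - ip22 (tang X a0 1) (tang X a0 \<sigma>) * ip22 (tang X a0 1) (tang X a0 \<sigma>))"
      unfolding gpp_def gqq_def gpq_def E_def linear_A_expand[OF ltang[OF U(2)], of p]
        linear_A_expand[OF ltang[OF U(2)], of q]
      by (simp add: ip22_commute[of "tang X a0 \<sigma>" "tang X a0 1"]) (simp add: algebra_simps)
    then show False using g0 0 by simp
  qed
  have pq: "h = ((sre h * sim q - sim h * sre q) / E) *\<^sub>R p + ((sre p * sim h - sim p * sre h) / E) *\<^sub>R q" for h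
    using \<open>E \<noteq> 0\<close> by (simp add: splitc_eq_iff field_simps) (simp add: E_def algebra_simps)
  define D where "D a = gpq a * gpq a - gpp a * gqq a" for a
  have sD: "smooth_on U D" unfolding D_def by (intro smooth_intros U sg)
  define U1 where "U1 = {a \<in> {a \<in> U. D a > 0}. - gpq a > 0}"
  have oD: "open {a \<in> U. D a > 0}" by (rule open_positive_set[OF U(1) sD])
  have U1: "open U1" "U1 \<subseteq> U"
    unfolding U1_def
    by (rule open_positive_set[OF oD]; intro smooth_intros oD smooth_on_subset[OF sg(3)]) auto
  have a1: "a0 \<in> U1" using U(2) g0 by (simp add: U1_def D_def)
  have U1D: "D a > 0" "gpq a < 0" "a \<in> U" if "a \<in> U1" for a using that by (auto simp: U1_def)
  \<comment> \<open>The quadratic formula is used in the form where the denominator does not vanish at \<open>a0\<close>, since \<open>gpq < 0\<close>.\<close>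
  define s where "s a = sqrt (D a) - gpq a" for a
  have ss: "smooth_on U1 s" unfolding s_def
    by (intro smooth_intros U1 smooth_on_subset[OF sD] smooth_on_subset[OF sg(3)] U1D)
  have spos: "s a > 0" if "a \<in> U1" for a
    using U1D(2)[OF that] real_sqrt_gt_zero[OF U1D(1)[OF that]] unfolding s_def by linarith
  have s0: "s a0 = 4" using g0 by (simp add: s_def D_def)
  have sq: "s a * s a + 2 * gpq a * s a = - gpp a * gqq a" if "a \<in> U1" for a
  proof -
    have "(s a + gpq a) * (s a + gpq a) = D a"
      using U1D(1)[OF that] by (simp add: s_def)
    then show ?thesis by (simp add: D_def algebra_simps)
  qed
  define V1 where "V1 a = tang X a p + (gpp a / s a) *\<^sub>R tang X a q" for a
  define V2 where "V2 a = tang X a q + (gqq a / s a) *\<^sub>R tang X a p" for a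
  have sV: "smooth_on U1 V1" "smooth_on U1 V2"
    unfolding V1_def V2_def using spos
    by (intro smooth_intros U1 ss smooth_on_subset[OF sg(1)] smooth_on_subset[OF sg(2)] smooth_on_subset[OF stang]; force)+
  have ipc: "ip22 (tang X a q) (tang X a p) = gpq a" for a by (simp add: gpq_def ip22_commute)
  have null: "ip22 (V1 a) (V1 a) = 0" "ip22 (V2 a) (V2 a) = 0" if "a \<in> U1" for a
  proof -
    have "ip22 (V1 a) (V1 a) * (s a * s a) = gpp a * (s a * s a + 2 * gpq a * s a + gpp a * gqq a)"
      "ip22 (V2 a) (V2 a) * (s a * s a) = gqq a * (s a * s a + 2 * gpq a * s a + gpp a * gqq a)"
      using spos[OF that]
      by (simp_all add: V1_def V2_def gpp_def[symmetric] gqq_def[symmetric] gpq_def[symmetric] ipc field_simps)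
    then show "ip22 (V1 a) (V1 a) = 0" "ip22 (V2 a) (V2 a) = 0"
      using sq[OF that] spos[OF that] by auto
  qed
  have V0: "V1 a0 = tang X a0 p" "V2 a0 = tang X a0 q"
    by (simp_all add: V1_def V2_def g0)
  have "V1 a0 \<noteq> 0" "V2 a0 \<noteq> 0"
    using g0 unfolding V0 gpq_def by auto
  then obtain z1 w1 z2 w2 where zw: "ip22 (V1 a0) (tens z1 w1) \<noteq> 0" "ip22 (V2 a0) (tens z2 w2) \<noteq> 0"
    using tens_spans by metis
  define m1 where "m1 a = - 2 * ip22 (V1 a) (tens z1 w1)" for a
  define m2 where "m2 a = - 2 * ip22 (V2 a) (tens z2 w2)" for a
  define n where "n a = ip22 (V1 a) (V2 a) * (1 - gpp a / s a * (gqq a / s a)) * (m1 a * m2 a)" for a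
  have sm: "smooth_on U1 m1" "smooth_on U1 m2"
    unfolding m1_def m2_def by (intro smooth_intros U1 sV)+
  have sn: "smooth_on U1 n"
    unfolding n_def using spos
    by (intro smooth_intros U1 sV sm ss smooth_on_subset[OF sg(1)] smooth_on_subset[OF sg(2)]; force)
  define B where "B = {a \<in> U1. n a \<noteq> 0}"
  have B: "open B" "B \<subseteq> U1" unfolding B_def using open_nonzero_set[OF U1(1) sn] by auto
  have aB: "a0 \<in> B"
    using a1 zw g0 by (simp add: B_def n_def V0 m1_def m2_def gpq_def[symmetric])
  have Bn: "ip22 (V1 a) (V2 a) \<noteq> 0" "1 - gpp a / s a * (gqq a / s a) \<noteq> 0" "m1 a \<noteq> 0" "m2 a \<noteq> 0" "a \<in> U1" "a \<in> U"
    if "a \<in> B" for a using that U1 by (auto simp: B_def n_def)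
  define \<xi> where "\<xi> a = cL (V1 a) w1" for a
  define \<xi>' where "\<xi>' a = cL (V2 a) w2" for a
  define \<eta>' where "\<eta>' a = (1 / m1 a) *\<^sub>R cR (V1 a) z1" for a
  define \<eta> where "\<eta> a = (1 / m2 a) *\<^sub>R cR (V2 a) z2" for a
  have sVB: "smooth_on B V1" "smooth_on B V2" "smooth_on B m1" "smooth_on B m2"
    using sV sm B smooth_on_subset by blast+
  have s\<xi>: "smooth_on B \<xi>" "smooth_on B \<xi>'" "smooth_on B \<eta>" "smooth_on B \<eta>'"
    unfolding \<xi>_def \<xi>'_def \<eta>_def \<eta>'_def cL_def cR_def
    by (intro smooth_intros B sVB Bn; assumption)+
  have V1: "V1 a = tens (\<xi> a) (\<eta>' a)" if "a \<in> B" for a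
  proof -
    have "m1 a *\<^sub>R V1 a = tens (\<xi> a) (cR (V1 a) z1)"
      unfolding m1_def \<xi>_def by (rule null_factor[OF null(1)[OF Bn(5)[OF that]]])
    then have "(1 / m1 a) *\<^sub>R (m1 a *\<^sub>R V1 a) = tens (\<xi> a) (\<eta>' a)" by (simp add: \<eta>'_def tens_scaleR_right)
    then show ?thesis using Bn(3)[OF that] by simp
  qed
  have V2: "V2 a = tens (\<xi>' a) (\<eta> a)" if "a \<in> B" for a
  proof -
    have "m2 a *\<^sub>R V2 a = tens (\<xi>' a) (cR (V2 a) z2)"
      unfolding m2_def \<xi>'_def by (rule null_factor[OF null(2)[OF Bn(5)[OF that]]])
    then have "(1 / m2 a) *\<^sub>R (m2 a *\<^sub>R V2 a) = tens (\<xi>' a) (\<eta> a)" by (simp add: \<eta>_def tens_scaleR_right)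
    then show ?thesis using Bn(4)[OF that] by simp
  qed
  have brnz: "br (\<xi> a) (\<xi>' a) \<noteq> 0" "br (\<eta> a) (\<eta>' a) \<noteq> 0" if "a \<in> B" for a
    using Bn(1)[OF that] br_commute[of "\<eta> a" "\<eta>' a"] unfolding V1[OF that] V2[OF that] ip22_tens by auto
  define x' where "x' a = (1 / br (\<xi> a) (\<xi>' a)) *\<^sub>R \<xi>' a" for a
  define y' where "y' a = (1 / br (\<eta> a) (\<eta>' a)) *\<^sub>R \<eta>' a" for a
  interpret F: spin_frame B \<xi> x' \<eta> y' X
  proof
    show "open B" by (rule B)
    show "smooth_on B \<xi>" "smooth_on B \<eta>" by (rule s\<xi>)+
    show "smooth_on B x'" "smooth_on B y'"
      unfolding x'_def y'_def by (intro smooth_intros B s\<xi> brnz; assumption)+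
    show "br (\<xi> a) (x' a) = 1" "br (\<eta> a) (y' a) = 1" if "a \<in> B" for a
      using brnz[OF that] by (simp_all add: x'_def y'_def)
    show "smooth_on B X" using smooth_on_subset[OF sX] B U1 by blast
    fix a h assume a: "a \<in> B"
    have key: "ip22 (tang X a h) e = 0" if "ip22 (V1 a) e = 0" "ip22 (V2 a) e = 0" for e
    proof -
      let ?r = "gpp a / s a" and ?l = "gqq a / s a"
      let ?P = "ip22 (tang X a p) e" and ?Q = "ip22 (tang X a q) e"
      have "?P + ?r * ?Q = 0" "?Q + ?l * ?P = 0" using that by (simp_all add: V1_def V2_def)
      then have "(1 - ?r * ?l) * ?P = 0" "(1 - ?r * ?l) * ?Q = 0" by algebra+
      then have PQ: "?P = 0" "?Q = 0" using Bn(2)[OF a] by auto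
      have "a \<in> U" using a B U1 by blast
      then show ?thesis
        by (subst pq[of h]) (simp add: linear_add[OF ltang] linear_scale[OF ltang] PQ)
    qed
    show "ip22 (tang X a h) (tens (\<xi> a) (\<eta> a)) = 0"
      by (rule key) (simp_all add: V1[OF a] V2[OF a] ip22_tens)
    show "ip22 (tang X a h) (tens (x' a) (y' a)) = 0"
      by (rule key) (simp_all add: V1[OF a] V2[OF a] ip22_tens x'_def y'_def)
  qed
  have "immersed_spin_frame B \<xi> x' \<eta> y' X"
  proof
    fix a assume a: "a \<in> B"
    have e: "F.al h a = sre h * F.al 1 a + sim h * F.al \<sigma> a" "F.be h a = sre h * F.be 1 a + sim h * F.be \<sigma> a" for h
      using linear_A_expand[OF F.al_linear[OF a], of h] linear_A_expand[OF F.be_linear[OF a], of h] by simp_all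
    have gs: "gpp a = F.al p a * F.be p a" "gqq a = F.al q a * F.be q a"
      "gpq a = (F.al p a * F.be q a + F.al q a * F.be p a) / 2"
      unfolding gpp_def gqq_def gpq_def F.tang_eq[OF a] using a by (simp_all add: field_simps)
    have "4 * D a = (F.al p a * F.be q a - F.al q a * F.be p a) * (F.al p a * F.be q a - F.al q a * F.be p a)"
      unfolding D_def gs by (simp add: field_simps)
    also have "F.al p a * F.be q a - F.al q a * F.be p a = (F.al 1 a * F.be \<sigma> a - F.al \<sigma> a * F.be 1 a) * E"
      unfolding e[of p] e[of q] E_def by algebra
    finally show "F.al 1 a * F.be \<sigma> a - F.al \<sigma> a * F.be 1 a \<noteq> 0"
      using U1D(1)[OF Bn(5)[OF a]] by auto
  qed
  then show ?thesis using that aB B U1 by blast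
qed

section \<open>The representation data of a frame\<close>

lemma chain_dd:
  assumes "f differentiable (at (\<phi> w))" "\<phi> differentiable (at w)"
  shows "dd h (\<lambda>w. f (\<phi> w)) w = dd (dd h \<phi> w) f (\<phi> w)"
  by (rule dd_eqI[OF has_derivative_compose]) (use assms frechet_derivative_works in blast)+

text \<open>All the data can be read off the frame: \<open>g\<close> is given by the spinors, and \<open>\<lambda>, \<mu>\<close> by \<open>al\<close>. The normal part of
  \<open>codazzi\<close> determines \<open>be\<close> by \<open>al\<close>; its tangent part then yields the equations on \<open>\<lambda>, \<mu>\<close>.\<close>

theorem frame_representation:
  assumes W: "simply_connected W" and \<epsilon>: "\<epsilon> = 1 \<or> \<epsilon> = -1"
    and F: "immersed_spin_frame W x x' y y' X" and fe: "frame_eqs W \<theta>1 \<theta>2 \<epsilon> x x' y y'"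
    and s\<theta>: "smooth_on W \<theta>1" "smooth_on W \<theta>2"
    and d\<theta>: "\<And>a. a \<in> W \<Longrightarrow> dd \<sigma> \<theta>1 a = dd 1 \<theta>2 a" "\<And>a. a \<in> W \<Longrightarrow> dd \<sigma> \<theta>2 a = dd 1 \<theta>1 a"
  shows "\<exists>\<psi> lam mu g w1 w2. representation_data W \<psi> \<theta>1 \<theta>2 lam mu \<epsilon> g w1 w2
    \<and> primitive_of W (xi_form g w1 w2) X"
proof -
  interpret S: immersed_spin_frame W x x' y y' X by fact
  note forms = S.frame_forms[OF fe]
  define \<psi> where "\<psi> a = SC (\<theta>1 a) (\<theta>2 a)" for a
  define lam where "lam a = exp (- \<theta>1 a) * S.al 1 a" for a
  define mu where "mu a = - (exp (- \<theta>1 a) * S.al \<sigma> a)" for a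
  define g where "g a = qspin (x a, x' a, y a, y' a)" for a
  define w1 where "w1 a h = be_form \<epsilon> \<theta>1 lam mu h a / sqrt 2" for a h
  define w2 where "w2 a h = al_form \<theta>1 lam mu h a / sqrt 2" for a h
  have ee: "exp (\<theta>1 a) * exp (- \<theta>1 a) = 1" "exp (\<theta>1 a) * (exp (- \<theta>1 a) * z) = z" for a z
    by (simp_all add: exp_minus)
  have al: "S.al h a = al_form \<theta>1 lam mu h a" if "a \<in> W" for h a
    unfolding S.al_be_coord(1)[OF that, of h] al_form_def lam_def mu_def
    by (simp add: algebra_simps ee)
  have be: "S.be h a = be_form \<epsilon> \<theta>1 lam mu h a" if a: "a \<in> W" for h a
  proof -
    let ?E = "exp (\<theta>1 a)" and ?T = "exp (\<theta>2 a)"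
    have pos: "?E > 0" "?T > 0" by simp_all
    have x: "exp (\<theta>1 a + \<theta>2 a) = ?E * ?T" "exp (\<theta>1 a - \<theta>2 a) = ?E / ?T" "exp (- (\<theta>1 a + \<theta>2 a)) = 1 / (?E * ?T)"
      "exp (- (\<theta>1 a - \<theta>2 a)) = ?T / ?E" "exp (- \<theta>1 a) = 1 / ?E"
      by (simp_all add: exp_add exp_diff exp_minus field_simps)
    have "\<epsilon> * (S.al 1 a - S.al \<sigma> a) = ?E * ?E * (S.be 1 a + S.be \<sigma> a)"
      using S.codazzi(1)[OF a, of 1 \<sigma>] pos unfolding forms[OF a] x by (simp add: field_simps)
    moreover have "?T * (\<epsilon> * (S.al 1 a + S.al \<sigma> a)) = ?T * (?E * ?E * (S.be 1 a - S.be \<sigma> a))"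
      using S.codazzi(2)[OF a, of 1 \<sigma>] pos unfolding forms[OF a] x by (simp add: field_simps)
    then have "\<epsilon> * (S.al 1 a + S.al \<sigma> a) = ?E * ?E * (S.be 1 a - S.be \<sigma> a)" by simp
    ultimately have b: "\<epsilon> * S.al 1 a = ?E * ?E * S.be 1 a" "- \<epsilon> * S.al \<sigma> a = ?E * ?E * S.be \<sigma> a"
      by (simp_all add: algebra_simps)
    have "?E * ?E * be_form \<epsilon> \<theta>1 lam mu h a = sre h * (\<epsilon> * S.al 1 a) + sim h * (- \<epsilon> * S.al \<sigma> a)"
      unfolding be_form_def lam_def mu_def x(5) using pos by (simp add: field_simps)
    also have "\<dots> = ?E * ?E * S.be h a"
      unfolding S.al_be_coord(2)[OF a, of h] b by (simp add: algebra_simps)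
    finally have "?E * ?E * S.be h a = ?E * ?E * be_form \<epsilon> \<theta>1 lam mu h a" ..
    then show ?thesis using pos by simp
  qed
  have slm: "smooth_on W lam" "smooth_on W mu"
    unfolding lam_def[abs_def] mu_def[abs_def]
    by (intro smooth_on_mult smooth_on_exp smooth_on_minus S.smooth_al S.open_U s\<theta>)+
  have nz: "lam a * mu a \<noteq> 0" if a: "a \<in> W" for a
  proof -
    have "S.Jac a = 2 * \<epsilon> * (lam a * mu a)"
      unfolding S.Jac_def al[OF a] be[OF a] al_form_def be_form_def by (simp add: exp_minus field_simps)
    then show ?thesis using S.Jac_nz[OF a] by auto
  qed
  have pde: "dd 1 mu a = - lam a * dd 1 \<theta>2 a \<and> dd \<sigma> lam a = - mu a * dd \<sigma> \<theta>2 a" if a: "a \<in> W" for a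
  proof -
    let ?E = "exp (\<theta>1 a)"
    note e = dd_al_be_form[OF smooth_on_differentiable[OF s\<theta>(1) a] smooth_on_differentiable[OF slm(1) a]
        smooth_on_differentiable[OF slm(2) a]]
    have ad: "dd j (S.al h) a = dd j (al_form \<theta>1 lam mu h) a" for j h
      by (rule dd_cong[OF S.open_U a al])
    have bd: "dd j (S.be h) a = dd j (be_form \<epsilon> \<theta>1 lam mu h) a" for j h
      by (rule dd_cong[OF S.open_U a be])
    have "?E * (dd \<sigma> lam a + dd \<sigma> \<theta>1 a * lam a) = ?E * (- dd 1 mu a - dd 1 \<theta>1 a * mu a)"
      using S.codazzi(4)[OF a, of 1 \<sigma>] unfolding ad e forms[OF a] by (simp add: algebra_simps)
    then have 1: "dd \<sigma> lam a + dd \<sigma> \<theta>1 a * lam a = - dd 1 mu a - dd 1 \<theta>1 a * mu a" by simp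
    have "(\<epsilon> * exp (- \<theta>1 a)) * (dd \<sigma> lam a - dd \<sigma> \<theta>1 a * lam a) = (\<epsilon> * exp (- \<theta>1 a)) * (dd 1 mu a - dd 1 \<theta>1 a * mu a)"
      using S.codazzi(3)[OF a, of 1 \<sigma>] unfolding bd e forms[OF a] by (simp add: algebra_simps)
    then have 2: "dd \<sigma> lam a - dd \<sigma> \<theta>1 a * lam a = dd 1 mu a - dd 1 \<theta>1 a * mu a" using \<epsilon> by auto
    have "dd \<sigma> lam a = - (dd 1 \<theta>1 a * mu a)" "dd 1 mu a = - (dd \<sigma> \<theta>1 a * lam a)"
      using 1 2 by linarith+
    then show ?thesis unfolding d\<theta>[OF a] by (simp add: mult.commute)
  qed
  have conf: "conformal_A W \<psi>"
    unfolding conformal_A_def d_u_def d_v_def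
  proof (intro conjI ballI)
    show "smooth_on W \<psi>" unfolding \<psi>_def[abs_def] by (intro smooth_intros S.open_U s\<theta>)
    fix a assume a: "a \<in> W"
    have "dd h \<psi> a = SC (dd h \<theta>1 a) (dd h \<theta>2 a)" for h
      unfolding \<psi>_def[abs_def]
      by (rule dd_eqI) (intro has_derivative_SC smooth_on_deriv[OF s\<theta>(1) a] smooth_on_deriv[OF s\<theta>(2) a])
    then show "dd \<sigma> \<psi> a = \<sigma> * dd 1 \<psi> a" using d\<theta>[OF a] by (simp add: splitc_eq_iff)
  qed
  have sp: "spin_eq W \<psi> \<epsilon> g"
    unfolding g_def[abs_def]
    by (rule spin_of_spinors[OF \<epsilon> S.L.spinor_pair_axioms S.R.spinor_pair_axioms fe]) (simp add: \<psi>_def)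
  have "representation_data W \<psi> \<theta>1 \<theta>2 lam mu \<epsilon> g w1 w2"
    unfolding representation_data_iff
    using S.open_U W conf slm pde nz \<epsilon> sp by (auto simp: \<psi>_def w1_def w2_def)
  moreover have "primitive_of W (xi_form g w1 w2) X"
  proof -
    have "\<forall>a\<in>W. \<forall>h. xi_form g w1 w2 a h = r22 (tang X a h)"
    proof (intro ballI allI)
      fix a h assume a: "a \<in> W"
      have "g a \<in> Spin22" using sp a by (auto simp: spin_eq_def)
      from xi_form_eq[where g = g, OF this, of w1 w2 h]
      show "xi_form g w1 w2 a h = r22 (tang X a h)"
        unfolding S.tang_eq[OF a] by (simp add: g_def w1_def w2_def al[OF a] be[OF a] S.T1_def S.T2_def)
    qed
    from primitive_of_iff[OF this] show ?thesis
      using smooth_on_deriv[OF S.smooth_X] by (simp add: tang_def[abs_def])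
  qed
  ultimately show ?thesis by blast
qed

section \<open>Flat frames\<close>

lemma immersed_spin_frame_subset:
  assumes "immersed_spin_frame U x x' y y' X" "open V" "V \<subseteq> U"
  shows "immersed_spin_frame V x x' y y' X"
proof -
  interpret S: immersed_spin_frame U x x' y y' X by fact
  interpret T: spin_frame V x x' y y' X
    using assms(2,3) S.L.unimodular S.R.unimodular S.adapted
    by unfold_locales (auto intro: smooth_on_subset[OF S.L.smooth_x] smooth_on_subset[OF S.L.smooth_x']
        smooth_on_subset[OF S.R.smooth_x] smooth_on_subset[OF S.R.smooth_x'] smooth_on_subset[OF S.smooth_X])
  show ?thesis
    by unfold_locales (use S.nondeg assms(3) in blast)
qed

context spinor_pair
begin

text \<open>Rescaling the pair by \<open>exp (-f)\<close> and \<open>exp f\<close> subtracts \<open>df\<close> from the connection form, and \<open>om\<close> is closed when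
  \<open>cf \<and> bf = 0\<close>.\<close>

lemma gauge:
  assumes sc: "simply_connected U"
    and flat: "\<And>a. a \<in> U \<Longrightarrow> cf 1 a * bf \<sigma> a = cf \<sigma> a * bf 1 a"
  obtains f where "smooth_on U f" "spinor_pair U (\<lambda>a. exp (- f a) *\<^sub>R x a) (\<lambda>a. exp (f a) *\<^sub>R x' a)"
    "\<And>a h. a \<in> U \<Longrightarrow> spinor_pair.om (\<lambda>a. exp (- f a) *\<^sub>R x a) (\<lambda>a. exp (f a) *\<^sub>R x' a) h a = 0"
proof -
  have "dd \<sigma> (om 1) a = dd 1 (om \<sigma>) a" if "a \<in> U" for a
    using om_structure[OF that, of \<sigma> 1] flat[OF that] by simp
  from closed_form_exact[OF open_U sc smooth_om smooth_om this]
  obtain f where f: "\<And>a. a \<in> U \<Longrightarrow> (f has_derivative (\<lambda>h. sre h * om 1 a + sim h * om \<sigma> a)) (at a)"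
    by blast
  have fd: "(f has_derivative (\<lambda>h. om h a)) (at a)" if "a \<in> U" for a
    by (rule has_derivative_eq_rhs[OF f[OF that]]) (rule ext, simp add: linear_A_expand[OF om_linear[OF that], symmetric] flip: real_scaleR_def)
  have sf: "smooth_on U f" by (rule smooth_onI[OF open_U fd smooth_om])
  let ?x = "\<lambda>a. exp (- f a) *\<^sub>R x a" and ?x' = "\<lambda>a. exp (f a) *\<^sub>R x' a"
  have "spinor_pair U ?x ?x'"
  proof
    show "smooth_on U ?x" "smooth_on U ?x'"
      by (intro smooth_on_scaleR smooth_on_exp smooth_on_minus sf smooth_x smooth_x' open_U)+
  qed (use open_U unimodular in \<open>auto simp: exp_minus\<close>)
  moreover have "spinor_pair.om ?x ?x' h a = 0" if a: "a \<in> U" for h a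
  proof -
    interpret N: spinor_pair U ?x ?x' by fact
    have "dd h ?x a = exp (- f a) *\<^sub>R dd h x a + (- om h a * exp (- f a)) *\<^sub>R x a"
      by (rule dd_eqI[where f' = "\<lambda>h. exp (- f a) *\<^sub>R dd h x a + (- om h a * exp (- f a)) *\<^sub>R x a"])
        (auto intro!: derivative_eq_intros fd[OF a] smooth_on_deriv[OF smooth_x a])
    also have "\<dots> = (exp (- f a) * cf h a) *\<^sub>R x' a"
      unfolding dd_x[OF a] by (simp add: algebra_simps)
    finally show ?thesis by (simp add: N.om_def)
  qed
  ultimately show ?thesis using that sf by blast
qed

text \<open>If \<open>om = 0\<close> then \<open>cf\<close> and \<open>bf = k cf\<close> are both closed, so \<open>dk \<and> cf = 0\<close>, and the product of \<open>cf\<close> with any function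
  of \<open>k\<close> is closed. With the square root the product of the coefficients of \<open>cf\<close> and \<open>bf\<close> on \<open>ds\<close> becomes \<open>\<plusminus> 1\<close>.\<close>

lemma unit_speed:
  assumes sc: "simply_connected U" and om: "\<And>a h. a \<in> U \<Longrightarrow> om h a = 0"
    and k: "smooth_on U k" "\<And>a h. a \<in> U \<Longrightarrow> bf h a = k a * cf h a"
    and e: "\<And>a. a \<in> U \<Longrightarrow> e * k a > 0"
  obtains s where "\<And>a. a \<in> U \<Longrightarrow> (s has_derivative (\<lambda>h. sqrt (e * k a) * cf h a)) (at a)"
    "\<And>a h j. a \<in> U \<Longrightarrow> dd h k a * cf j a = dd j k a * cf h a"
proof -
  have om': "dd h (cf j) a = dd j (cf h) a" "dd h (bf j) a = dd j (bf h) a" if "a \<in> U" for h j a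
    using cf_structure[OF that, of h j] bf_structure[OF that, of h j] om[OF that] by auto
  have dk: "dd h k a * cf j a = dd j k a * cf h a" if a: "a \<in> U" for a h j
  proof -
    have "dd h (bf j) a = k a * dd h (cf j) a + dd h k a * cf j a" for h j
    proof -
      have "dd h (bf j) a = dd h (\<lambda>a. k a * cf j a) a" by (rule dd_cong[OF open_U a k(2)])
      then show ?thesis
        by (simp add: dd_mult[OF smooth_on_differentiable[OF k(1) a] smooth_on_differentiable[OF smooth_cf a]])
    qed
    from this[of h j] this[of j h] om'[OF a, of h j] show ?thesis by simp
  qed
  define r where "r a = sqrt (e * k a)" for a
  have r: "r a > 0" "r a * r a = e * k a" if "a \<in> U" for a
    using e[OF that] by (simp_all add: r_def)
  have sr: "smooth_on U r"
    unfolding r_def by (intro smooth_on_sqrt smooth_on_mult smooth_on_const open_U k e)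
  have sP: "smooth_on U (\<lambda>a. r a * cf h a)" for h
    by (intro smooth_on_mult open_U sr smooth_cf)
  have "dd \<sigma> (\<lambda>a. r a * cf 1 a) a = dd 1 (\<lambda>a. r a * cf \<sigma> a) a" if a: "a \<in> U" for a
  proof -
    have dr: "2 * r a * dd h r a = e * dd h k a" for h
    proof -
      have "dd h (\<lambda>a. r a * r a) a = dd h (\<lambda>a. e * k a) a" by (rule dd_cong[OF open_U a r(2)])
      then show ?thesis
        using smooth_on_differentiable[OF sr a] smooth_on_differentiable[OF k(1) a] by (simp add: dd_mult)
    qed
    have "2 * r a * (dd \<sigma> r a * cf 1 a) = 2 * r a * (dd 1 r a * cf \<sigma> a)"
      using dr[of \<sigma>] dr[of 1] dk[OF a, of \<sigma> 1] by algebra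
    then have "dd \<sigma> r a * cf 1 a = dd 1 r a * cf \<sigma> a" using r(1)[OF a] by simp
    then show ?thesis
      using om'(1)[OF a, of \<sigma> 1]
      by (simp add: dd_mult[OF smooth_on_differentiable[OF sr a] smooth_on_differentiable[OF smooth_cf a]])
  qed
  from closed_form_exact[OF open_U sc sP sP this]
  obtain s where s: "\<And>a. a \<in> U \<Longrightarrow> (s has_derivative (\<lambda>h. sre h * (r a * cf 1 a) + sim h * (r a * cf \<sigma> a))) (at a)"
    by blast
  have "(s has_derivative (\<lambda>h. sqrt (e * k a) * cf h a)) (at a)" if "a \<in> U" for a
  proof (rule has_derivative_eq_rhs[OF s[OF that]], rule ext)
    fix h
    have "cf h a = sre h * cf 1 a + sim h * cf \<sigma> a"
      using linear_A_expand[OF cf_linear[OF that], of h] by simp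
    then show "sre h * (r a * cf 1 a) + sim h * (r a * cf \<sigma> a) = sqrt (e * k a) * cf h a"
      by (simp add: r_def algebra_simps)
  qed
  then show ?thesis using that dk by blast
qed

end

lemma flat_frame:
  assumes "immersed_spin_frame U x x' y y' X" and sc: "simply_connected U"
    and K: "\<And>a. a \<in> U \<Longrightarrow> gauss_curvature X a = 0" "\<And>a. a \<in> U \<Longrightarrow> normal_curvature X a = 0"
  obtains p p' q q' where "immersed_spin_frame U p p' q q' X"
    "\<And>a h. a \<in> U \<Longrightarrow> spinor_pair.om p p' h a = 0" "\<And>a h. a \<in> U \<Longrightarrow> spinor_pair.om q q' h a = 0"
proof -
  interpret S: immersed_spin_frame U x x' y y' X by fact
  have flat: "S.L.cf 1 a * S.L.bf \<sigma> a = S.L.cf \<sigma> a * S.L.bf 1 a"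
    "S.R.cf 1 a * S.R.bf \<sigma> a = S.R.cf \<sigma> a * S.R.bf 1 a" if "a \<in> U" for a
  proof -
    have "S.L.cf 1 a * S.L.bf \<sigma> a - S.L.cf \<sigma> a * S.L.bf 1 a = S.R.cf 1 a * S.R.bf \<sigma> a - S.R.cf \<sigma> a * S.R.bf 1 a"
      using S.gauss_curvature_zero_iff[OF that] K(1)[OF that] by blast
    moreover have "(S.L.cf 1 a * S.L.bf \<sigma> a - S.L.cf \<sigma> a * S.L.bf 1 a) + (S.R.cf 1 a * S.R.bf \<sigma> a - S.R.cf \<sigma> a * S.R.bf 1 a) = 0"
      using S.normal_curvature_zero_iff[OF that] K(2)[OF that] by blast
    ultimately show "S.L.cf 1 a * S.L.bf \<sigma> a = S.L.cf \<sigma> a * S.L.bf 1 a"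
      "S.R.cf 1 a * S.R.bf \<sigma> a = S.R.cf \<sigma> a * S.R.bf 1 a" by linarith+
  qed
  obtain f where f: "smooth_on U f" "spinor_pair U (\<lambda>a. exp (- f a) *\<^sub>R x a) (\<lambda>a. exp (f a) *\<^sub>R x' a)"
    "\<And>a h. a \<in> U \<Longrightarrow> spinor_pair.om (\<lambda>a. exp (- f a) *\<^sub>R x a) (\<lambda>a. exp (f a) *\<^sub>R x' a) h a = 0"
    using S.L.gauge[OF sc flat(1)] by blast
  obtain f2 where f2: "smooth_on U f2" "spinor_pair U (\<lambda>a. exp (- f2 a) *\<^sub>R y a) (\<lambda>a. exp (f2 a) *\<^sub>R y' a)"
    "\<And>a h. a \<in> U \<Longrightarrow> spinor_pair.om (\<lambda>a. exp (- f2 a) *\<^sub>R y a) (\<lambda>a. exp (f2 a) *\<^sub>R y' a) h a = 0"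
    using S.R.gauge[OF sc flat(2)] by blast
  let ?x = "\<lambda>a. exp (- f a) *\<^sub>R x a" and ?x' = "\<lambda>a. exp (f a) *\<^sub>R x' a"
  let ?y = "\<lambda>a. exp (- f2 a) *\<^sub>R y a" and ?y' = "\<lambda>a. exp (f2 a) *\<^sub>R y' a"
  interpret L: spinor_pair U ?x ?x' by (rule f(2))
  interpret R: spinor_pair U ?y ?y' by (rule f2(2))
  interpret T: spin_frame U ?x ?x' ?y ?y' X
    by unfold_locales (use S.smooth_X S.adapted in \<open>auto simp: tens_scaleR_left tens_scaleR_right\<close>)
  have "immersed_spin_frame U ?x ?x' ?y ?y' X"
  proof
    fix a assume a: "a \<in> U"
    have t: "T.al h a = exp (f a) * exp (- f2 a) * S.al h a" "T.be h a = exp (- f a) * exp (f2 a) * S.be h a" for h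
      by (simp_all add: T.al_def S.al_def T.be_def S.be_def T.T1_def T.T2_def S.T1_def S.T2_def
          tens_scaleR_left tens_scaleR_right)
    have "T.al 1 a * T.be \<sigma> a - T.al \<sigma> a * T.be 1 a = S.Jac a"
      unfolding t S.Jac_def by (simp add: exp_minus field_simps)
    then show "T.al 1 a * T.be \<sigma> a - T.al \<sigma> a * T.be 1 a \<noteq> 0" using S.Jac_nz[OF a] by simp
  qed
  then show ?thesis using that f(3) f2(3) by blast
qed

section \<open>Adapted coordinates\<close>

text \<open>If \<open>c \<and> b = 0\<close> and \<open>c \<and> d \<noteq> 0\<close> then \<open>b = r c\<close>, where the factor \<open>r = (b \<and> d) / (c \<and> d)\<close> depends smoothly on the
  coefficients of the forms.\<close>

lemma proportional_forms:
  fixes b1 :: real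
  assumes "c1 * b2 = c2 * b1" and w: "c1 * d2 - c2 * d1 \<noteq> 0"
  defines "r \<equiv> (b1 * d2 - b2 * d1) / (c1 * d2 - c2 * d1)"
  shows "s * b1 + t * b2 = r * (s * c1 + t * c2)"
proof -
  have "(c1 * d2 - c2 * d1) * (s * b1 + t * b2) = (b1 * d2 - b2 * d1) * (s * c1 + t * c2)"
    using assms(1) by algebra
  then show ?thesis using w by (simp add: r_def field_simps)
qed

text \<open>The situation after a change of gauge. The functions \<open>kL\<close> and \<open>kR\<close> below are the factors of
  proportionality between \<open>bf\<close> and \<open>cf\<close> for the two pairs.\<close>

locale flat_spin_frame = immersed_spin_frame +
  assumes om0: "\<And>a h. a \<in> U \<Longrightarrow> L.om h a = 0" "\<And>a h. a \<in> U \<Longrightarrow> R.om h a = 0"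
    and flat: "\<And>a. a \<in> U \<Longrightarrow> L.cf 1 a * L.bf \<sigma> a = L.cf \<sigma> a * L.bf 1 a"
      "\<And>a. a \<in> U \<Longrightarrow> R.cf 1 a * R.bf \<sigma> a = R.cf \<sigma> a * R.bf 1 a"
    and Delta_pos: "\<And>a. a \<in> U \<Longrightarrow> Delta X a > 0"
begin

definition cw :: "A \<Rightarrow> real" where "cw a = L.cf 1 a * R.cf \<sigma> a - L.cf \<sigma> a * R.cf 1 a"
definition kL :: "A \<Rightarrow> real" where "kL a = (L.bf 1 a * R.cf \<sigma> a - L.bf \<sigma> a * R.cf 1 a) / cw a"
definition kR :: "A \<Rightarrow> real" where "kR a = (L.cf 1 a * R.bf \<sigma> a - L.cf \<sigma> a * R.bf 1 a) / cw a"

lemma cw_nz: "a \<in> U \<Longrightarrow> cw a \<noteq> 0"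
  using Delta_pos[of a] Delta_pos_iff[of a] flat[of a] by (fastforce simp: cw_def)

lemma bf_eq:
  assumes a: "a \<in> U"
  shows "L.bf h a = kL a * L.cf h a" "R.bf h a = kR a * R.cf h a"
proof -
  note e = linear_A_expand[OF L.bf_linear[OF a], of h] linear_A_expand[OF L.cf_linear[OF a], of h]
    linear_A_expand[OF R.bf_linear[OF a], of h] linear_A_expand[OF R.cf_linear[OF a], of h]
  have w: "L.cf 1 a * R.cf \<sigma> a - L.cf \<sigma> a * R.cf 1 a \<noteq> 0" using cw_nz[OF a] by (simp add: cw_def)
  then have w': "R.cf 1 a * L.cf \<sigma> a - R.cf \<sigma> a * L.cf 1 a \<noteq> 0" by (simp add: mult.commute)
  show "L.bf h a = kL a * L.cf h a"
    using proportional_forms[OF flat(1)[OF a] w, of "sre h" "sim h"] e by (simp add: kL_def cw_def)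
  have "kR a = (R.bf 1 a * L.cf \<sigma> a - R.bf \<sigma> a * L.cf 1 a) / (R.cf 1 a * L.cf \<sigma> a - R.cf \<sigma> a * L.cf 1 a)"
    using w w' by (simp add: kR_def cw_def frac_eq_eq) (simp add: algebra_simps)
  then show "R.bf h a = kR a * R.cf h a"
    using proportional_forms[OF flat(2)[OF a] w', of "sre h" "sim h"] e by simp
qed

lemma kL_kR_pos: assumes a: "a \<in> U" shows "kL a * kR a > 0"
proof -
  have "(L.bf 1 a * R.bf \<sigma> a - L.bf \<sigma> a * R.bf 1 a) * cw a > 0"
    using Delta_pos[OF a] Delta_pos_iff[OF a flat(1)[OF a] flat(2)[OF a]] by (simp add: cw_def)
  then have "kL a * kR a * (cw a * cw a) > 0"
    unfolding bf_eq[OF a] by (simp add: cw_def algebra_simps)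
  then show ?thesis using zero_less_mult_pos2[of "kL a * kR a" "cw a * cw a"] cw_nz[OF a]
    by (simp add: zero_less_mult_iff)
qed

lemma smooth_k: "smooth_on U kL" "smooth_on U kR"
proof -
  have scw: "smooth_on U cw" unfolding cw_def[abs_def]
    by (intro smooth_on_diff smooth_on_mult open_U L.smooth_cf R.smooth_cf)
  show "smooth_on U kL" "smooth_on U kR"
    unfolding kL_def[abs_def] kR_def[abs_def]
    by (intro scw smooth_on_divide smooth_on_diff smooth_on_mult open_U L.smooth_bf L.smooth_cf R.smooth_bf R.smooth_cf cw_nz;
      assumption)+
qed

end

text \<open>The frame is restricted to balls around \<open>a0\<close>, for simple connectedness and in order that
  \<open>kL\<close> has a constant sign, which is \<open>-\<epsilon>\<close>; \<open>kR\<close> has the same sign by the condition on \<open>\<Delta>\<close>.\<close>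

lemma flat_spin_frame_exists:
  assumes U: "open U" "a0 \<in> U" and X: "lorentzian_immersion U X"
    and K: "\<And>a. a \<in> U \<Longrightarrow> gauss_curvature X a = 0" "\<And>a. a \<in> U \<Longrightarrow> normal_curvature X a = 0"
    and D: "\<And>a. a \<in> U \<Longrightarrow> Delta X a > 0"
  obtains B x x' y y' \<epsilon> where "simply_connected B" "a0 \<in> B" "B \<subseteq> U" "flat_spin_frame B x x' y y' X"
    "\<epsilon> = 1 \<or> \<epsilon> = -1"
    "\<And>a. a \<in> B \<Longrightarrow> - \<epsilon> * flat_spin_frame.kL x x' y a > 0 \<and> - \<epsilon> * flat_spin_frame.kR x y y' a > 0"
proof -
  obtain B0 where B0: "a0 \<in> B0" "B0 \<subseteq> U" "\<exists>x x' y y'. immersed_spin_frame B0 x x' y y' X"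
    using spin_frame_exists[OF U X] by metis
  then obtain x0 x0' y0 y0' where F0: "immersed_spin_frame B0 x0 x0' y0 y0' X" by blast
  interpret F0: immersed_spin_frame B0 x0 x0' y0 y0' X by fact
  obtain r where r: "r > 0" "ball a0 r \<subseteq> B0" using openE[OF F0.open_U B0(1)] by blast
  have F1: "immersed_spin_frame (ball a0 r) x0 x0' y0 y0' X"
    by (rule immersed_spin_frame_subset[OF F0 open_ball r(2)])
  have sc: "simply_connected (ball a r)" for a :: A and r
    by (intro convex_imp_simply_connected convex_ball)
  obtain x x' y y' where F: "immersed_spin_frame (ball a0 r) x x' y y' X"
    and om: "\<And>a h. a \<in> ball a0 r \<Longrightarrow> spinor_pair.om x x' h a = 0" "\<And>a h. a \<in> ball a0 r \<Longrightarrow> spinor_pair.om y y' h a = 0"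
  proof (rule flat_frame[OF F1 sc])
    show "gauss_curvature X a = 0" "normal_curvature X a = 0" if "a \<in> ball a0 r" for a
      using K that r B0 by blast+
  qed blast
  interpret F: immersed_spin_frame "ball a0 r" x x' y y' X by fact
  interpret F: flat_spin_frame "ball a0 r" x x' y y' X
  proof
    fix a assume a: "a \<in> ball a0 r"
    then have aU: "a \<in> U" using r B0 by blast
    have "F.L.cf 1 a * F.L.bf \<sigma> a - F.L.cf \<sigma> a * F.L.bf 1 a = F.R.cf 1 a * F.R.bf \<sigma> a - F.R.cf \<sigma> a * F.R.bf 1 a"
      using F.gauss_curvature_zero_iff[OF a] K(1)[OF aU] by blast
    moreover have "(F.L.cf 1 a * F.L.bf \<sigma> a - F.L.cf \<sigma> a * F.L.bf 1 a) + (F.R.cf 1 a * F.R.bf \<sigma> a - F.R.cf \<sigma> a * F.R.bf 1 a) = 0"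
      using F.normal_curvature_zero_iff[OF a] K(2)[OF aU] by blast
    ultimately show "F.L.cf 1 a * F.L.bf \<sigma> a = F.L.cf \<sigma> a * F.L.bf 1 a"
      "F.R.cf 1 a * F.R.bf \<sigma> a = F.R.cf \<sigma> a * F.R.bf 1 a" by linarith+
    show "Delta X a > 0" by (rule D[OF aU])
  qed (use om in auto)
  have a0: "a0 \<in> ball a0 r" using r by simp
  define \<epsilon> where "\<epsilon> = - sgn (F.kL a0)"
  have "F.kL a0 \<noteq> 0" using F.kL_kR_pos[OF a0] by auto
  then have \<epsilon>: "\<epsilon> = 1 \<or> \<epsilon> = -1" and pos0: "- \<epsilon> * F.kL a0 > 0"
    by (auto simp: \<epsilon>_def sgn_if)
  define V where "V = {a \<in> ball a0 r. - \<epsilon> * F.kL a > 0}"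
  have "open V"
    unfolding V_def by (rule open_positive_set[OF open_ball]) (intro smooth_on_mult smooth_on_const open_ball F.smooth_k)
  moreover have "a0 \<in> V" using a0 pos0 by (simp add: V_def)
  ultimately obtain d where d: "d > 0" "ball a0 d \<subseteq> V" by (meson openE)
  let ?B = "ball a0 d"
  have sub: "?B \<subseteq> ball a0 r" using d(2) unfolding V_def by blast
  interpret G: immersed_spin_frame ?B x x' y y' X
    by (rule immersed_spin_frame_subset[OF F open_ball sub])
  have "flat_spin_frame ?B x x' y y' X"
    by unfold_locales (use sub F.om0 F.flat F.Delta_pos in blast)+
  moreover have "- \<epsilon> * F.kL a > 0 \<and> - \<epsilon> * F.kR a > 0" if "a \<in> ?B" for a
  proof -
    have 1: "- \<epsilon> * F.kL a > 0" using that d(2) unfolding V_def by blast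
    have "(- \<epsilon> * F.kL a) * (- \<epsilon> * F.kR a) = F.kL a * F.kR a" using \<epsilon> by auto
    also have "\<dots> > 0" using F.kL_kR_pos that sub by blast
    finally show ?thesis using 1 zero_less_mult_pos by blast
  qed
  ultimately show ?thesis
    using that[of ?B x x' y y' \<epsilon>] sc d(1) sub r B0 \<epsilon> by (meson centre_in_ball order_trans)
qed

text \<open>The primitives of \<open>\<epsilon> k\<^sub>1 cf\<close> and \<open>k\<^sub>2 cf'\<close>, where \<open>k\<^sub>1 = \<bar>kL\<bar>\<^sup>1\<^sup>/\<^sup>2\<close> and \<open>k\<^sub>2 = \<bar>kR\<bar>\<^sup>1\<^sup>/\<^sup>2\<close>, are the null coordinates
  \<open>u + v\<close> and \<open>u - v\<close>. The components of \<open>\<psi>\<close> are \<open>ln k\<^sub>1\<close> and \<open>- ln k\<^sub>2\<close>; each of them depends only on the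
  corresponding null coordinate, which is conformality. The choice of signs is possible because either null coordinate
  may be replaced by its opposite.\<close>

theorem local_representation:
  assumes U: "open U" "a0 \<in> U" and X: "lorentzian_immersion U X"
    and K: "\<And>a. a \<in> U \<Longrightarrow> gauss_curvature X a = 0" "\<And>a. a \<in> U \<Longrightarrow> normal_curvature X a = 0"
    and D: "\<And>a. a \<in> U \<Longrightarrow> Delta X a > 0"
  obtains B W \<phi> \<phi>i \<psi> \<theta>1 \<theta>2 lam mu \<epsilon> g w1 w2 where
    "open B" "a0 \<in> B" "B \<subseteq> U" "open W" "homeomorphism B W \<phi> \<phi>i" "smooth_on B \<phi>" "smooth_on W \<phi>i"
    "representation_data W \<psi> \<theta>1 \<theta>2 lam mu \<epsilon> g w1 w2"
    "primitive_of W (xi_form g w1 w2) (\<lambda>w. X (\<phi>i w))"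
proof -
  obtain B0 x x' y y' \<epsilon> where B0: "simply_connected B0" "a0 \<in> B0" "B0 \<subseteq> U" and F: "flat_spin_frame B0 x x' y y' X"
    and \<epsilon>: "\<epsilon> = 1 \<or> \<epsilon> = -1"
    and pos: "\<And>a. a \<in> B0 \<Longrightarrow> - \<epsilon> * flat_spin_frame.kL x x' y a > 0 \<and> - \<epsilon> * flat_spin_frame.kR x y y' a > 0"
    using flat_spin_frame_exists[OF U X K D] by blast
  interpret F: flat_spin_frame B0 x x' y y' X by fact
  have ee: "\<epsilon> * \<epsilon> = 1" using \<epsilon> by auto
  define k1 where "k1 a = sqrt (- \<epsilon> * F.kL a)" for a
  define k2 where "k2 a = sqrt (- \<epsilon> * F.kR a)" for a
  have k: "k1 a > 0" "k2 a > 0" "k1 a * k1 a = - \<epsilon> * F.kL a" "k2 a * k2 a = - \<epsilon> * F.kR a" if "a \<in> B0" for a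
    using pos[OF that] by (simp_all add: k1_def k2_def)
  have sk: "smooth_on B0 k1" "smooth_on B0 k2"
    unfolding k1_def k2_def
    by (intro smooth_on_sqrt smooth_on_mult smooth_on_const F.open_U F.smooth_k; use pos in blast)+
  have pos1: "- \<epsilon> * F.kL a > 0" and pos2: "- \<epsilon> * F.kR a > 0" if "a \<in> B0" for a using pos[OF that] by auto
  obtain sL where sL: "\<And>a. a \<in> B0 \<Longrightarrow> (sL has_derivative (\<lambda>h. k1 a * F.L.cf h a)) (at a)"
    and dkL: "\<And>a h j. a \<in> B0 \<Longrightarrow> dd h F.kL a * F.L.cf j a = dd j F.kL a * F.L.cf h a"
    using F.L.unit_speed[OF B0(1) F.om0(1) F.smooth_k(1) F.bf_eq(1) pos1] unfolding k1_def by blast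
  obtain sR where sR: "\<And>a. a \<in> B0 \<Longrightarrow> (sR has_derivative (\<lambda>h. k2 a * F.R.cf h a)) (at a)"
    and dkR: "\<And>a h j. a \<in> B0 \<Longrightarrow> dd h F.kR a * F.R.cf j a = dd j F.kR a * F.R.cf h a"
    using F.R.unit_speed[OF B0(1) F.om0(2) F.smooth_k(2) F.bf_eq(2) pos2] unfolding k2_def by blast
  define \<phi> where "\<phi> a = SC (1/2 * (\<epsilon> * sL a + sR a)) (1/2 * (\<epsilon> * sL a - sR a))" for a
  define d\<phi> where "d\<phi> a h = SC (1/2 * (\<epsilon> * (k1 a * F.L.cf h a) + k2 a * F.R.cf h a))
      (1/2 * (\<epsilon> * (k1 a * F.L.cf h a) - k2 a * F.R.cf h a))" for a h
  have \<phi>d: "(\<phi> has_derivative d\<phi> a) (at a)" if "a \<in> B0" for a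
    unfolding \<phi>_def[abs_def] d\<phi>_def[abs_def]
    by (intro has_derivative_SC has_derivative_mult_right has_derivative_add has_derivative_diff sL sR that)
  have s\<phi>: "smooth_on B0 \<phi>"
  proof (rule smooth_onI[OF F.open_U \<phi>d])
    show "smooth_on B0 (\<lambda>a. d\<phi> a h)" for h
      unfolding d\<phi>_def
      by (intro smooth_on_SC smooth_on_add smooth_on_diff smooth_on_mult smooth_on_const F.open_U sk F.L.smooth_cf F.R.smooth_cf)
  qed
  have d\<phi>: "dd h \<phi> a = d\<phi> a h" if "a \<in> B0" for a h by (rule dd_eqI[OF \<phi>d[OF that]])
  have wedge: "F.L.cf h a * F.R.cf j a - F.L.cf j a * F.R.cf h a = F.cw a * (sre h * sim j - sim h * sre j)"
    if a: "a \<in> B0" for h j a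
  proof -
    note e = linear_A_expand[OF F.L.cf_linear[OF a]] linear_A_expand[OF F.R.cf_linear[OF a]]
    show ?thesis
      unfolding F.cw_def e(1)[of h] e(1)[of j] e(2)[of h] e(2)[of j] real_scaleR_def by algebra
  qed
  have inj: "h = 0" if "dd h \<phi> a0 = 0" for h
  proof -
    have "sre (d\<phi> a0 h) = 0" "sim (d\<phi> a0 h) = 0"
      using that d\<phi>[OF B0(2)] by simp_all
    moreover have "1/2 * (u + v) = 0 \<Longrightarrow> 1/2 * (u - v) = 0 \<Longrightarrow> u = 0 \<and> v = 0" for u v :: real by simp
    ultimately have "\<epsilon> * (k1 a0 * F.L.cf h a0) = 0 \<and> k2 a0 * F.R.cf h a0 = 0"
      unfolding d\<phi>_def splitc.sel by blast
    then have "F.L.cf h a0 = 0" "F.R.cf h a0 = 0" using k[OF B0(2)] \<epsilon> by auto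
    then have "sre h * sim j - sim h * sre j = 0" for j
      using wedge[OF B0(2), of h j] F.cw_nz[OF B0(2)] by simp
    from this[of 1] this[of \<sigma>] show "h = 0" by (simp add: splitc_eq_iff)
  qed
  obtain B W \<phi>i where B: "open B" "a0 \<in> B" "B \<subseteq> B0" and W: "open W" "simply_connected W"
    and hom: "homeomorphism B W \<phi> \<phi>i" and s\<phi>i: "smooth_on W \<phi>i"
    and inv: "\<And>w h. w \<in> W \<Longrightarrow> dd (dd h \<phi>i w) \<phi> (\<phi>i w) = h"
    using smooth_inverse_function[OF F.open_U B0(2) s\<phi> inj] by blast
  have im: "\<phi>i w \<in> B0" if "w \<in> W" for w using hom that B(3) by (auto simp: homeomorphism_def)
  then have im': "\<phi>i ` W \<subseteq> B0" by blast
  have comp: "smooth_on W (\<lambda>w. f (\<phi>i w))" if "smooth_on B0 f" for f :: "A \<Rightarrow> 'b::real_normed_vector"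
    by (rule smooth_on_compose_A[OF W(1) F.open_U that s\<phi>i im'])
  \<comment> \<open>The vector at \<open>\<phi>i w\<close> in the old coordinates that is \<open>h\<close> in the new ones.\<close>
  define kk where "kk h w = dd h \<phi>i w" for h w
  have chain: "dd h (\<lambda>w. f (\<phi>i w)) w = dd (kk h w) f (\<phi>i w)" if "smooth_on B0 f" "w \<in> W" for f :: "A \<Rightarrow> 'b::real_normed_vector" and h w
    unfolding kk_def
    by (rule chain_dd[OF smooth_on_differentiable[OF that(1) im[OF that(2)]] smooth_on_differentiable[OF s\<phi>i that(2)]])
  have cfk: "F.L.cf (kk h w) (\<phi>i w) = \<epsilon> * (sre h + sim h) / k1 (\<phi>i w)"
    "F.R.cf (kk h w) (\<phi>i w) = (sre h - sim h) / k2 (\<phi>i w)" if w: "w \<in> W" for h w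
  proof -
    let ?a = "\<phi>i w"
    have "d\<phi> ?a (kk h w) = h" using inv[OF w] d\<phi>[OF im[OF w]] by (simp add: kk_def)
    then have "sre h = 1/2 * (\<epsilon> * (k1 ?a * F.L.cf (kk h w) ?a) + k2 ?a * F.R.cf (kk h w) ?a)"
      "sim h = 1/2 * (\<epsilon> * (k1 ?a * F.L.cf (kk h w) ?a) - k2 ?a * F.R.cf (kk h w) ?a)"
      by (auto simp: d\<phi>_def splitc_eq_iff)
    moreover have "s = 1/2 * (u + v) \<Longrightarrow> t = 1/2 * (u - v) \<Longrightarrow> s + t = u \<and> s - t = v" for s t u v :: real by (simp add: field_simps)
    ultimately have "sre h + sim h = \<epsilon> * (k1 ?a * F.L.cf (kk h w) ?a) \<and> sre h - sim h = k2 ?a * F.R.cf (kk h w) ?a" by blast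
    then show "F.L.cf (kk h w) ?a = \<epsilon> * (sre h + sim h) / k1 ?a" "F.R.cf (kk h w) ?a = (sre h - sim h) / k2 ?a"
      using k[OF im[OF w]] ee by (simp_all add: mult.assoc[symmetric])
  qed
  have wedge_kk: "sre (kk 1 w) * sim (kk \<sigma> w) - sim (kk 1 w) * sre (kk \<sigma> w) \<noteq> 0" if w: "w \<in> W" for w
  proof
    assume 0: "sre (kk 1 w) * sim (kk \<sigma> w) - sim (kk 1 w) * sre (kk \<sigma> w) = 0"
    have "F.L.cf (kk 1 w) (\<phi>i w) * F.R.cf (kk \<sigma> w) (\<phi>i w) - F.L.cf (kk \<sigma> w) (\<phi>i w) * F.R.cf (kk 1 w) (\<phi>i w) = 0"
      unfolding wedge[OF im[OF w]] 0 by simp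
    then have "- 2 * \<epsilon> / (k1 (\<phi>i w) * k2 (\<phi>i w)) = 0"
      unfolding cfk[OF w] by (simp add: field_simps)
    then show False using k[OF im[OF w]] \<epsilon> by auto
  qed
  interpret L: spinor_pair W "\<lambda>w. x (\<phi>i w)" "\<lambda>w. x' (\<phi>i w)"
    by unfold_locales (use W im F.L.unimodular in \<open>auto intro: comp F.L.smooth_x F.L.smooth_x'\<close>)
  interpret R: spinor_pair W "\<lambda>w. y (\<phi>i w)" "\<lambda>w. y' (\<phi>i w)"
    by unfold_locales (use W im F.R.unimodular in \<open>auto intro: comp F.R.smooth_x F.R.smooth_x'\<close>)
  let ?X = "\<lambda>w. X (\<phi>i w)"
  have tangW: "tang ?X w h = tang X (\<phi>i w) (kk h w)" if "w \<in> W" for w h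
    unfolding tang_def by (rule chain[OF F.smooth_X that])
  interpret S: spin_frame W "\<lambda>w. x (\<phi>i w)" "\<lambda>w. x' (\<phi>i w)" "\<lambda>w. y (\<phi>i w)" "\<lambda>w. y' (\<phi>i w)" ?X
    by unfold_locales (use im F.adapted in \<open>auto simp: tangW intro: comp F.smooth_X\<close>)
  have imm: "immersed_spin_frame W (\<lambda>w. x (\<phi>i w)) (\<lambda>w. x' (\<phi>i w)) (\<lambda>w. y (\<phi>i w)) (\<lambda>w. y' (\<phi>i w)) ?X"
  proof
    fix w assume w: "w \<in> W"
    have "S.al h w = F.al (kk h w) (\<phi>i w)" "S.be h w = F.be (kk h w) (\<phi>i w)" for h
      by (simp_all add: S.al_def S.be_def F.al_def F.be_def tangW[OF w] S.T1_def S.T2_def F.T1_def F.T2_def)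
    then show "S.al 1 w * S.be \<sigma> w - S.al \<sigma> w * S.be 1 w \<noteq> 0"
      using F.al_be_wedge[OF im[OF w], of "kk 1 w" "kk \<sigma> w"] F.Jac_nz[OF im[OF w]] wedge_kk[OF w] by simp
  qed
  define p where "p w = 1/2 * ln (- \<epsilon> * F.kL (\<phi>i w))" for w
  define q where "q w = - (1/2) * ln (- \<epsilon> * F.kR (\<phi>i w))" for w
  define \<theta>1 where "\<theta>1 w = 1/2 * (p w + q w)" for w
  define \<theta>2 where "\<theta>2 w = 1/2 * (p w - q w)" for w
  have sp: "smooth_on W p" "smooth_on W q"
    unfolding p_def q_def
    by (intro smooth_on_mult smooth_on_const smooth_on_ln comp F.smooth_k W(1) pos1 pos2 im; assumption)+
  have s\<theta>: "smooth_on W \<theta>1" "smooth_on W \<theta>2"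
    unfolding \<theta>1_def \<theta>2_def by (intro smooth_on_mult smooth_on_add smooth_on_diff smooth_on_const sp W(1))+
  have expp: "exp (p w) = k1 (\<phi>i w)" "exp (q w) = 1 / k2 (\<phi>i w)" if w: "w \<in> W" for w
  proof -
    have es: "exp (1/2 * ln z) = sqrt z" "exp (- (1/2) * ln z) = 1 / sqrt z" if "z > 0" for z :: real
      using that by (simp_all add: powr_half_sqrt[symmetric] powr_def exp_minus inverse_eq_divide)
    show "exp (p w) = k1 (\<phi>i w)" "exp (q w) = 1 / k2 (\<phi>i w)"
      unfolding p_def q_def k1_def k2_def by (rule es, rule pos1[OF im[OF w]], rule es, rule pos2[OF im[OF w]])
  qed
  have th: "\<theta>1 w + \<theta>2 w = p w" "\<theta>1 w - \<theta>2 w = q w" for w by (simp_all add: \<theta>1_def \<theta>2_def field_simps)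
  have dpq: "dd h p w = dd (kk h w) F.kL (\<phi>i w) / (2 * F.kL (\<phi>i w))"
    "dd h q w = - dd (kk h w) F.kR (\<phi>i w) / (2 * F.kR (\<phi>i w))" if w: "w \<in> W" for w h
  proof -
    note d = smooth_on_deriv[OF comp[OF F.smooth_k(1)] w] smooth_on_deriv[OF comp[OF F.smooth_k(2)] w]
    have nz: "F.kL (\<phi>i w) \<noteq> 0" "F.kR (\<phi>i w) \<noteq> 0" "\<epsilon> \<noteq> 0"
      using F.kL_kR_pos[OF im[OF w]] \<epsilon> by auto
    have "dd h p w = dd h (\<lambda>w. F.kL (\<phi>i w)) w / (2 * F.kL (\<phi>i w))"
      unfolding p_def using nz pos1[OF im[OF w]]
      by (intro dd_eqI) (auto intro!: derivative_eq_intros d simp: fun_eq_iff field_simps)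
    then show "dd h p w = dd (kk h w) F.kL (\<phi>i w) / (2 * F.kL (\<phi>i w))"
      by (simp add: chain[OF F.smooth_k(1) w])
    have "dd h q w = - dd h (\<lambda>w. F.kR (\<phi>i w)) w / (2 * F.kR (\<phi>i w))"
      unfolding q_def using nz pos2[OF im[OF w]]
      by (intro dd_eqI) (auto intro!: derivative_eq_intros d simp: fun_eq_iff field_simps)
    then show "dd h q w = - dd (kk h w) F.kR (\<phi>i w) / (2 * F.kR (\<phi>i w))"
      by (simp add: chain[OF F.smooth_k(2) w])
  qed
  have dp: "dd \<sigma> p w = dd 1 p w" and dq: "dd \<sigma> q w = - dd 1 q w" if w: "w \<in> W" for w
  proof -
    have "dd (kk \<sigma> w) F.kL (\<phi>i w) = dd (kk 1 w) F.kL (\<phi>i w)"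
      using dkL[OF im[OF w], of "kk \<sigma> w" "kk 1 w"] k[OF im[OF w]] \<epsilon> unfolding cfk[OF w] by auto
    then show "dd \<sigma> p w = dd 1 p w" unfolding dpq[OF w] by simp
    have "dd (kk \<sigma> w) F.kR (\<phi>i w) = - dd (kk 1 w) F.kR (\<phi>i w)"
      using dkR[OF im[OF w], of "kk \<sigma> w" "kk 1 w"] k[OF im[OF w]] unfolding cfk[OF w] by (simp add: field_simps)
    then show "dd \<sigma> q w = - dd 1 q w" unfolding dpq[OF w] by simp
  qed
  have d\<theta>: "dd h \<theta>1 w = 1/2 * (dd h p w + dd h q w)" "dd h \<theta>2 w = 1/2 * (dd h p w - dd h q w)" if w: "w \<in> W" for h w
    unfolding \<theta>1_def[abs_def] \<theta>2_def[abs_def]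
    by (rule dd_eqI; intro has_derivative_mult_right has_derivative_add has_derivative_diff smooth_on_deriv[OF sp(1) w] smooth_on_deriv[OF sp(2) w])+
  have fe: "frame_eqs W \<theta>1 \<theta>2 \<epsilon> (\<lambda>w. x (\<phi>i w)) (\<lambda>w. x' (\<phi>i w)) (\<lambda>w. y (\<phi>i w)) (\<lambda>w. y' (\<phi>i w))"
    unfolding frame_eqs_def
  proof (intro ballI allI)
    fix w h assume w: "w \<in> W"
    let ?a = "\<phi>i w"
    have a: "?a \<in> B0" by (rule im[OF w])
    have kLR: "F.kL ?a = - \<epsilon> * (k1 ?a * k1 ?a)" "F.kR ?a = - \<epsilon> * (k2 ?a * k2 ?a)"
      unfolding k(3,4)[OF a] using \<epsilon> by auto
    have e: "exp (\<theta>1 w + \<theta>2 w) = k1 ?a" "exp (- (\<theta>1 w + \<theta>2 w)) = 1 / k1 ?a"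
      "exp (\<theta>1 w - \<theta>2 w) = 1 / k2 ?a" "exp (- (\<theta>1 w - \<theta>2 w)) = k2 ?a"
      unfolding th exp_minus expp[OF w] by (simp_all add: field_simps)
    have c: "F.L.bf (kk h w) ?a = - (k1 ?a * (sre h + sim h))" "F.R.bf (kk h w) ?a = - (\<epsilon> * k2 ?a * (sre h - sim h))"
      unfolding F.bf_eq[OF a] kLR cfk[OF w] using k(1,2)[OF a] \<epsilon> by (auto simp: field_simps)
    show "dd h (\<lambda>w. x (\<phi>i w)) w = (\<epsilon> * exp (- (\<theta>1 w + \<theta>2 w)) * (sre h + sim h)) *\<^sub>R x' ?a
      \<and> dd h (\<lambda>w. x' (\<phi>i w)) w = - (exp (\<theta>1 w + \<theta>2 w) * (sre h + sim h)) *\<^sub>R x ?a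
      \<and> dd h (\<lambda>w. y (\<phi>i w)) w = (exp (\<theta>1 w - \<theta>2 w) * (sre h - sim h)) *\<^sub>R y' ?a
      \<and> dd h (\<lambda>w. y' (\<phi>i w)) w = - (\<epsilon> * exp (- (\<theta>1 w - \<theta>2 w)) * (sre h - sim h)) *\<^sub>R y ?a"
      unfolding e chain[OF F.L.smooth_x w] chain[OF F.L.smooth_x' w] chain[OF F.R.smooth_x w] chain[OF F.R.smooth_x' w]
        F.L.dd_x[OF a] F.L.dd_x'[OF a] F.R.dd_x[OF a] F.R.dd_x'[OF a] F.om0[OF a] c cfk[OF w]
      by simp
  qed
  have "\<exists>\<psi> lam mu g w1 w2. representation_data W \<psi> \<theta>1 \<theta>2 lam mu \<epsilon> g w1 w2 \<and> primitive_of W (xi_form g w1 w2) ?X"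
    by (rule frame_representation[OF W(2) \<epsilon> imm fe s\<theta>]) (simp_all add: d\<theta> dp dq)
  then show ?thesis
    using that[OF B(1,2) _ W(1) hom smooth_on_subset[OF s\<phi> B(3)] s\<phi>i] B(3) B0(3) by blast
qed

section \<open>Charts of abstract surfaces\<close>

text \<open>The charts of an atlas are homeomorphisms on open sets, hence open maps.\<close>

lemma chart_open_image:
  assumes "chart M V c" "openin M N" "N \<subseteq> V"
  shows "open (c ` N)"
proof -
  have "open_map (subtopology M V) (top_of_set (c ` V)) c"
    using assms(1) homeomorphic_imp_open_map by (auto simp: chart_def)
  moreover have "openin (subtopology M V) N"
    using assms openin_open_subtopology[of M V N] by (auto simp: chart_def)
  ultimately have "openin (top_of_set (c ` V)) (c ` N)"
    by (auto simp: open_map_def)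
  then show ?thesis
    using assms(1) by (simp add: chart_def openin_open_eq)
qed

lemma chart_inj_on: "chart M V c \<Longrightarrow> inj_on c V"
  using homeomorphic_imp_injective_map[of "subtopology M V" "top_of_set (c ` V)" c] openin_subset[of M V]
  by (auto simp: chart_def inf_absorb2)

lemma homeomorphic_map_euclidean:
  assumes "homeomorphism S T f g" shows "homeomorphic_map (top_of_set S) (top_of_set T) f"
proof -
  have "homeomorphic_maps (top_of_set S) (top_of_set T) f g"
    using assms by (auto simp: homeomorphic_maps_def homeomorphism_def)
  then show ?thesis using homeomorphic_maps_map by blast
qed

text \<open>A chart of the maximal atlas is obtained from a given one by restriction and composition with a
  diffeomorphism between open subsets of the plane.\<close>

lemma reparametrized_chart:
  assumes A: "\<forall>W d. (W, d) \<in> \<A> \<longrightarrow> chart M W d" and c0: "chart M V0 c0"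
    and comp: "\<forall>W d. (W, d) \<in> \<A> \<longrightarrow> compatible V0 c0 W d"
    and B: "open B" "B \<subseteq> c0 ` V0" and W: "open W" and hom: "homeomorphism B W \<phi> \<phi>i"
    and s: "smooth_on B \<phi>" "smooth_on W \<phi>i"
  defines "V \<equiv> {q \<in> V0. c0 q \<in> B}" and "c \<equiv> \<phi> \<circ> c0"
  shows "smooth_chart M \<A> V c" "c ` V = W" "\<And>w. w \<in> W \<Longrightarrow> the_inv_into V c w = the_inv_into V0 c0 (\<phi>i w)"
proof -
  have inj0: "inj_on c0 V0" by (rule chart_inj_on[OF c0])
  have V0: "openin M V0" "open (c0 ` V0)" and h0: "homeomorphic_map (subtopology M V0) (top_of_set (c0 ` V0)) c0"
    using c0 by (auto simp: chart_def)
  have ts: "topspace (subtopology M V0) = V0"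
    using openin_subset[OF V0(1)] by (simp add: inf_absorb2)
  have c0V: "c0 ` V = B" using B(2) by (auto simp: V_def)
  have homB: "\<phi> ` B = W" "\<phi>i ` W = B" "\<And>b. b \<in> B \<Longrightarrow> \<phi>i (\<phi> b) = b" "\<And>w. w \<in> W \<Longrightarrow> \<phi> (\<phi>i w) = w"
    using hom by (auto simp: homeomorphism_def)
  show cV: "c ` V = W"
    unfolding c_def image_comp[symmetric] c0V homB(1) ..
  have VV0: "V \<subseteq> V0" by (auto simp: V_def)
  have "openin (subtopology M V0) {q \<in> topspace (subtopology M V0). c0 q \<in> B}"
  proof (rule openin_continuous_map_preimage[OF homeomorphic_imp_continuous_map[OF h0]])
    show "openin (top_of_set (c0 ` V0)) B" using B V0 by (simp add: openin_open_eq)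
  qed
  then have "openin (subtopology M V0) V" unfolding ts V_def .
  then have oV: "openin M V" using openin_open_subtopology[OF V0(1)] by blast
  have "homeomorphic_map (subtopology (subtopology M V0) V) (subtopology (top_of_set (c0 ` V0)) B) c0"
    by (rule homeomorphic_map_subtopologies[OF h0]) (use c0V B VV0 ts in auto)
  then have hV: "homeomorphic_map (subtopology M V) (top_of_set B) c0"
    using VV0 B(2) by (simp add: subtopology_subtopology inf_absorb2)
  have "homeomorphic_map (subtopology M V) (top_of_set W) c"
    unfolding c_def by (rule homeomorphic_map_compose[OF hV homeomorphic_map_euclidean[OF hom]])
  then have ch: "chart M V c" using oV W cV by (simp add: chart_def)
  have inj: "inj_on c V" by (rule chart_inj_on[OF ch])
  show ti: "the_inv_into V c w = the_inv_into V0 c0 (\<phi>i w)" if "w \<in> W" for w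
  proof (rule the_inv_into_f_eq[OF inj])
    have b: "\<phi>i w \<in> B" using homB that by blast
    then have "\<phi>i w \<in> c0 ` V0" using B by blast
    then show "c (the_inv_into V0 c0 (\<phi>i w)) = w" "the_inv_into V0 c0 (\<phi>i w) \<in> V"
      using f_the_inv_into_f[OF inj0] the_inv_into_into[OF inj0] b homB(4)[OF that]
      by (auto simp: c_def V_def)
  qed
  have "compatible V c W' d" if "(W', d) \<in> \<A>" for W' d
    unfolding compatible_def
  proof
    have d: "chart M W' d" using A that by blast
    have cmp: "smooth_on (c0 ` (V0 \<inter> W')) (d \<circ> the_inv_into V0 c0)" "smooth_on (d ` (V0 \<inter> W')) (c0 \<circ> the_inv_into W' d)"
      using comp that by (auto simp: compatible_def)
    have o: "openin M (V \<inter> W')" "openin M (V0 \<inter> W')" using oV V0 d by (auto simp: chart_def)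
    have o1: "open (c ` (V \<inter> W'))" by (rule chart_open_image[OF ch o(1)]) auto
    have o2: "open (c0 ` (V0 \<inter> W'))" by (rule chart_open_image[OF c0 o(2)]) auto
    have o3: "open (d ` (V \<inter> W'))" by (rule chart_open_image[OF d o(1)]) auto
    have cW: "c ` (V \<inter> W') \<subseteq> W" using cV by blast
    show "smooth_on (c ` (V \<inter> W')) (d \<circ> the_inv_into V c)"
    proof (rule smooth_on_cong[OF o1])
      show "smooth_on (c ` (V \<inter> W')) (\<lambda>w. (d \<circ> the_inv_into V0 c0) (\<phi>i w))"
      proof (rule smooth_on_compose_A[OF o1 o2 cmp(1) smooth_on_subset[OF s(2) cW]])
        show "\<phi>i ` c ` (V \<inter> W') \<subseteq> c0 ` (V0 \<inter> W')"
          using homB(3) by (auto simp: c_def V_def)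
      qed
      show "(d \<circ> the_inv_into V0 c0) (\<phi>i w) = (d \<circ> the_inv_into V c) w" if "w \<in> c ` (V \<inter> W')" for w
        using ti[of w] that cW by auto
    qed
    have sub: "d ` (V \<inter> W') \<subseteq> d ` (V0 \<inter> W')" using VV0 by blast
    have "smooth_on (d ` (V \<inter> W')) (\<lambda>z. \<phi> ((c0 \<circ> the_inv_into W' d) z))"
    proof (rule smooth_on_compose_A[OF o3 B(1) s(1) smooth_on_subset[OF cmp(2) sub]])
      show "(c0 \<circ> the_inv_into W' d) ` d ` (V \<inter> W') \<subseteq> B"
        using the_inv_into_f_f[OF chart_inj_on[OF d]] by (auto simp: V_def)
    qed
    then show "smooth_on (d ` (V \<inter> W')) (c \<circ> the_inv_into W' d)"
      by (simp add: c_def o_def)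
  qed
  then show "smooth_chart M \<A> V c" using ch by (auto simp: smooth_chart_def)
qed

theorem surface_representation:
  fixes M :: "'m topology"
  assumes S: "smooth_surface M \<A>" and L: "in_charts \<A> lorentzian_immersion F"
    and K: "in_charts \<A> (\<lambda>U X. \<forall>a\<in>U. gauss_curvature X a = 0) F"
    and KN: "in_charts \<A> (\<lambda>U X. \<forall>a\<in>U. normal_curvature X a = 0) F"
    and D: "in_charts \<A> (\<lambda>U X. \<forall>a\<in>U. Delta X a > 0) F"
    and p: "p \<in> topspace M"
  shows "\<exists>V c. p \<in> V \<and> smooth_chart M \<A> V c
     \<and> (\<exists>\<psi> \<theta>1 \<theta>2 lam mu \<epsilon> g w1 w2.
          representation_data (c ` V) \<psi> \<theta>1 \<theta>2 lam mu \<epsilon> g w1 w2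
          \<and> primitive_of (c ` V) (xi_form g w1 w2) (F \<circ> the_inv_into V c))"
proof -
  have "p \<in> (\<Union>(V, c)\<in>\<A>. V)" using S p by (simp add: smooth_surface_def)
  then obtain V0 c0 where V0: "(V0, c0) \<in> \<A>" "p \<in> V0" by auto
  have A: "\<forall>W d. (W, d) \<in> \<A> \<longrightarrow> chart M W d" using S by (auto simp: smooth_surface_def)
  then have c0: "chart M V0 c0" using V0(1) by blast
  have comp: "\<forall>W d. (W, d) \<in> \<A> \<longrightarrow> compatible V0 c0 W d"
    using S V0(1) by (fastforce simp: smooth_surface_def)
  let ?U = "c0 ` V0" and ?X = "F \<circ> the_inv_into V0 c0"
  have U: "open ?U" "c0 p \<in> ?U" using c0 V0(2) by (auto simp: chart_def)
  have X: "lorentzian_immersion ?U ?X" "\<And>a. a \<in> ?U \<Longrightarrow> gauss_curvature ?X a = 0"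
    "\<And>a. a \<in> ?U \<Longrightarrow> normal_curvature ?X a = 0" "\<And>a. a \<in> ?U \<Longrightarrow> Delta ?X a > 0"
    using bspec[OF L[unfolded in_charts_def] V0(1)] bspec[OF K[unfolded in_charts_def] V0(1)]
      bspec[OF KN[unfolded in_charts_def] V0(1)] bspec[OF D[unfolded in_charts_def] V0(1)] by auto
  obtain B W \<phi> \<phi>i \<psi> \<theta>1 \<theta>2 lam mu \<epsilon> g w1 w2 where
    B: "open B" "c0 p \<in> B" "B \<subseteq> ?U" and W: "open W" and hom: "homeomorphism B W \<phi> \<phi>i"
    and s: "smooth_on B \<phi>" "smooth_on W \<phi>i"
    and rd: "representation_data W \<psi> \<theta>1 \<theta>2 lam mu \<epsilon> g w1 w2"
    and pr: "primitive_of W (xi_form g w1 w2) (\<lambda>w. ?X (\<phi>i w))"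
    using local_representation[OF U X] by blast
  define V where "V = {q \<in> V0. c0 q \<in> B}"
  define c where "c = \<phi> \<circ> c0"
  note ch = reparametrized_chart[OF A c0 comp B(1,3) W hom s, folded V_def c_def]
  have "primitive_of (c ` V) (xi_form g w1 w2) (F \<circ> the_inv_into V c)"
    unfolding primitive_of_def ch(2)
  proof
    fix w assume w: "w \<in> W"
    have "((r22 \<circ> (\<lambda>w. ?X (\<phi>i w))) has_derivative xi_form g w1 w2 w) (at w)"
      using pr w by (auto simp: primitive_of_def)
    then show "((r22 \<circ> (F \<circ> the_inv_into V c)) has_derivative xi_form g w1 w2 w) (at w)"
      by (rule has_derivative_transform_within_open[OF _ W w]) (simp add: ch(3))
  qed
  moreover have "p \<in> V" using V0 B by (simp add: V_def)
  moreover have "representation_data (c ` V) \<psi> \<theta>1 \<theta>2 lam mu \<epsilon> g w1 w2" unfolding ch(2) by (rule rd)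
  ultimately show ?thesis using ch(1) by (intro exI[of _ V] exI[of _ c] conjI) (assumption | rule exI conjI)+
qed

theorem theorem4:
  shows "(\<forall>U \<psi> \<theta>1 \<theta>2 lam mu \<epsilon> g w1 w2.
            representation_data U \<psi> \<theta>1 \<theta>2 lam mu \<epsilon> g w1 w2 \<longrightarrow>
              (\<exists>F. primitive_of U (xi_form g w1 w2) F)
              \<and> (\<forall>F. primitive_of U (xi_form g w1 w2) F \<longrightarrow>
                   lorentzian_immersion U F
                   \<and> (\<forall>a\<in>U. gauss_curvature F a = 0 \<and> normal_curvature F a = 0 \<and> Delta F a > 0)))
         \<and> (\<forall>(M :: 'm topology) \<A> F.
              smooth_surface M \<A>
              \<and> in_charts \<A> lorentzian_immersion F
              \<and> in_charts \<A> (\<lambda>U X. \<forall>a\<in>U. gauss_curvature X a = 0) F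
              \<and> in_charts \<A> (\<lambda>U X. \<forall>a\<in>U. normal_curvature X a = 0) F
              \<and> in_charts \<A> (\<lambda>U X. \<forall>a\<in>U. Delta X a > 0) F
              \<and> in_charts \<A> regular_gauss_map F \<longrightarrow>
                (\<forall>p\<in>topspace M. \<exists>V c. p \<in> V \<and> smooth_chart M \<A> V c
                   \<and> (\<exists>\<psi> \<theta>1 \<theta>2 lam mu \<epsilon> g w1 w2.
                        representation_data (c ` V) \<psi> \<theta>1 \<theta>2 lam mu \<epsilon> g w1 w2
                        \<and> primitive_of (c ` V) (xi_form g w1 w2) (F \<circ> the_inv_into V c))))"
proof (intro conjI allI impI)
  fix U \<psi> \<theta>1 \<theta>2 lam mu \<epsilon> g w1 w2
  assume "representation_data U \<psi> \<theta>1 \<theta>2 lam mu \<epsilon> g w1 w2"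
  note r = representation_immersion[OF this]
  show "\<exists>F. primitive_of U (xi_form g w1 w2) F" by (rule r(1))
  fix F assume F: "primitive_of U (xi_form g w1 w2) F"
  show "lorentzian_immersion U F" "\<forall>a\<in>U. gauss_curvature F a = 0 \<and> normal_curvature F a = 0 \<and> Delta F a > 0"
    using r(2)[OF F] by blast+
next
  fix M :: "'m topology" and \<A> F
  assume "smooth_surface M \<A>
              \<and> in_charts \<A> lorentzian_immersion F
              \<and> in_charts \<A> (\<lambda>U X. \<forall>a\<in>U. gauss_curvature X a = 0) F
              \<and> in_charts \<A> (\<lambda>U X. \<forall>a\<in>U. normal_curvature X a = 0) F
              \<and> in_charts \<A> (\<lambda>U X. \<forall>a\<in>U. Delta X a > 0) F
              \<and> in_charts \<A> regular_gauss_map F"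
  note A = this
  show "\<forall>p\<in>topspace M. \<exists>V c. p \<in> V \<and> smooth_chart M \<A> V c
                   \<and> (\<exists>\<psi> \<theta>1 \<theta>2 lam mu \<epsilon> g w1 w2.
                        representation_data (c ` V) \<psi> \<theta>1 \<theta>2 lam mu \<epsilon> g w1 w2
                        \<and> primitive_of (c ` V) (xi_form g w1 w2) (F \<circ> the_inv_into V c))"
    by (rule ballI, rule surface_representation) (use A in simp_all)
qed

end
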